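(* Let $\varepsilon>0$ and $x>0$, and let $r$ be an integer with $(1+\varepsilon)\operatorname{Log}_2 x\le r\le (2-\varepsilon)\operatorname{Log}_2 x$. Then \[ \mathbb{E}\big[\Delta(n_{<x})\,\mathbf{1}\{\omega(n_{<x})=r\}\big]\gg_\varepsilon (\operatorname{Log}_2 x)^{\eta_*-\varepsilon}. \]
   Context: $\Delta(n)\coloneqq \max_{u\in\mathbb{R}}\#\{d\mid n: e^u<d\le e^{u+1}\}$; $\omega(n)$ is the number of distinct prime factors of $n$; $\operatorname{Log} x\coloneqq\max\{1,\log x\}$, $\operatorname{Log}_2 x\coloneqq\operatorname{Log}(\operatorname{Log} x)$. Random model: for each prime $p$, $n_p$ equals $1$ with probability $\frac{p}{p+1}$ and $p$ with probability $\frac1{p+1}$, independently over $p$; $n_{<x}\coloneqq\prod_{p<x}n_p$. For a finite set $A\subset\mathbb{N}$, $m(A)$ is the largest $m$ such that there are distinct subsets $A_1,\dots,A_m\subseteq A$ with equal element sums. With $\mathbf{A}$ a random set containing each $a\in\mathbb{N}$ independently with probability $1/a$, $\beta_k$ is the supremum of constants $c<1$ with $\lim_{D\to\infty}\mathbb{P}(m(\mathbf{A}\cap[D^c,D])\ge k)=1$, and $\eta_*\coloneqq\liminf_{k\to\infty}\frac{\log k}{\log(1/\beta_k)}$. The implied constant depends only on $\varepsilon$. *)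

theory Defs
  imports "HOL-Probability.Probability" "HOL-Computational_Algebra.Primes"
begin

definition LogM :: "real \<Rightarrow> real" where
  "LogM x = max 1 (ln x)"

definition Log2 :: "real \<Rightarrow> real" where
  "Log2 x = LogM (LogM x)"

definition Delta :: "nat \<Rightarrow> nat" where
  "Delta n = Max {card {d. d dvd n \<and> exp u < real d \<and> real d \<le> exp (u + 1)} | u. True}"

definition omega :: "nat \<Rightarrow> nat" where
  "omega n = card (prime_factors n)"

definition np_pmf :: "nat \<Rightarrow> nat pmf" where
  "np_pmf p = map_pmf (\<lambda>b. if b then p else 1) (bernoulli_pmf (1 / (real p + 1)))"

definition n_lt_pmf :: "real \<Rightarrow> nat pmf" where
  "n_lt_pmf x = map_pmf (\<lambda>f. \<Prod>p\<in>{p. prime p \<and> real p < x}. f p)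
                  (Pi_pmf {p. prime p \<and> real p < x} 1 np_pmf)"

definition mEq :: "nat set \<Rightarrow> nat" where
  "mEq A = (GREATEST m. \<exists>F. F \<subseteq> Pow A \<and> card F = m \<and> (\<exists>s. \<forall>B\<in>F. \<Sum>B = s))"

(* distribution of the random set A \<inter> [D^c, D], where each positive integer a
   lies in A independently with probability 1/a *)
definition window :: "real \<Rightarrow> real \<Rightarrow> nat set" where
  "window D c = {a. 0 < a \<and> D powr c \<le> real a \<and> real a \<le> D}"

definition randA_window_pmf :: "real \<Rightarrow> real \<Rightarrow> nat set pmf" where
  "randA_window_pmf D c =
     map_pmf (\<lambda>f. {a \<in> window D c. f a})
       (Pi_pmf (window D c) False (\<lambda>a. bernoulli_pmf (1 / real a)))"

definition beta :: "nat \<Rightarrow> real" where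
  "beta k = Sup {c. c < 1 \<and>
     ((\<lambda>D. measure_pmf.prob (randA_window_pmf D c) {S. mEq S \<ge> k}) \<longlongrightarrow> 1) at_top}"

definition eta_star :: real where
  "eta_star = real_of_ereal (liminf (\<lambda>k. ereal (ln (real k) / ln (1 / beta k))))"

end

theory Submission
  imports Defs "HOL-Real_Asymp.Real_Asymp"
begin

text \<open>
  Write \<open>L\<close> for \<open>ln (ln x)\<close>. For \<open>j\<close> in a window of width \<open>sqrt L\<close> above \<open>l = r - L\<close>, weighting by the
  number of divisors composed of primes \<open>p\<close> with \<open>ln (ln p) < j\<close> turns the model into one where these primes occur with
  probability \<open>2 / (p + 2)\<close>, at the cost of a factor of order \<open>exp j\<close>. Under the tilted measure
  \<open>ln 2 * \<omega> - j\<close> increases up to \<open>j\<close> and decreases afterwards, so \<open>j\<close> is with high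
  probability its maximum along a grid of mesh \<open>L powr (\<epsilon> / 2)\<close>. As the maximum is attained at one \<open>j\<close> only, the
  contributions of the grid points can be added up; this compensates the loss of \<open>1 / sqrt L\<close> from
  fixing \<open>\<omega> = r\<close>, which is a local limit estimate for the primes below the window.

  The primes beyond \<open>j\<close>, sorted into cells of width \<open>exp j / r\<close> on the logarithmic scale, hit each cell \<open>a\<close> with
  probability close to \<open>1 / a\<close> by Mertens' theorem. Hence most of the about
  \<open>ln L / ln (1 / \<beta>\<^sub>k)\<close> scales \<open>[D powr c, D]\<close> contain \<open>k\<close> equal subset sums, and these
  multiply to about \<open>L powr (ln k / ln (1 / \<beta>\<^sub>k))\<close> products in an interval of logarithmic length of order \<open>exp j\<close>;
  the pigeonhole principle combines them with the divisors below \<open>j\<close>.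
\<close>

section \<open>Random subsets\<close>

text \<open>The pigeonhole bound at \<open>j\<close> is 2 to the number of primes with
  \<open>ln (ln p) < j\<close>, times the gain from the stages, divided by an interval length of
  order \<open>exp j\<close>. The tilt absorbs the power of 2, and its total mass, a product of
  factors \<open>1 + 1 / (p + 1)\<close>, is of order \<open>exp j\<close> as well; the two cancel,
  so every \<open>j\<close> contributes the stage gain times the probability of its event. Under the
  tilt the number of primes has mean about \<open>2 * j + (L - j)\<close>, which equals
  \<open>r\<close> at \<open>j = r - L\<close>. This is the origin of \<open>l\<close>, and the
  standard deviation of order \<open>sqrt L\<close> is that of the window. The lower bound on
  \<open>r\<close> makes \<open>l\<close> of order \<open>L\<close>, which keeps the local limit
  estimate within a constant of \<open>1 / sqrt L\<close>; the upper bound leaves room of order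
  \<open>L\<close> above \<open>j\<close> for the stages. The obstacle is to keep the rare event
  \<open>\<omega> = r\<close> apart from the others: only the primes with
  \<open>ln (ln p) < l\<close> adjust the count to \<open>r\<close>, while peak, sizes and stages
  are read off from the independent primes beyond. The peak is typical because
  \<open>2 * ln 2 > 1 > ln 2\<close>.\<close>

text \<open>Expectation of \<open>f\<close> over a random subset of \<open>P\<close> that contains each \<open>p\<close> independently with
  probability \<open>q p\<close>.\<close>

definition Esub :: "'a set \<Rightarrow> ('a \<Rightarrow> real) \<Rightarrow> ('a set \<Rightarrow> real) \<Rightarrow> real" where
  "Esub P q f = (\<Sum>T\<in>Pow P. (\<Prod>p\<in>P. if p \<in> T then q p else 1 - q p) * f T)"

lemma Esub_empty [simp]: "Esub {} q f = f {}"
  by (simp add: Esub_def)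

lemma Esub_insert:
  assumes "finite P" "a \<notin> P"
  shows "Esub (insert a P) q f = q a * Esub P q (\<lambda>T. f (insert a T)) + (1 - q a) * Esub P q f"
proof -
  have inj: "inj_on (insert a) (Pow P)"
    using assms(2) by (intro inj_onI) (metis PowD insert_ident subsetD)
  have dis: "Pow P \<inter> insert a ` Pow P = {}"
    using assms(2) by auto
  have c1: "(\<Prod>p\<in>P. if p \<in> insert a T then q p else 1 - q p) = (\<Prod>p\<in>P. if p \<in> T then q p else 1 - q p)" for T
    using assms(2) by (intro prod.cong) auto
  have "Esub (insert a P) q f
     = (\<Sum>T\<in>Pow P. (\<Prod>p\<in>insert a P. if p \<in> T then q p else 1 - q p) * f T)
     + (\<Sum>T\<in>Pow P. (\<Prod>p\<in>insert a P. if p \<in> insert a T then q p else 1 - q p) * f (insert a T))"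
    unfolding Esub_def Pow_insert using assms dis inj
    by (subst sum.union_disjoint) (auto simp: sum.reindex)
  also have "(\<Sum>T\<in>Pow P. (\<Prod>p\<in>insert a P. if p \<in> T then q p else 1 - q p) * f T)
      = (1 - q a) * Esub P q f"
    unfolding Esub_def sum_distrib_left using assms
    by (intro sum.cong refl) (auto simp: mult.assoc)
  also have "(\<Sum>T\<in>Pow P. (\<Prod>p\<in>insert a P. if p \<in> insert a T then q p else 1 - q p) * f (insert a T))
      = q a * Esub P q (\<lambda>T. f (insert a T))"
    unfolding Esub_def sum_distrib_left using assms
    by (intro sum.cong refl) (simp add: c1 mult.assoc del: insert_iff, simp)
  finally show ?thesis by simp
qed

lemma Esub_cong:
  assumes "\<And>p. p \<in> P \<Longrightarrow> q p = q' p" "\<And>T. T \<subseteq> P \<Longrightarrow> f T = g T"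
  shows "Esub P q f = Esub P q' g"
  unfolding Esub_def using assms by (intro sum.cong refl arg_cong2[of _ _ _ _ "(*)"] prod.cong) auto

lemma Esub_mono:
  assumes "\<And>p. p \<in> P \<Longrightarrow> 0 \<le> q p \<and> q p \<le> 1" "\<And>T. T \<subseteq> P \<Longrightarrow> f T \<le> g T"
  shows "Esub P q f \<le> Esub P q g"
  unfolding Esub_def using assms by (intro sum_mono mult_left_mono prod_nonneg) auto

lemma Esub_cmult: "Esub P q (\<lambda>T. c * f T) = c * Esub P q f"
  unfolding Esub_def sum_distrib_left by (simp add: mult_ac)

lemma Esub_add: "Esub P q (\<lambda>T. f T + g T) = Esub P q f + Esub P q g"
  unfolding Esub_def by (simp add: distrib_left sum.distrib)

lemma Esub_sum: "Esub P q (\<lambda>T. \<Sum>i\<in>I. f i T) = (\<Sum>i\<in>I. Esub P q (f i))"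
  unfolding Esub_def sum_distrib_left by (rule sum.swap)

lemma Esub_const: "finite P \<Longrightarrow> Esub P q (\<lambda>_. c) = c"
  by (induction P rule: finite_induct) (auto simp: Esub_insert algebra_simps)

lemma Esub_nonneg:
  assumes "\<And>p. p \<in> P \<Longrightarrow> 0 \<le> q p \<and> q p \<le> 1" "\<And>T. T \<subseteq> P \<Longrightarrow> 0 \<le> f T"
  shows "0 \<le> Esub P q f"
  unfolding Esub_def using assms by (intro sum_nonneg mult_nonneg_nonneg prod_nonneg) auto

text \<open>Independence of the parts in disjoint sets, in Fubini form: one part can be fixed while
  the other is averaged.\<close>

lemma Esub_Un:
  assumes "finite A" "finite B" "A \<inter> B = {}"
  shows "Esub (A \<union> B) q f = Esub A q (\<lambda>S. Esub B q (\<lambda>T. f (S \<union> T)))"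
  using assms
proof (induction A arbitrary: f rule: finite_induct)
  case (insert a A)
  have "Esub (insert a A \<union> B) q f = q a * Esub (A \<union> B) q (\<lambda>T. f (insert a T)) + (1 - q a) * Esub (A \<union> B) q f"
    using insert.hyps insert.prems by (simp add: Esub_insert)
  then show ?case
    using insert.hyps insert.prems by (simp add: Esub_insert insert.IH)
qed simp

lemma Esub_Int:
  assumes "finite P" "A \<subseteq> P"
  shows "Esub P q (\<lambda>T. f (T \<inter> A)) = Esub A q f"
proof -
  have P: "P = A \<union> (P - A)" using assms by auto
  have fin: "finite A" "finite (P - A)" using assms by (auto intro: finite_subset)
  have "Esub P q (\<lambda>T. f (T \<inter> A)) = Esub A q (\<lambda>S. Esub (P - A) q (\<lambda>T. f ((S \<union> T) \<inter> A)))"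
    by (subst P, subst Esub_Un) (use fin in auto)
  also have "\<dots> = Esub A q (\<lambda>S. Esub (P - A) q (\<lambda>T. f S))"
    by (intro Esub_cong) (auto intro!: arg_cong[of _ _ f])
  finally show ?thesis using fin by (simp add: Esub_const)
qed

text \<open>A coin with weights \<open>1 - q\<close> and \<open>q\<close> gets the weights
  \<open>1 - q\<close> and \<open>2 * q\<close>, of total mass \<open>1 + q\<close>. The product
  collects these masses; renormalising gives \<open>2 * q / (1 + q)\<close>, which is
  \<open>2 / (p + 2)\<close> for \<open>q = 1 / (p + 1)\<close>.\<close>

lemma Esub_tilt:
  assumes "finite P" "\<And>p. p \<in> P \<Longrightarrow> 0 \<le> q p"
  shows "Esub P q (\<lambda>T. 2 ^ card (T \<inter> A) * f T)
     = (\<Prod>p\<in>P \<inter> A. 1 + q p) * Esub P (\<lambda>p. if p \<in> A then 2 * q p / (1 + q p) else q p) f"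
  using assms
proof (induction P arbitrary: f rule: finite_induct)
  case (insert a P)
  let ?q = "\<lambda>p. if p \<in> A then 2 * q p / (1 + q p) else q p"
  have e: "Esub P q (\<lambda>T. 2 ^ card (insert a T \<inter> A) * f (insert a T))
        = (if a \<in> A then 2 else 1) * Esub P q (\<lambda>T. 2 ^ card (T \<inter> A) * f (insert a T))"
    unfolding Esub_cmult [symmetric]
  proof (intro Esub_cong refl)
    fix T assume "T \<subseteq> P"
    then have "a \<notin> T" "finite T" using insert.hyps by (auto intro: finite_subset)
    then show "2 ^ card (insert a T \<inter> A) * f (insert a T) =
         (if a \<in> A then 2 else 1) * (2 ^ card (T \<inter> A) * f (insert a T))"
      by (simp add: Int_insert_left)
  qed
  have q: "0 \<le> q a" using insert.prems by simp
  have IH: "Esub P q (\<lambda>T. 2 ^ card (T \<inter> A) * g T) = (\<Prod>p\<in>P \<inter> A. 1 + q p) * Esub P ?q g" for g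
    using insert.IH insert.prems by simp
  have "Esub (insert a P) q (\<lambda>T. 2 ^ card (T \<inter> A) * f T)
     = (\<Prod>p\<in>P \<inter> A. 1 + q p) * (q a * (if a \<in> A then 2 else 1) * Esub P ?q (\<lambda>T. f (insert a T)) + (1 - q a) * Esub P ?q f)"
    unfolding Esub_insert[OF insert.hyps] e IH by (simp add: algebra_simps)
  also have "\<dots> = (\<Prod>p\<in>insert a P \<inter> A. 1 + q p) * Esub (insert a P) ?q f"
  proof (cases "a \<in> A")
    case True
    have "2 * q a * X + (1 - q a) * Y = (1 + q a) * (2 * q a / (1 + q a) * X + (1 - 2 * q a / (1 + q a)) * Y)"
      for X Y
    proof -
      have "(1 + q a) * (2 * q a / (1 + q a)) = 2 * q a" using q by simp
      then have "(1 + q a) * (1 - 2 * q a / (1 + q a)) = 1 - q a" by (simp only: right_diff_distrib) simp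
      then show ?thesis
        using \<open>(1 + q a) * (2 * q a / (1 + q a)) = 2 * q a\<close> by (metis (no_types) distrib_left mult.assoc)
    qed
    note key = this[of "Esub P ?q (\<lambda>T. f (insert a T))" "Esub P ?q f"]
    have pr: "(\<Prod>p\<in>insert a P \<inter> A. 1 + q p) = (1 + q a) * (\<Prod>p\<in>P \<inter> A. 1 + q p)"
      using insert.hyps True by (simp add: Int_insert_left)
    show ?thesis
      unfolding Esub_insert[OF insert.hyps] pr using True
      by (simp only: if_True mult.commute[of "q a" 2] key) (simp only: mult_ac)
  next
    case False
    then show ?thesis using insert.hyps by (simp add: Esub_insert Int_insert_left)
  qed
  finally show ?case .
qed simp

lemma Esub_mean:
  assumes "finite P"
  shows "Esub P q (\<lambda>T. \<Sum>p\<in>T. w p) = (\<Sum>p\<in>P. q p * w p)"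
  using assms
proof (induction P rule: finite_induct)
  case (insert a P)
  have "Esub P q (\<lambda>T. \<Sum>p\<in>insert a T. w p) = Esub P q (\<lambda>T. w a + (\<Sum>p\<in>T. w p))"
    using insert.hyps by (intro Esub_cong refl sum.insert) (auto intro: finite_subset)
  then show ?case
    using insert by (simp add: Esub_insert Esub_add Esub_const algebra_simps)
qed simp

text \<open>The centre \<open>m\<close> is arbitrary because a chosen element shifts it to
  \<open>m - 1\<close> in the induction.\<close>

lemma Esub_variance:
  assumes "finite P"
  shows "Esub P q (\<lambda>T. (real (card T) - m)\<^sup>2) = ((\<Sum>p\<in>P. q p) - m)\<^sup>2 + (\<Sum>p\<in>P. q p * (1 - q p))"
  using assms
proof (induction P arbitrary: m rule: finite_induct)
  case (insert a P)
  have "Esub P q (\<lambda>T. (real (card (insert a T)) - m)\<^sup>2) = Esub P q (\<lambda>T. (real (card T) - (m - 1))\<^sup>2)"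
  proof (intro Esub_cong refl)
    fix T assume "T \<subseteq> P"
    then have "a \<notin> T" "finite T" using insert.hyps by (auto intro: finite_subset)
    then show "(real (card (insert a T)) - m)\<^sup>2 = (real (card T) - (m - 1))\<^sup>2"
      by (simp add: algebra_simps)
  qed
  then have "Esub (insert a P) q (\<lambda>T. (real (card T) - m)\<^sup>2)
      = q a * (((\<Sum>p\<in>P. q p) - (m - 1))\<^sup>2 + (\<Sum>p\<in>P. q p * (1 - q p)))
        + (1 - q a) * (((\<Sum>p\<in>P. q p) - m)\<^sup>2 + (\<Sum>p\<in>P. q p * (1 - q p)))"
    by (simp only: Esub_insert[OF insert.hyps] insert.IH)
  then show ?case
    using insert.hyps by (simp add: power2_eq_square algebra_simps)
qed (simp add: power2_eq_square)

lemma Esub_chebyshev: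
  assumes P: "finite P" "\<And>p. p \<in> P \<Longrightarrow> 0 \<le> q p \<and> q p \<le> 1" and A: "A \<subseteq> P" and t: "0 < t"
  shows "Esub P q (\<lambda>T. of_bool (t \<le> \<bar>real (card (T \<inter> A)) - (\<Sum>p\<in>A. q p)\<bar>)) \<le> (\<Sum>p\<in>A. q p) / t\<^sup>2"
proof -
  have fA: "finite A" using P A finite_subset by blast
  let ?m = "\<Sum>p\<in>A. q p"
  have "Esub P q (\<lambda>T. of_bool (t \<le> \<bar>real (card (T \<inter> A)) - ?m\<bar>))
      = Esub A q (\<lambda>T. of_bool (t \<le> \<bar>real (card T) - ?m\<bar>))"
    using Esub_Int[OF P(1) A, of q "\<lambda>T. of_bool (t \<le> \<bar>real (card T) - ?m\<bar>)"] by simp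
  also have "\<dots> \<le> Esub A q (\<lambda>T. (1 / t\<^sup>2) * (real (card T) - ?m)\<^sup>2)"
  proof (rule Esub_mono)
    fix T
    have "1 \<le> (real (card T) - ?m)\<^sup>2 / t\<^sup>2" if "t \<le> \<bar>real (card T) - ?m\<bar>"
      using that t by (simp add: field_simps abs_le_square_iff[symmetric])
    then show "of_bool (t \<le> \<bar>real (card T) - ?m\<bar>) \<le> (1 / t\<^sup>2) * (real (card T) - ?m)\<^sup>2"
      by auto
  qed (use P A in auto)
  also have "\<dots> = (\<Sum>p\<in>A. q p * (1 - q p)) / t\<^sup>2"
    by (simp only: Esub_cmult Esub_variance[OF fA]) simp
  also have "\<dots> \<le> ?m / t\<^sup>2"
  proof (intro divide_right_mono sum_mono)
    fix p assume "p \<in> A"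
    then have "0 \<le> q p" "q p \<le> 1" using P A by auto
    then show "q p * (1 - q p) \<le> q p" by (simp add: mult_left_le)
  qed simp
  finally show ?thesis .
qed

lemma Esub_markov:
  assumes P: "finite P" "\<And>p. p \<in> P \<Longrightarrow> 0 \<le> q p \<and> q p \<le> 1"
    and f: "\<And>T. T \<subseteq> P \<Longrightarrow> 0 \<le> f T" and t: "0 < t"
  shows "Esub P q (\<lambda>T. of_bool (t \<le> f T)) \<le> Esub P q f / t"
proof -
  have "Esub P q (\<lambda>T. of_bool (t \<le> f T)) \<le> Esub P q (\<lambda>T. (1 / t) * f T)"
    using P f t by (intro Esub_mono) (auto simp: field_simps)
  then show ?thesis by (simp only: Esub_cmult) simp
qed

text \<open>Total variation: replacing the coins one at a time changes the mean of a function with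
  values in [0, 1] by at most the change of each coin.\<close>

lemma Esub_change_weights:
  assumes "finite P" "\<And>p. p \<in> P \<Longrightarrow> 0 \<le> q p \<and> q p \<le> 1" "\<And>p. p \<in> P \<Longrightarrow> 0 \<le> q' p \<and> q' p \<le> 1"
    "\<And>T. T \<subseteq> P \<Longrightarrow> 0 \<le> f T \<and> f T \<le> 1"
  shows "\<bar>Esub P q f - Esub P q' f\<bar> \<le> (\<Sum>p\<in>P. \<bar>q p - q' p\<bar>)"
  using assms
proof (induction P arbitrary: f rule: finite_induct)
  case (insert a P)
  let ?f = "\<lambda>T. f (insert a T)"
  define u u' v v' where "u = Esub P q ?f" and "u' = Esub P q' ?f" and "v = Esub P q f" and "v' = Esub P q' f"
  let ?s = "\<Sum>p\<in>P. \<bar>q p - q' p\<bar>"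
  have fa: "0 \<le> f (insert a T) \<and> f (insert a T) \<le> 1" "0 \<le> f T \<and> f T \<le> 1" if "T \<subseteq> P" for T
    using that insert.prems(3)[of T] insert.prems(3)[of "insert a T"] by blast+
  have 1: "\<bar>u - u'\<bar> \<le> ?s" unfolding u_def u'_def
    using insert.prems fa by (intro insert.IH) auto
  have 2: "\<bar>v - v'\<bar> \<le> ?s" unfolding v_def v'_def
    using insert.prems by (intro insert.IH) auto
  have b: "0 \<le> u'" "u' \<le> 1" "0 \<le> v'" "v' \<le> 1"
  proof -
    show "0 \<le> u'" "0 \<le> v'" unfolding u'_def v'_def using insert.prems fa
      by (auto intro!: Esub_nonneg)
    have "u' \<le> Esub P q' (\<lambda>_. 1)" "v' \<le> Esub P q' (\<lambda>_. 1)" unfolding u'_def v'_def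
      using insert.prems fa by (auto intro!: Esub_mono)
    then show "u' \<le> 1" "v' \<le> 1" using insert.hyps by (simp_all add: Esub_const)
  qed
  have qa: "0 \<le> q a" "q a \<le> 1" using insert.prems by auto
  \<comment> \<open>The conditional means are exchanged under the old coin at \<open>a\<close>, and
    the coin is exchanged last; that term is at most \<open>\<bar>q a - q' a\<bar>\<close> because
    \<open>u'\<close> and \<open>v'\<close> lie in [0, 1].\<close>
  have "q a * u + (1 - q a) * v - (q' a * u' + (1 - q' a) * v')
      = q a * (u - u') + (1 - q a) * (v - v') + (q a - q' a) * (u' - v')"
    by (simp add: algebra_simps)
  also have "\<bar>\<dots>\<bar> \<le> q a * \<bar>u - u'\<bar> + (1 - q a) * \<bar>v - v'\<bar> + \<bar>q a - q' a\<bar> * \<bar>u' - v'\<bar>"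
  proof -
    have "\<bar>x + y + z\<bar> \<le> \<bar>x\<bar> + \<bar>y\<bar> + \<bar>z\<bar>" for x y z :: real by linarith
    from this[of "q a * (u - u')" "(1 - q a) * (v - v')" "(q a - q' a) * (u' - v')"]
    show ?thesis using qa by (simp add: abs_mult)
  qed
  also have "\<dots> \<le> q a * ?s + (1 - q a) * ?s + \<bar>q a - q' a\<bar> * 1"
    using qa 1 2 b by (intro add_mono mult_left_mono) auto
  also have "\<dots> = ?s + \<bar>q a - q' a\<bar>" by (simp add: algebra_simps)
  finally show ?case
    using insert.hyps by (simp add: Esub_insert u_def u'_def v_def v'_def)
qed simp

lemma Esub_if_empty:
  assumes "finite P"
  shows "Esub P q (\<lambda>T. if T = {} then u else v) = (\<Prod>p\<in>P. 1 - q p) * u + (1 - (\<Prod>p\<in>P. 1 - q p)) * v"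
  using assms
proof (induction P rule: finite_induct)
  case (insert a P)
  then show ?case unfolding Esub_insert[OF insert.hyps] by (simp add: Esub_const, simp add: algebra_simps)
qed simp

text \<open>Disjoint blocks are hit independently, so the set of hit blocks is again a random subset
  of the same kind. This turns random primes into random integers.\<close>

lemma Esub_blocks:
  assumes "finite W" "\<And>a. a \<in> W \<Longrightarrow> finite (I a)" "disjoint_family_on I W"
  shows "Esub (\<Union>a\<in>W. I a) q (\<lambda>T. g {a\<in>W. T \<inter> I a \<noteq> {}})
     = Esub W (\<lambda>a. 1 - (\<Prod>p\<in>I a. 1 - q p)) g"
  using assms
proof (induction W arbitrary: g rule: finite_induct)
  case (insert b W)
  let ?q = "\<lambda>a. 1 - (\<Prod>p\<in>I a. 1 - q p)"
  have dis: "I b \<inter> (\<Union>a\<in>W. I a) = {}"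
    using insert.prems insert.hyps by (fastforce simp: disjoint_family_on_def)
  have fin: "finite (I b)" "finite (\<Union>a\<in>W. I a)" using insert by auto
  have IH: "Esub (\<Union>a\<in>W. I a) q (\<lambda>T. g' {a\<in>W. T \<inter> I a \<noteq> {}}) = Esub W ?q g'" for g'
    using insert.prems by (intro insert.IH) (auto simp: disjoint_family_on_def)
  have "Esub (\<Union>a\<in>insert b W. I a) q (\<lambda>T. g {a\<in>insert b W. T \<inter> I a \<noteq> {}})
      = Esub (I b) q (\<lambda>S. Esub (\<Union>a\<in>W. I a) q (\<lambda>T. g {a\<in>insert b W. (S \<union> T) \<inter> I a \<noteq> {}}))"
    using dis fin by (simp add: Esub_Un)
  also have "\<dots> = Esub (I b) q (\<lambda>S. Esub (\<Union>a\<in>W. I a) q (\<lambda>T.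
        (if S \<noteq> {} then g (insert b {a\<in>W. T \<inter> I a \<noteq> {}}) else g {a\<in>W. T \<inter> I a \<noteq> {}})))"
  proof (intro Esub_cong refl)
    fix S T assume S: "S \<subseteq> I b" and T: "T \<subseteq> (\<Union>a\<in>W. I a)"
    have "{a\<in>insert b W. (S \<union> T) \<inter> I a \<noteq> {}} =
       (if S \<noteq> {} then insert b {a\<in>W. T \<inter> I a \<noteq> {}} else {a\<in>W. T \<inter> I a \<noteq> {}})"
      using S T dis insert.hyps by auto
    then show "g {a\<in>insert b W. (S \<union> T) \<inter> I a \<noteq> {}} =
       (if S \<noteq> {} then g (insert b {a\<in>W. T \<inter> I a \<noteq> {}}) else g {a\<in>W. T \<inter> I a \<noteq> {}})"
      by simp
  qed
  also have "\<dots> = Esub (I b) q (\<lambda>S. if S = {} then Esub W ?q g else Esub W ?q (\<lambda>A. g (insert b A)))"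
    using IH[of g] IH[of "\<lambda>A. g (insert b A)"] by (intro Esub_cong refl) auto
  also have "\<dots> = ?q b * Esub W ?q (\<lambda>A. g (insert b A)) + (\<Prod>p\<in>I b. 1 - q p) * Esub W ?q g"
    by (simp add: Esub_if_empty[OF fin(1)])
  finally show ?case using insert.hyps by (simp add: Esub_insert)
qed simp

text \<open>The link between probability mass functions and finite sums: both the integer model and
  the random set in \<open>beta\<close> pass through it.\<close>

lemma expectation_Pi_bernoulli:
  fixes q :: "'a \<Rightarrow> real" and g :: "'a set \<Rightarrow> real"
  assumes "finite P" "\<And>p. p \<in> P \<Longrightarrow> 0 \<le> q p \<and> q p \<le> 1"
  shows "measure_pmf.expectation (Pi_pmf P False (\<lambda>p. bernoulli_pmf (q p))) (\<lambda>f. g {p\<in>P. f p}) = Esub P q g"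
  using assms
proof (induction P arbitrary: g rule: finite_induct)
  case (insert a P)
  let ?M = "\<lambda>P. Pi_pmf P False (\<lambda>p. bernoulli_pmf (q p))"
  have q: "0 \<le> q a" "q a \<le> 1" using insert.prems by auto
  have finM: "finite (set_pmf (?M P))"
    by (rule finite_subset[OF set_Pi_pmf_subset']) (use insert.hyps in \<open>auto intro!: finite_PiE_dflt\<close>)
  have 1: "measure_pmf.expectation (?M P) (\<lambda>f. g {p\<in>insert a P. (f(a := b)) p})
     = Esub P q (\<lambda>T. g (if b then insert a T else T))" for b
  proof -
    have "{p\<in>insert a P. (f(a := b)) p} = (if b then insert a {p\<in>P. f p} else {p\<in>P. f p})" for f
      using insert.hyps by auto
    then show ?thesis using insert by simp
  qed
  have "measure_pmf.expectation (?M (insert a P)) (\<lambda>f. g {p\<in>insert a P. f p})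
     = measure_pmf.expectation (bernoulli_pmf (q a))
         (\<lambda>b. measure_pmf.expectation (?M P) (\<lambda>f. g {p\<in>insert a P. (f(a := b)) p}))"
    unfolding Pi_pmf_insert'[OF insert.hyps] map_pmf_def[symmetric]
    by (subst pmf_expectation_bind[where A = UNIV])
       (use finM in \<open>auto simp: integral_measure_pmf_real[where A = UNIV] UNIV_bool mult_ac\<close>)
  also have "\<dots> = q a * Esub P q (\<lambda>T. g (insert a T)) + (1 - q a) * Esub P q g"
    unfolding 1 using q by (subst integral_measure_pmf_real[where A = UNIV]) (auto simp: UNIV_bool)
  finally show ?case using insert.hyps by (simp add: Esub_insert)
qed simp

section \<open>Mertens' theorems\<close>

lemma prod_primes_dvd:
  fixes N :: nat
  assumes "finite S" "\<And>p. p \<in> S \<Longrightarrow> prime p \<and> p dvd N"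
  shows "\<Prod>S dvd N"
  using assms
proof (induction S rule: finite_induct)
  case (insert p S)
  have "coprime p (\<Prod>S)"
    using insert by (intro prod_coprime_right) (auto intro: primes_coprime)
  then show ?case using insert by (auto intro: divides_mult)
qed simp

text \<open>The coefficient occurs twice in its row, so it is at most half of
  \<open>2 ^ (2 * m + 1)\<close>.\<close>

lemma binomial_odd_le: "(2 * m + 1) choose m \<le> 4 ^ m"
proof -
  have "2 * ((2 * m + 1) choose m) = ((2 * m + 1) choose m) + ((2 * m + 1) choose (m + 1))"
    using binomial_symmetric[of m "2 * m + 1"] by simp
  also have "\<dots> = (\<Sum>k\<in>{m, m + 1}. (2 * m + 1) choose k)" by simp
  also have "\<dots> \<le> (\<Sum>k\<le>2 * m + 1. (2 * m + 1) choose k)"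
    by (intro sum_mono2) auto
  also have "\<dots> = 2 * 4 ^ m" by (simp only: choose_row_sum) (simp add: power_mult)
  finally show ?thesis by simp
qed

text \<open>Chebyshev's bound by the argument of Erdos: the primes between \<open>m + 2\<close> and
  \<open>2 * m + 1\<close> all divide \<open>(2 * m + 1) choose m\<close>, which is at most
  \<open>4 ^ m\<close>; an even \<open>n > 2\<close> is no prime.\<close>

lemma sum_ln_primes_le: "(\<Sum>p | prime p \<and> p \<le> n. ln (real p)) \<le> real n * ln 4"
proof (induction n rule: less_induct)
  case (less n)
  let ?S = "\<lambda>n. {p. prime p \<and> p \<le> (n::nat)}"
  consider "n \<le> 1" | "n = 2" | m where "n = 2 * m" "m > 1" | m where "n = 2 * m + 1" "m \<ge> 1"
  proof -
    assume *: "n \<le> 1 \<Longrightarrow> thesis" "n = 2 \<Longrightarrow> thesis"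
      "\<And>m. n = 2 * m \<Longrightarrow> m > 1 \<Longrightarrow> thesis" "\<And>m. n = 2 * m + 1 \<Longrightarrow> m \<ge> 1 \<Longrightarrow> thesis"
    show thesis
    proof (cases "even n")
      case True
      then obtain m where "n = 2 * m" by (elim evenE)
      then show thesis using *(1,2) *(3)[of m] by linarith
    next
      case False
      then obtain m where "n = 2 * m + 1" by (elim oddE)
      then show thesis using *(1) *(4)[of m] by linarith
    qed
  qed
  then show ?case
  proof cases
    case 1
    then have "?S n = {}" by (auto dest!: prime_ge_2_nat)
    then show ?thesis by (simp only: sum.empty) simp
  next
    case 2
    have "?S 2 = {2}"
    proof (intro equalityI subsetI)
      fix p assume "p \<in> ?S 2"
      then have "p \<le> 2" "2 \<le> p" by (auto simp: prime_ge_2_nat)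
      then show "p \<in> {2}" by simp
    qed auto
    moreover have "ln (2::real) \<le> 2 * ln 4"
    proof -
      have "ln (2::real) \<le> ln 4" "0 \<le> ln (4::real)" by simp_all
      then show ?thesis by linarith
    qed
    ultimately show ?thesis using 2 by simp
  next
    case 3
    have "\<not> prime n" using 3 prime_odd_nat[of n] by auto
    have "?S n = ?S (n - 1)"
    proof (intro equalityI subsetI)
      fix p assume "p \<in> ?S n"
      then have "p \<le> n" "p \<noteq> n" "prime p" using \<open>\<not> prime n\<close> by auto
      then show "p \<in> ?S (n - 1)" by simp
    qed auto
    then have "(\<Sum>p\<in>?S n. ln (real p)) \<le> real (n - 1) * ln 4" using less[of "n - 1"] 3 by simp
    also have "\<dots> \<le> real n * ln 4" by (intro mult_right_mono) auto
    finally show ?thesis .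
  next
    case 4
    let ?Q = "{p. prime p \<and> m + 1 < p \<and> p \<le> 2 * m + 1}"
    have S: "?S n = ?S (m + 1) \<union> ?Q" using 4 by auto
    have "\<Prod>?Q dvd ((2 * m + 1) choose m)"
    proof (rule prod_primes_dvd)
      fix p assume p: "p \<in> ?Q"
      have pf: "p dvd fact k \<longleftrightarrow> p \<le> k" for k using p by (intro prime_dvd_fact_iff) auto
      have "2 * m + 1 - m = m + 1" by simp
      then have "fact (2 * m + 1) = fact m * fact (m + 1) * ((2 * m + 1) choose m)"
        using binomial_fact_lemma[of m "2 * m + 1"] by (simp only:)
      moreover have "p dvd fact (2 * m + 1)" using p pf by blast
      ultimately have "p dvd fact m * fact (m + 1) * ((2 * m + 1) choose m)" by (simp only:)
      moreover have "\<not> p dvd fact m" "\<not> p dvd fact (m + 1)" unfolding pf using p by auto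
      ultimately show "prime p \<and> p dvd ((2 * m + 1) choose m)"
        using p prime_dvd_mult_iff[of p] by blast
    qed auto
    then have "\<Prod>?Q \<le> (2 * m + 1) choose m" by (intro dvd_imp_le) auto
    then have "real (\<Prod>?Q) \<le> real (4 ^ m)"
      using binomial_odd_le[of m] by (intro of_nat_mono) linarith
    then have "(\<Prod>p\<in>?Q. real p) \<le> 4 ^ m" by simp
    moreover have "0 < (\<Prod>p\<in>?Q. real p)" by (intro prod_pos) (auto simp: prime_gt_0_nat)
    ultimately have "ln (\<Prod>p\<in>?Q. real p) \<le> ln (4 ^ m)" by simp
    then have Q: "(\<Sum>p\<in>?Q. ln (real p)) \<le> m * ln 4"
      by (subst (asm) ln_prod) (auto simp: ln_realpow prime_gt_0_nat)
    have "(\<Sum>p\<in>?S n. ln (real p)) = (\<Sum>p\<in>?S (m + 1). ln (real p)) + (\<Sum>p\<in>?Q. ln (real p))"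
      unfolding S by (intro sum.union_disjoint) auto
    also have "\<dots> \<le> real (m + 1) * ln 4 + m * ln 4" using Q less[of "m + 1"] 4 by (intro add_mono) auto
    also have "\<dots> = real n * ln 4" using 4 by (simp add: algebra_simps)
    finally show ?thesis .
  qed
qed

lemma card_multiples_atLeastAtMost:
  assumes "d > 0"
  shows "card {k\<in>{1..n}. d dvd k} = n div (d::nat)"
proof -
  have "{k\<in>{1..n}. d dvd k} = (\<lambda>i. d * i) ` {1..n div d}"
    using assms by (auto simp: image_iff less_eq_div_iff_mult_less_eq mult.commute elim!: dvdE)
  then show ?thesis using assms by (simp add: card_image inj_on_def)
qed

lemma ln_fact_eq_sum: "ln (fact n :: real) = (\<Sum>k=1..n. ln (real k))"
  unfolding fact_prod of_nat_prod by (subst ln_prod) auto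

lemma sum_of_bool_mult: "finite A \<Longrightarrow> (\<Sum>k\<in>A. of_bool (P k) * c) = real (card {k\<in>A. P k}) * c"
  by (simp add: Int_def flip: sum_distrib_right sum.inter_filter)

text \<open>The prime \<open>p\<close> divides \<open>n div p\<close> of the numbers up to
  \<open>n\<close>, and the distinct prime divisors of \<open>k\<close> multiply to at most
  \<open>k\<close>; hence the sum of \<open>(n div p) * ln p\<close> is at most
  \<open>n * ln n\<close>. Dropping the floors costs Chebyshev's sum, which is the term
  \<open>ln 4\<close>.\<close>

lemma mertens_first_upper:
  fixes n :: nat
  assumes n: "n \<ge> 1"
  shows "(\<Sum>p | prime p \<and> p \<le> n. ln (real p) / real p) \<le> ln n + ln 4"
proof -
  let ?S = "{p. prime p \<and> p \<le> n}"
  have "(\<Sum>p\<in>?S. ln (real p) * (n / p - 1)) \<le> (\<Sum>p\<in>?S. real (card {k\<in>{1..n}. p dvd k}) * ln (real p))"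
  proof (intro sum_mono)
    fix p assume "p \<in> ?S"
    then have p: "p > 0" "0 \<le> ln (real p)" by (auto simp: prime_gt_0_nat Suc_leI)
    have "n / p - 1 \<le> real (n div p)"
    proof -
      have "real n / p = real (n div p) + real (n mod p) / p" by (rule of_nat_of_nat_div_aux)
      moreover have "real (n mod p) / p \<le> 1" using p by (simp add: less_imp_le)
      ultimately show ?thesis by linarith
    qed
    then have "ln (real p) * (n / p - 1) \<le> ln (real p) * real (n div p)" using p by (intro mult_left_mono)
    then show "ln (real p) * (n / p - 1) \<le> real (card {k\<in>{1..n}. p dvd k}) * ln (real p)"
      unfolding card_multiples_atLeastAtMost[OF p(1)] by (simp only: mult.commute)
  qed
  also have "\<dots> = (\<Sum>p\<in>?S. \<Sum>k=1..n. of_bool (p dvd k) * ln (real p))"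
    by (simp only: sum_of_bool_mult finite_atLeastAtMost)
  also have "\<dots> = (\<Sum>k=1..n. \<Sum>p\<in>?S. of_bool (p dvd k) * ln (real p))" by (rule sum.swap)
  also have "\<dots> \<le> (\<Sum>k=1..n. ln (real k))"
  proof (intro sum_mono)
    fix k assume k: "k \<in> {1..n}"
    let ?D = "{p\<in>?S. p dvd k}"
    have "(\<Sum>p\<in>?S. of_bool (p dvd k) * ln (real p)) = (\<Sum>p\<in>?D. ln (real p))"
      by (intro sum.mono_neutral_cong_right) auto
    also have "\<dots> = ln (\<Prod>p\<in>?D. real p)"
      by (subst ln_prod) (auto simp: prime_gt_0_nat)
    also have "\<dots> \<le> ln (real k)"
    proof -
      have "\<Prod>?D dvd k" by (intro prod_primes_dvd) auto
      then have "\<Prod>?D \<le> k" using k by (intro dvd_imp_le) auto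
      then have "(\<Prod>p\<in>?D. real p) \<le> real k" by (simp flip: of_nat_prod)
      moreover have "0 < (\<Prod>p\<in>?D. real p)" by (intro prod_pos) (auto simp: prime_gt_0_nat)
      ultimately show ?thesis by simp
    qed
    finally show "(\<Sum>p\<in>?S. of_bool (p dvd k) * ln (real p)) \<le> ln (real k)" .
  qed
  also have "\<dots> \<le> (\<Sum>k=1..n. ln (real n))" by (intro sum_mono) auto
  finally have "(\<Sum>p\<in>?S. ln (real p) * (n / p - 1)) \<le> n * ln n" by simp
  moreover have "(\<Sum>p\<in>?S. ln (real p) * (n / p - 1)) = n * (\<Sum>p\<in>?S. ln (real p) / p) - (\<Sum>p\<in>?S. ln (real p))"
    by (simp add: algebra_simps sum_subtractf sum_distrib_left)
  ultimately have "n * (\<Sum>p\<in>?S. ln (real p) / p) \<le> n * (ln n + ln 4)"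
    using sum_ln_primes_le[of n] by (simp add: algebra_simps)
  then show ?thesis using n by simp
qed

text \<open>\<open>(ln x + 1) / x\<close> is an antiderivative of \<open>- ln x / x ^ 2\<close>; the
  2 in place of the 1 pays for the passage from integral to sum and makes the induction close, with
  equality at \<open>n = 1\<close>.\<close>

lemma sum_ln_over_square_le:
  fixes n :: nat
  assumes "n \<ge> 1"
  shows "(\<Sum>k\<in>{2..n}. ln (real k) / (real k * (real k - 1))) \<le> 2 - (ln n + 2) / n"
  using assms
proof (induction n rule: dec_induct)
  case (step n)
  have n: "real n \<ge> 1" using step by simp
  have l: "ln (real n + 1) \<le> ln (real n) + 1 / n"
    using ln_add_one_self_le_self[of "1 / real n"] n ln_div[of "real n + 1" "real n"]
    by (simp add: add_divide_distrib)
  have "(real n + 1) * ln (real n + 1) \<le> (real n + 1) * (ln (real n) + 1 / n)"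
    using l n by (intro mult_left_mono) auto
  also have "\<dots> = (real n + 1) * ln n + 1 + 1 / n" using n by (simp add: field_simps)
  also have "\<dots> \<le> (real n + 1) * ln n + 2" using n by simp
  finally have "ln (real n + 1) + n * (ln (real n + 1) + 2) \<le> (real n + 1) * (ln n + 2)" by (simp add: algebra_simps)
  then have "ln (real n + 1) / ((real n + 1) * real n) + (ln (real n + 1) + 2) / (real n + 1) \<le> (ln n + 2) / n"
    using n by (simp add: divide_simps) (simp add: algebra_simps)
  moreover have "{2..Suc n} = insert (Suc n) {2..n}" using step by auto
  ultimately show ?case using step.IH by (simp add: add.commute)
qed simp

text \<open>Legendre's formula without the floors: the left side is the exponent of \<open>p\<close>
  in \<open>fact n\<close>, and the geometric series over the powers of \<open>p\<close> is at most
  \<open>1 / (p - 1)\<close>.\<close>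

lemma sum_multiplicity_le:
  fixes p n :: nat
  assumes p: "prime p"
  shows "real (\<Sum>k=1..n. multiplicity p k) \<le> n / (real p - 1)"
proof -
  have p2: "p \<ge> 2" using p prime_ge_2_nat by blast
  have m: "multiplicity p k = (\<Sum>i=1..n. of_bool (p ^ i dvd k))" if k: "k \<in> {1..n}" for k
  proof -
    have "p ^ multiplicity p k dvd k" by (rule multiplicity_dvd)
    then have "p ^ multiplicity p k \<le> k" using k by (intro dvd_imp_le) auto
    moreover have "multiplicity p k < p ^ multiplicity p k" using p2 by (intro power_gt_expt) auto
    ultimately have "multiplicity p k \<le> n" using k by auto
    then have "{i\<in>{1..n}. p ^ i dvd k} = {1..multiplicity p k}"
      using k p2 by (subst power_dvd_iff_le_multiplicity) auto
    moreover have "(\<Sum>i=1..n. of_bool (p ^ i dvd k)) = card {i\<in>{1..n}. p ^ i dvd k}"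
      by (simp add: of_bool_def sum.If_cases Int_def)
    ultimately show ?thesis by simp
  qed
  have "(\<Sum>k=1..n. multiplicity p k) = (\<Sum>k=1..n. \<Sum>i=1..n. of_bool (p ^ i dvd k))"
    using m by (intro sum.cong) auto
  also have "\<dots> = (\<Sum>i=1..n. \<Sum>k=1..n. of_bool (p ^ i dvd k))" by (rule sum.swap)
  also have "\<dots> = (\<Sum>i=1..n. n div p ^ i)"
    using p2 by (intro sum.cong refl) (simp add: card_multiples_atLeastAtMost[symmetric] of_bool_def sum.If_cases Int_def)
  finally have "real (\<Sum>k=1..n. multiplicity p k) = (\<Sum>i=1..n. real (n div p ^ i))" by simp
  also have "\<dots> \<le> (\<Sum>i=1..n. n * (1 / p) ^ i)"
    by (intro sum_mono order_trans[OF of_nat_div_le_of_nat]) (simp add: power_divide)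
  also have "\<dots> = n * (\<Sum>i=1..n. (1 / p) ^ i)" by (simp add: sum_distrib_left)
  also have "(\<Sum>i=1..n. (1 / real p) ^ i) \<le> 1 / (real p - 1)"
  proof -
    have "(\<Sum>i=1..n. (1 / real p) ^ i) = (1 - (1 / p) ^ n) / (real p - 1)"
    proof (induction n)
      case (Suc n)
      have q: "(1 / real p) * (real p - 1) = 1 - 1 / real p" using p2 by (simp add: field_simps)
      have "(1 / real p) ^ Suc n = (1 / p) ^ n * ((1 / real p) * (real p - 1)) / (real p - 1)"
        using p2 by simp
      also have "\<dots> = (1 / p) ^ n * (1 - 1 / real p) / (real p - 1)" by (simp only: q)
      finally have "(\<Sum>i=1..Suc n. (1 / real p) ^ i)
          = (1 - (1 / p) ^ n) / (real p - 1) + (1 / p) ^ n * (1 - 1 / real p) / (real p - 1)"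
        using Suc by simp
      then show ?case unfolding add_divide_distrib[symmetric] by (simp add: algebra_simps)
    qed simp
    also have "\<dots> \<le> 1 / (real p - 1)" using p2 by (intro divide_right_mono) auto
    finally show ?thesis .
  qed
  finally show ?thesis by (simp add: mult_left_mono)
qed

text \<open>Legendre's formula for \<open>ln (fact n)\<close>, read from below. The 3 is 1 from
  \<open>n ^ n / fact n \<le> exp n\<close>, a single term of the exponential series, plus 2 from
  the proper prime powers, that is from the difference between \<open>1 / (p - 1)\<close> and
  \<open>1 / p\<close>.\<close>

lemma mertens_first_lower:
  fixes n :: nat
  assumes n: "n \<ge> 1"
  shows "ln n - 3 \<le> (\<Sum>p | prime p \<and> p \<le> n. ln (real p) / real p)"
proof -
  let ?S = "{p. prime p \<and> p \<le> n}"
  have "real n ^ n / fact n \<le> exp (real n)"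
    using sum_le_suminf[OF summable_exp_generic, of "{n}" "real n"] unfolding exp_def
    by (simp add: scaleR_conv_of_real divide_inverse mult.commute)
  then have "real n ^ n \<le> exp (real n) * fact n" by (simp add: field_simps)
  then have "ln (real n ^ n) \<le> ln (exp (real n) * fact n)" using n by (subst ln_le_cancel_iff) auto
  then have 1: "n * ln n - n \<le> ln (fact n :: real)" using n by (simp add: ln_mult ln_realpow)
  have lnk: "ln (real k) = (\<Sum>p\<in>?S. real (multiplicity p k) * ln (real p))" if k: "k \<in> {1..n}" for k
  proof -
    have "k = (\<Prod>p\<in>prime_factors k. p ^ multiplicity p k)"
      using k by (intro prime_factorization_nat) auto
    then have "real k = real (\<Prod>p\<in>prime_factors k. p ^ multiplicity p k)" by (rule arg_cong)
    then have "ln (real k) = ln (\<Prod>p\<in>prime_factors k. real p ^ multiplicity p k)"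
      by (simp only: of_nat_prod of_nat_power)
    also have "\<dots> = (\<Sum>p\<in>prime_factors k. real (multiplicity p k) * ln (real p))"
      by (subst ln_prod) (auto simp: ln_realpow prime_gt_0_nat prime_factors_gt_0_nat)
    also have "\<dots> = (\<Sum>p\<in>?S. real (multiplicity p k) * ln (real p))"
    proof (intro sum.mono_neutral_left ballI)
      show "prime_factors k \<subseteq> ?S" using k
        by (auto simp: prime_factors_dvd dest: dvd_imp_le)
      fix p assume "p \<in> ?S - prime_factors k"
      then have "\<not> p dvd k" using k by (auto simp: prime_factors_dvd)
      then show "real (multiplicity p k) * ln (real p) = 0" by (simp add: not_dvd_imp_multiplicity_0)
    qed auto
    finally show ?thesis .
  qed
  have "ln (fact n :: real) = (\<Sum>k=1..n. \<Sum>p\<in>?S. real (multiplicity p k) * ln (real p))"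
    unfolding ln_fact_eq_sum using lnk by (intro sum.cong) auto
  also have "\<dots> = (\<Sum>p\<in>?S. \<Sum>k=1..n. real (multiplicity p k) * ln (real p))" by (rule sum.swap)
  also have "\<dots> = (\<Sum>p\<in>?S. real (\<Sum>k=1..n. multiplicity p k) * ln (real p))"
    by (simp add: sum_distrib_right)
  also have "\<dots> \<le> (\<Sum>p\<in>?S. n / (real p - 1) * ln (real p))"
    by (intro sum_mono mult_right_mono sum_multiplicity_le) (auto simp: prime_gt_0_nat Suc_leI)
  also have "\<dots> = (\<Sum>p\<in>?S. n * (ln (real p) / p) + n * (ln (real p) / (real p * (real p - 1))))"
  proof (intro sum.cong refl)
    fix p assume "p \<in> ?S"
    then have "real p > 1" using prime_gt_1_nat by auto
    then show "n / (real p - 1) * ln (real p) = n * (ln (real p) / p) + n * (ln (real p) / (real p * (real p - 1)))"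
      by (simp add: field_simps)
  qed
  also have "\<dots> = n * (\<Sum>p\<in>?S. ln (real p) / p) + n * (\<Sum>p\<in>?S. ln (real p) / (real p * (real p - 1)))"
    by (simp add: sum.distrib sum_distrib_left)
  also have "(\<Sum>p\<in>?S. ln (real p) / (real p * (real p - 1))) \<le> (\<Sum>k\<in>{2..n}. ln (real k) / (real k * (real k - 1)))"
    by (intro sum_mono2) (auto simp: prime_ge_2_nat)
  also have "\<dots> \<le> 2"
    using sum_ln_over_square_le[OF n] n by (smt (verit, best) divide_nonneg_nonneg ln_ge_zero of_nat_0_le_iff of_nat_1 of_nat_mono)
  finally have "ln (fact n :: real) \<le> n * (\<Sum>p\<in>?S. ln (real p) / p) + n * 2" by (simp add: mult_left_mono)
  then have "n * (ln n - 3) \<le> n * (\<Sum>p\<in>?S. ln (real p) / p)" using 1 by (simp add: algebra_simps)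
  then show ?thesis using n by simp
qed

text \<open>Partial summation of the first theorem with weight \<open>1 / ln p\<close>, carried out
  as an induction on \<open>n\<close>; the error \<open>e\<close> of the first theorem is at most 3
  in absolute value.\<close>

lemma mertens_second_nat:
  fixes m n :: nat
  assumes "2 \<le> m" "m \<le> n"
  shows "\<bar>(\<Sum>p | prime p \<and> m < p \<and> p \<le> n. 1 / real p) - (ln (ln n) - ln (ln m))\<bar> \<le> 10 / ln m"
proof -
  define A where "A n = (\<Sum>p | prime p \<and> p \<le> n. ln (real p) / real p)" for n :: nat
  define B where "B n = (\<Sum>p | prime p \<and> m < p \<and> p \<le> n. 1 / real p)" for n :: nat
  define e where "e n = A n - ln n" for n :: nat
  have ln4: "ln (4::real) \<le> 3" using ln_le_minus_one[of "4::real"] by simp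
  have e: "\<bar>e n\<bar> \<le> 3" if "n \<ge> 1" for n
    using mertens_first_upper[OF that] mertens_first_lower[OF that] ln4 by (simp add: e_def A_def)
  \<comment> \<open>The invariant separates the boundary terms from an error that telescopes. One
    step costs \<open>3 * (1 / l - 1 / l')\<close> because of \<open>e n\<close>; comparing
    \<open>(l' - l) / l'\<close> with \<open>ln l' - ln l\<close> costs one more such unit, in the
    lower direction only, hence 3 against 4.\<close>
  have key: "B n - (ln (ln n) - ln (ln m)) - (e n / ln n - e m / ln m) \<le> 3 * (1 / ln m - 1 / ln n)
      \<and> - (4 * (1 / ln m - 1 / ln n)) \<le> B n - (ln (ln n) - ln (ln m)) - (e n / ln n - e m / ln m)"
    using assms(2)
  proof (induction n rule: dec_induct)
    case base
    have "B m = 0" unfolding B_def by (rule sum.neutral) auto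
    then show ?case by simp
  next
    case (step n)
    define l l' where "l = ln (real n)" and "l' = ln (real (Suc n))"
    have n2: "n \<ge> 2" using step assms by simp
    have l: "0 < l" "l < l'" "l' \<le> l + 1"
    proof -
      show "0 < l" "l < l'" using n2 by (auto simp: l_def l'_def)
      have "l' - l \<le> (real (Suc n) - real n) / real n" unfolding l_def l'_def
        using n2 by (intro ln_diff_le) auto
      also have "\<dots> \<le> 1" using n2 by simp
      finally show "l' \<le> l + 1" by simp
    qed
    have S: "{p. prime p \<and> p \<le> Suc n} = {p. prime p \<and> p \<le> n} \<union> (if prime (Suc n) then {Suc n} else {})"
      "{p. prime p \<and> m < p \<and> p \<le> Suc n} = {p. prime p \<and> m < p \<and> p \<le> n} \<union> (if prime (Suc n) then {Suc n} else {})"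
      using step.hyps by (auto simp: le_Suc_eq)
    have A: "A (Suc n) = A n + (if prime (Suc n) then l' / real (Suc n) else 0)"
      unfolding A_def l'_def S by (subst sum.union_disjoint) auto
    have B: "B (Suc n) = B n + (if prime (Suc n) then 1 / real (Suc n) else 0)"
      unfolding B_def S by (subst sum.union_disjoint) auto
    have "B (Suc n) - B n = (A (Suc n) - A n) / l'"
      unfolding A B using l by simp
    also have "A (Suc n) - A n = (e (Suc n) - e n) + (l' - l)" by (simp add: e_def l_def l'_def)
    finally have "B (Suc n) - B n = e (Suc n) / l' - e n / l + e n * (1 / l - 1 / l') + (l' - l) / l'"
      by (simp add: add_divide_distrib diff_divide_distrib right_diff_distrib)
    moreover have "\<bar>e n * (1 / l - 1 / l')\<bar> \<le> 3 * (1 / l - 1 / l')"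
      unfolding abs_mult using e[of n] n2 l by (intro mult_mono) (auto simp: field_simps)
    moreover have "(l' - l) / l' \<le> ln l' - ln l"
    proof -
      have "ln l - ln l' \<le> (l - l') / l'" using l by (intro ln_diff_le) auto
      then show ?thesis by (simp add: diff_divide_distrib)
    qed
    moreover have "ln l' - ln l - (1 / l - 1 / l') \<le> (l' - l) / l'"
    proof -
      have "ln l' - ln l \<le> (l' - l) / l" using l by (intro ln_diff_le) auto
      also have "\<dots> = (l' - l) / l' + (l' - l) * (1 / l - 1 / l')" using l by (simp add: field_simps)
      also have "(l' - l) * (1 / l - 1 / l') \<le> 1 * (1 / l - 1 / l')"
        using l by (intro mult_right_mono) (auto simp: field_simps)
      finally show ?thesis by simp
    qed
    ultimately show ?case using step.IH by (simp add: l_def l'_def abs_le_iff)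
  qed
  have lm: "0 < ln (real m)" "ln (real m) \<le> ln (real n)" using assms by auto
  define a b X where "a = 1 / ln (real m)" and "b = 1 / ln (real n)" and "X = B n - (ln (ln n) - ln (ln m))"
  have "\<bar>e n / ln n\<bar> \<le> 3 / ln m" unfolding abs_divide using e[of n] assms lm by (intro frac_le) auto
  then have 1: "\<bar>e n / ln n\<bar> \<le> 3 * a" by (simp add: a_def)
  have "\<bar>e m / ln m\<bar> \<le> 3 / ln m" unfolding abs_divide using e[of m] assms lm by (intro frac_le) auto
  then have 2: "\<bar>e m / ln m\<bar> \<le> 3 * a" by (simp add: a_def)
  have 3: "0 < a" "0 < b" using lm by (auto simp: a_def b_def)
  have 4: "X - (e n / ln n - e m / ln m) \<le> 3 * (a - b)" "- (4 * (a - b)) \<le> X - (e n / ln n - e m / ln m)"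
    using key by (simp_all only: a_def b_def X_def)
  \<comment> \<open>3 for each boundary term and 4 for the telescoped error.\<close>
  have "\<bar>X\<bar> \<le> 10 * a" using 1 2 3 4 by (simp only: abs_le_iff) argo
  then show ?thesis by (simp add: X_def B_def a_def)
qed

section \<open>Primes ordered by their logarithm\<close>

text \<open>Half-open, so that adjacent ranges partition the primes; on this scale the sum of
  \<open>1 / p\<close> is close to the logarithm of the ratio of the end points.\<close>

definition PL :: "real \<Rightarrow> real \<Rightarrow> nat set" where
  "PL s t = {p. prime p \<and> s \<le> ln (real p) \<and> ln (real p) < t}"

lemma PL_prime: "p \<in> PL s t \<Longrightarrow> prime p"
  by (simp add: PL_def)

lemma PL_gt_1: "p \<in> PL s t \<Longrightarrow> 1 < p"
  using prime_gt_1_nat by (auto simp: PL_def)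

lemma finite_PL [simp]: "finite (PL s t)"
proof (rule finite_subset)
  show "PL s t \<subseteq> {..nat \<lceil>exp t\<rceil>}"
  proof
    fix p assume p: "p \<in> PL s t"
    have "real p < exp t" using p PL_gt_1[OF p] exp_less_mono[of "ln (real p)" t] by (simp add: PL_def)
    also have "\<dots> \<le> real (nat \<lceil>exp t\<rceil>)" by (rule real_nat_ceiling_ge)
    finally show "p \<in> {..nat \<lceil>exp t\<rceil>}" by simp
  qed
qed simp

text \<open>\<open>m\<close> is the ceiling minus 1 and not the floor because
  \<open>ln p < s\<close> is strict, which matters if \<open>exp s\<close> is an integer.\<close>

lemma PL_conv_nat:
  obtains m where "real m < exp s" "exp s \<le> real m + 1"
    "\<And>p::nat. 0 < p \<Longrightarrow> ln (real p) < s \<longleftrightarrow> p \<le> m"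
proof
  let ?m = "nat (\<lceil>exp s\<rceil> - 1)"
  have "\<lceil>exp s\<rceil> \<ge> 1" by (simp add: le_ceiling_iff)
  then have m: "real ?m = of_int \<lceil>exp s\<rceil> - 1" by simp
  show "real ?m < exp s" "exp s \<le> real ?m + 1" unfolding m by linarith+
  fix p :: nat assume "0 < p"
  then have "ln (real p) < s \<longleftrightarrow> real p < exp s" using exp_less_cancel_iff[of "ln (real p)" s] by simp
  also have "\<dots> \<longleftrightarrow> int p < \<lceil>exp s\<rceil>" by (simp add: less_ceiling_iff)
  also have "\<dots> \<longleftrightarrow> p \<le> ?m" using \<open>\<lceil>exp s\<rceil> \<ge> 1\<close> by linarith
  finally show "ln (real p) < s \<longleftrightarrow> p \<le> ?m" .
qed

lemma ln_approx_below:
  assumes s: "1 \<le> s" and m: "real m < exp s" "exp s \<le> real m + 1"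
  shows "2 \<le> m" "s / 2 \<le> ln m" "ln m \<le> s" "ln (ln m) \<le> ln s" "ln s \<le> ln (ln m) + 1 / s" "1 / real m \<le> 2 / s"
proof -
  have "exp 1 \<le> exp s" using s by simp
  moreover have "exp (1::real) > 2"
    using ln2_le_25_over_36 exp_less_mono[of "ln 2" "1::real"] by simp
  ultimately show m2: "2 \<le> m" using m by linarith
  have "ln (real m) < ln (exp s)" using m m2 by (subst ln_less_cancel_iff) auto
  then show 1: "ln m \<le> s" by simp
  have "s = ln (exp s)" by simp
  also have "\<dots> \<le> ln (real m + 1)" using m by (subst ln_le_cancel_iff) auto
  also have "\<dots> - ln m \<le> (real m + 1 - real m) / real m" using m2 by (intro ln_diff_le) auto
  finally have 2: "s - ln m \<le> 1 / m" by simp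
  also have "1 / real m \<le> 1 / 2" using m2 by (intro divide_left_mono) auto
  finally have h: "s - ln m \<le> 1 / 2" .
  then show 3: "s / 2 \<le> ln m" using s by linarith
  then have l0: "0 < ln (real m)" using s by linarith
  show "ln (ln m) \<le> ln s" using 1 l0 s by simp
  have "ln s - ln (ln m) \<le> (s - ln m) / ln m" using s l0 by (intro ln_diff_le) auto
  also have "\<dots> \<le> (1 / 2) / (s / 2)" using h 3 s by (intro frac_le) auto
  finally show "ln s \<le> ln (ln m) + 1 / s" using s by (simp add: field_simps)
  have "s / 2 \<le> m" using 3 ln_le_minus_one[of "real m"] m2 by simp
  then have "1 / m \<le> 1 / (s / 2)" using s m2 by (intro divide_left_mono) auto
  then show "1 / real m \<le> 2 / s" by simp
qed

text \<open>22 is 20 from \<open>10 / ln m\<close> with \<open>ln m \<ge> s / 2\<close>, plus 1 for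
  rounding at each of the two end points.\<close>

lemma mertens_second:
  assumes "1 \<le> s" "s \<le> t"
  shows "\<bar>(\<Sum>p\<in>PL s t. 1 / real p) - ln (t / s)\<bar> \<le> 22 / s"
proof -
  obtain m where m: "real m < exp s" "exp s \<le> real m + 1" "\<And>p::nat. 0 < p \<Longrightarrow> ln (real p) < s \<longleftrightarrow> p \<le> m"
    using PL_conv_nat[of s] by blast
  obtain n where n: "real n < exp t" "exp t \<le> real n + 1" "\<And>p::nat. 0 < p \<Longrightarrow> ln (real p) < t \<longleftrightarrow> p \<le> n"
    using PL_conv_nat[of t] by blast
  note M = ln_approx_below[OF assms(1) m(1,2)]
  have t: "1 \<le> t" using assms by simp
  note N = ln_approx_below[OF t n(1,2)]
  have mn: "m \<le> n" using m(3)[of m] n(3)[of m] M(1) assms by force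
  have "p \<in> PL s t \<longleftrightarrow> prime p \<and> m < p \<and> p \<le> n" for p
  proof (cases "prime p")
    case True
    then have p: "0 < p" by (rule prime_gt_0_nat)
    have "s \<le> ln (real p) \<longleftrightarrow> m < p" using m(3)[OF p] by linarith
    then show ?thesis using True n(3)[OF p] by (simp add: PL_def)
  qed (simp add: PL_def)
  then have "PL s t = {p. prime p \<and> m < p \<and> p \<le> n}" by blast
  then have "\<bar>(\<Sum>p\<in>PL s t. 1 / real p) - (ln (ln n) - ln (ln m))\<bar> \<le> 10 / ln m"
    using mertens_second_nat[OF M(1) mn] by simp
  also have "\<dots> \<le> 10 / (s / 2)" using M assms by (intro divide_left_mono) auto
  finally have "\<bar>(\<Sum>p\<in>PL s t. 1 / real p) - (ln (ln n) - ln (ln m))\<bar> \<le> 20 / s" by simp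
  moreover have "ln (t / s) = ln t - ln s" using assms by (simp add: ln_div)
  moreover have "1 / t \<le> 1 / s" using assms by (intro divide_left_mono) auto
  moreover have "22 / s = 20 / s + 1 / s + 1 / s" by (simp add: field_simps)
  ultimately show ?thesis using M(4,5) N(4,5) by (simp only: abs_le_iff) (elim conjE, intro conjI; linarith)
qed

lemma sum_inverse_squares_PL_le:
  assumes "1 \<le> s"
  shows "(\<Sum>p\<in>PL s t. 1 / (real p)\<^sup>2) \<le> 2 / s"
proof -
  obtain m where m: "real m < exp s" "exp s \<le> real m + 1" "\<And>p::nat. 0 < p \<Longrightarrow> ln (real p) < s \<longleftrightarrow> p \<le> m"
    using PL_conv_nat[of s] by blast
  note M = ln_approx_below[OF assms(1) m(1,2)]
  obtain n where n: "\<And>p::nat. 0 < p \<Longrightarrow> ln (real p) < t \<longleftrightarrow> p \<le> n"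
    using PL_conv_nat[of t] by blast
  have tel: "(\<Sum>k\<in>{m<..m + j}. 1 / (real k)\<^sup>2) \<le> 1 / m - 1 / (m + j)" for j
  proof (induction j)
    case (Suc j)
    have "{m<..m + Suc j} = insert (m + Suc j) {m<..m + j}" by auto
    then have "(\<Sum>k\<in>{m<..m + Suc j}. 1 / (real k)\<^sup>2) = 1 / (real (m + Suc j))\<^sup>2 + (\<Sum>k\<in>{m<..m + j}. 1 / (real k)\<^sup>2)"
      by simp
    moreover have "1 / x\<^sup>2 \<le> 1 / (x - 1) - 1 / x" if "x > 1" for x :: real
      using that by (simp add: field_simps power2_eq_square)
    from this[of "real (m + Suc j)"] have "1 / (real (m + Suc j))\<^sup>2 \<le> 1 / (m + j) - 1 / (m + Suc j)"
      using M(1) by simp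
    ultimately show ?case using Suc by linarith
  qed simp
  have "PL s t \<subseteq> {m<..m + n}"
  proof
    fix p assume "p \<in> PL s t"
    then have p: "0 < p" "s \<le> ln (real p)" "ln (real p) < t" by (auto simp: PL_def prime_gt_0_nat)
    then have "\<not> p \<le> m" "p \<le> n" using m(3)[OF p(1)] n[OF p(1)] by linarith+
    then show "p \<in> {m<..m + n}" by simp
  qed
  then have "(\<Sum>p\<in>PL s t. 1 / (real p)\<^sup>2) \<le> (\<Sum>k\<in>{m<..m + n}. 1 / (real k)\<^sup>2)"
    by (intro sum_mono2) auto
  also have "\<dots> \<le> 1 / m" using tel[of n] by (smt (verit) divide_nonneg_nonneg of_nat_0_le_iff)
  also have "\<dots> \<le> 2 / s" by (rule M(6))
  finally show ?thesis .
qed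

lemma mertens_first_PL:
  assumes "0 \<le> t"
  shows "(\<Sum>p\<in>PL s t. ln (real p) / real p) \<le> t + 3"
proof -
  obtain n where n: "real n < exp t" "exp t \<le> real n + 1" "\<And>p::nat. 0 < p \<Longrightarrow> ln (real p) < t \<longleftrightarrow> p \<le> n"
    using PL_conv_nat[of t] by blast
  have S: "PL s t \<subseteq> {p. prime p \<and> p \<le> n}" unfolding PL_def using n(3) by (auto simp: prime_gt_0_nat)
  show ?thesis
  proof (cases "n = 0")
    case True
    then have "PL s t = {}" using S by (auto simp: prime_gt_0_nat)
    then show ?thesis using assms by simp
  next
    case False
    have ln4: "ln (4::real) \<le> 3" using ln_le_minus_one[of "4::real"] by simp
    have "(\<Sum>p\<in>PL s t. ln (real p) / real p) \<le> (\<Sum>p | prime p \<and> p \<le> n. ln (real p) / real p)"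
      using S by (intro sum_mono2) (auto simp: prime_gt_0_nat Suc_leI)
    also have "\<dots> \<le> ln n + ln 4" using False by (intro mertens_first_upper) simp
    also have "ln (real n) < ln (exp t)" using False n(1) by (subst ln_less_cancel_iff) auto
    finally show ?thesis using ln4 by simp
  qed
qed

section \<open>Equal subset sums and concentrated divisors\<close>

text \<open>\<open>GREATEST\<close> is meaningful only for a bounded predicate; the bound is the
  number of all subsets of \<open>A\<close>. Subfamilies give every smaller
  \<open>k\<close>.\<close>

lemma mEq_ge_iff:
  assumes "finite A"
  shows "k \<le> mEq A \<longleftrightarrow> (\<exists>F. F \<subseteq> Pow A \<and> card F = k \<and> (\<exists>s. \<forall>B\<in>F. \<Sum>B = s))" (is "_ \<longleftrightarrow> ?P k")
proof -
  have bound: "m \<le> card (Pow A)" if "?P m" for m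
    using that assms by (auto intro: card_mono)
  have P0: "?P 0" by (intro exI[of _ "{}"]) auto
  have "?P (mEq A)" unfolding mEq_def by (rule GreatestI_nat[of ?P, OF P0 bound])
  then obtain F s where F: "F \<subseteq> Pow A" "card F = mEq A" "\<forall>B\<in>F. \<Sum>B = s" by blast
  show ?thesis
  proof
    assume "k \<le> mEq A"
    then obtain G where "G \<subseteq> F" "card G = k" using F obtain_subset_with_card_n by metis
    then show "?P k" using F by blast
  next
    assume "?P k"
    then show "k \<le> mEq A" unfolding mEq_def by (rule Greatest_le_nat[of ?P, OF _ bound])
  qed
qed

text \<open>One member is chosen per stage: the sums add up, and disjointness lets the union be
  split into its parts again, so the counts multiply. This makes the number of stages an exponent of
  \<open>k\<close>.\<close>

lemma equal_sums_UN:
  fixes A :: "'i \<Rightarrow> nat set"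
  assumes "finite S" "\<And>i. i \<in> S \<Longrightarrow> finite (A i)" "disjoint_family_on A S" "\<And>i. i \<in> S \<Longrightarrow> k \<le> mEq (A i)"
  shows "\<exists>F. F \<subseteq> Pow (\<Union>i\<in>S. A i) \<and> card F = k ^ card S \<and> (\<exists>s. \<forall>B\<in>F. \<Sum>B = s)"
  using assms
proof (induction S rule: finite_induct)
  case empty
  show ?case by (intro exI[of _ "{{}}"]) auto
next
  case (insert i S)
  have "\<exists>F. F \<subseteq> Pow (\<Union>i\<in>S. A i) \<and> card F = k ^ card S \<and> (\<exists>s. \<forall>B\<in>F. \<Sum>B = s)"
    using insert.prems by (intro insert.IH) (auto simp: disjoint_family_on_def)
  then obtain F s where F: "F \<subseteq> Pow (\<Union>i\<in>S. A i)" "card F = k ^ card S" "\<And>B. B \<in> F \<Longrightarrow> \<Sum>B = s" by auto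
  obtain G t where G: "G \<subseteq> Pow (A i)" "card G = k" "\<And>B. B \<in> G \<Longrightarrow> \<Sum>B = t"
    using mEq_ge_iff[of "A i" k] insert.prems by auto
  have fin: "finite (A i)" "finite (\<Union>i\<in>S. A i)" using insert by auto
  have dis: "A i \<inter> (\<Union>i\<in>S. A i) = {}"
    using insert.prems insert.hyps by (fastforce simp: disjoint_family_on_def)
  let ?u = "\<lambda>(X, Y). X \<union> Y"
  have inj: "inj_on ?u (G \<times> F)"
  proof (rule inj_onI, clarify)
    fix X Y X' Y' assume a: "X \<in> G" "Y \<in> F" "X' \<in> G" "Y' \<in> F" "X \<union> Y = X' \<union> Y'"
    have "X = (X \<union> Y) \<inter> A i" "X' = (X' \<union> Y') \<inter> A i" "Y = (X \<union> Y) - A i" "Y' = (X' \<union> Y') - A i"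
      using a(1-4) F G dis by blast+
    then show "X = X' \<and> Y = Y'" using a(5) by metis
  qed
  show ?case
  proof (intro exI[of _ "?u ` (G \<times> F)"] conjI exI[of _ "t + s"] ballI)
    show "?u ` (G \<times> F) \<subseteq> Pow (\<Union>i\<in>insert i S. A i)" using F G by auto
    show "card (?u ` (G \<times> F)) = k ^ card (insert i S)"
      using insert.hyps F G by (simp add: card_image[OF inj] card_cartesian_product)
    fix B assume "B \<in> ?u ` (G \<times> F)"
    then obtain X Y where XY: "X \<in> G" "Y \<in> F" "B = X \<union> Y" by auto
    then have "X \<subseteq> A i" "Y \<subseteq> (\<Union>i\<in>S. A i)" using F G by auto
    then have "X \<inter> Y = {}" "finite X" "finite Y" using dis fin by (auto intro: finite_subset)
    then show "\<Sum>B = t + s" using XY F G by (simp add: sum.union_disjoint)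
  qed
qed

lemma prod_primes_inj:
  assumes "finite T" "\<And>p. p \<in> T \<Longrightarrow> prime (p::nat)" "X \<subseteq> T" "Y \<subseteq> T" "\<Prod>X = \<Prod>Y"
  shows "X = Y"
proof -
  have "X = prime_factors (\<Prod>X)" if "X \<subseteq> T" for X
  proof -
    have fX: "finite X" using that assms by (auto intro: finite_subset)
    have nz: "\<Prod>X \<noteq> 0" using that assms fX by (auto dest: prime_gt_0_nat)
    have "p \<in> X" if "prime p" "p dvd \<Prod>X" for p
    proof -
      have "\<exists>x\<in>X. p dvd x" using prime_dvd_prod_iff[OF fX \<open>prime p\<close>, of "\<lambda>x. x"] that by blast
      then obtain x where "x \<in> X" "p dvd x" by blast
      then show ?thesis using that(1) primes_dvd_imp_eq[of p x] \<open>X \<subseteq> T\<close> assms(2)[of x] by auto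
    qed
    moreover have "prime p \<and> p dvd \<Prod>X" if "p \<in> X" for p
      using that \<open>X \<subseteq> T\<close> assms(2) dvd_prodI[OF fX that, of "\<lambda>x. x"] by auto
    ultimately have "p \<in> X \<longleftrightarrow> p \<in> prime_factors (\<Prod>X)" for p
      unfolding in_prime_factors_iff using nz by blast
    then show ?thesis by blast
  qed
  then show ?thesis using assms by metis
qed

lemma omega_prod:
  assumes "finite T" "\<And>p. p \<in> T \<Longrightarrow> prime (p::nat)"
  shows "omega (\<Prod>T) = card T"
proof -
  have nz: "\<Prod>T \<noteq> 0" using assms by (auto dest: prime_gt_0_nat)
  have "p \<in> T" if "prime p" "p dvd \<Prod>T" for p

    proof -
      have "\<exists>x\<in>T. p dvd x" using prime_dvd_prod_iff[OF assms(1) \<open>prime p\<close>, of "\<lambda>x. x"] that by blast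
      then obtain x where "x \<in> T" "p dvd x" by blast
      then show ?thesis using that(1) primes_dvd_imp_eq[of p x] assms(2)[of x] by auto
    qed
  then have "prime_factors (\<Prod>T) = T" using assms nz by (auto simp: in_prime_factors_iff)
  then show ?thesis by (simp add: omega_def)
qed

lemma Delta_ge:
  assumes "n > 0"
  shows "card {d. d dvd n \<and> exp u < real d \<and> real d \<le> exp (u + 1)} \<le> Delta n"
  unfolding Delta_def
proof (rule Max_ge)
  have fin: "finite {d. d dvd n}" using assms by simp
  \<comment> \<open>The family is indexed by all real \<open>u\<close>, but its values are bounded
    by the number of divisors, so \<open>Max\<close> is taken over a finite set.\<close>
  have "{card {d. d dvd n \<and> exp u < real d \<and> real d \<le> exp (u + 1)} |u. True} \<subseteq> {..card {d. d dvd n}}"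
    using fin by (auto intro: card_mono)
  then show "finite {card {d. d dvd n \<and> exp u < real d \<and> real d \<le> exp (u + 1)} |u. True}"
    by (rule finite_subset) simp
qed auto

lemma Delta_ge_1: "n > 0 \<Longrightarrow> 1 \<le> Delta n"
proof -
  assume n: "n > 0"
  \<comment> \<open>The left end of the interval is open, so \<open>u = 0\<close> would miss the
    divisor 1.\<close>
  have "{1} \<subseteq> {d. d dvd n \<and> exp (-1/2) < real d \<and> real d \<le> exp (-1/2 + 1)}" by auto
  then have "card {1::nat} \<le> card {d. d dvd n \<and> exp (-1/2) < real d \<and> real d \<le> exp (-1/2 + 1)}"
    using n by (intro card_mono) (auto intro: finite_subset[of _ "{d. d dvd n}"])
  then show ?thesis using Delta_ge[OF n, of "-1/2"] by simp
qed

lemma Delta_prod_ge: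
  assumes "finite T" "\<And>p. p \<in> T \<Longrightarrow> prime (p::nat)"
  shows "card {X. X \<subseteq> T \<and> u < (\<Sum>p\<in>X. ln (real p)) \<and> (\<Sum>p\<in>X. ln (real p)) \<le> u + 1} \<le> Delta (\<Prod>T)"
proof -
  have nz: "\<Prod>T > 0" using assms by (auto intro!: prod_pos dest: prime_gt_0_nat)
  have l: "real (\<Prod>X) = exp (\<Sum>p\<in>X. ln (real p))" if "X \<subseteq> T" for X
  proof -
    have "finite X" using that assms finite_subset by blast
    moreover have "real p > 0" if "p \<in> X" for p using that \<open>X \<subseteq> T\<close> assms(2) prime_gt_0_nat by auto
    ultimately show ?thesis by (simp add: exp_sum)
  qed
  have "card {X. X \<subseteq> T \<and> u < (\<Sum>p\<in>X. ln (real p)) \<and> (\<Sum>p\<in>X. ln (real p)) \<le> u + 1}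
      \<le> card {d. d dvd \<Prod>T \<and> exp u < real d \<and> real d \<le> exp (u + 1)}"
  proof (rule card_inj_on_le[where f = "\<lambda>X. \<Prod>X"])
    show "inj_on (\<lambda>X. \<Prod>X) {X. X \<subseteq> T \<and> u < (\<Sum>p\<in>X. ln (real p)) \<and> (\<Sum>p\<in>X. ln (real p)) \<le> u + 1}"
      using prod_primes_inj[OF assms] by (intro inj_onI) auto
    show "(\<lambda>X. \<Prod>X) ` {X. X \<subseteq> T \<and> u < (\<Sum>p\<in>X. ln (real p)) \<and> (\<Sum>p\<in>X. ln (real p)) \<le> u + 1}
        \<subseteq> {d. d dvd \<Prod>T \<and> exp u < real d \<and> real d \<le> exp (u + 1)}"
      using assms(1) by (auto simp only: l mem_Collect_eq exp_less_cancel_iff exp_le_cancel_iff prod_dvd_prod_subset image_iff)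
    show "finite {d. d dvd \<Prod>T \<and> exp u < real d \<and> real d \<le> exp (u + 1)}"
      using nz by (auto intro: finite_subset[of _ "{d. d dvd \<Prod>T}"])
  qed
  also have "\<dots> \<le> Delta (\<Prod>T)" by (rule Delta_ge[OF nz])
  finally show ?thesis .
qed

lemma Delta_pigeonhole:
  assumes T: "finite T" "\<And>p. p \<in> T \<Longrightarrow> prime (p::nat)"
    and F: "F \<subseteq> Pow T" "\<And>X. X \<in> F \<Longrightarrow> u \<le> (\<Sum>p\<in>X. ln (real p)) \<and> (\<Sum>p\<in>X. ln (real p)) \<le> u + W"
    and W: "0 \<le> W"
  shows "real (card F) \<le> (W + 2) * real (Delta (\<Prod>T))"
proof -
  define N where "N = nat \<lceil>W\<rceil>"
  let ?l = "\<lambda>X. \<Sum>p\<in>X. ln (real p)"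
  \<comment> \<open>The unit intervals are open on the left, so the lowest one starts at
    \<open>u - 1\<close> in order to contain the value \<open>u\<close>. There are
    \<open>N + 1\<close> of them and \<open>N < W + 1\<close>, hence the factor
    \<open>W + 2\<close>.\<close>
  let ?C = "\<lambda>i. {X. X \<subseteq> T \<and> u - 1 + real i < ?l X \<and> ?l X \<le> u - 1 + real i + 1}"
  have "F \<subseteq> (\<Union>i\<le>N. ?C i)"
  proof
    fix X assume X: "X \<in> F"
    define z where "z = ?l X - u"
    have z: "0 \<le> z" "z \<le> W" using F(2)[OF X] by (auto simp: z_def)
    define i where "i = nat \<lceil>z\<rceil>"
    have "real i = of_int \<lceil>z\<rceil>" using z by (simp add: i_def)
    then have "z \<le> real i" "real i < z + 1" by linarith+
    moreover have "i \<le> N" using z by (simp only: i_def N_def nat_mono ceiling_mono)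
    ultimately have "X \<in> ?C i" "i \<in> {..N}" using X F(1) unfolding z_def by auto
    then show "X \<in> (\<Union>i\<le>N. ?C i)" by blast
  qed
  then have "card F \<le> card (\<Union>i\<le>N. ?C i)" using T by (intro card_mono) auto
  also have "\<dots> \<le> (\<Sum>i\<le>N. card (?C i))" by (rule card_UN_le) simp
  also have "\<dots> \<le> (\<Sum>i\<le>N. Delta (\<Prod>T))" by (intro sum_mono Delta_prod_ge T)
  finally have "card F \<le> (N + 1) * Delta (\<Prod>T)" by simp
  then have "real (card F) \<le> real ((N + 1) * Delta (\<Prod>T))" by (rule of_nat_mono)
  also have "\<dots> = (real N + 1) * real (Delta (\<Prod>T))" by (simp only: of_nat_mult of_nat_add of_nat_1)
  also have "real N = of_int \<lceil>W\<rceil>" unfolding N_def using W by simp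
  then have "real N + 1 \<le> W + 2" by linarith
  then have "(real N + 1) * real (Delta (\<Prod>T)) \<le> (W + 2) * real (Delta (\<Prod>T))"
    by (intro mult_right_mono) auto
  finally show ?thesis .
qed

lemma PL_scaled_disjoint:
  assumes "v > 0" "a \<noteq> (b::nat)"
  shows "PL (v * (real a - 1)) (v * a) \<inter> PL (v * (real b - 1)) (v * b) = {}"
proof -
  have "PL (v * (real a - 1)) (v * a) \<inter> PL (v * (real b - 1)) (v * b) = {}" if "a < b" for a b :: nat
  proof -
    have "real a \<le> real b - 1" using that by simp
    then have "v * a \<le> v * (real b - 1)" using assms(1) by (intro mult_left_mono) auto
    then show ?thesis by (auto simp: PL_def)
  qed
  then show ?thesis using assms(2) by (metis inf_commute linorder_neqE_nat)
qed

text \<open>Multiplying all subproducts of \<open>U\<close> with the products that realise one equal-sum family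
  gives divisors with logarithms in a single interval; each large prime is known up to a factor
  \<open>exp v\<close> only.\<close>

lemma Delta_ge_stages:
  assumes T: "finite T" "\<And>p. p \<in> T \<Longrightarrow> prime (p::nat)" and U: "U \<subseteq> T" and v: "v > 0"
    and S: "finite S" "\<And>i. i \<in> S \<Longrightarrow> finite (A i)" "disjoint_family_on A S"
      "\<And>i. i \<in> S \<Longrightarrow> k \<le> mEq (A i)"
    and A: "\<And>i a. i \<in> S \<Longrightarrow> a \<in> A i \<Longrightarrow> (T - U) \<inter> PL (v * (real a - 1)) (v * a) \<noteq> {}"
  shows "2 ^ card U * real k ^ card S \<le> ((\<Sum>p\<in>U. ln (real p)) + v * card T + 2) * real (Delta (\<Prod>T))"
proof -
  let ?A = "\<Union>i\<in>S. A i"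
  let ?l = "\<lambda>X. \<Sum>p\<in>X. ln (real p)"
  obtain F s where F: "F \<subseteq> Pow ?A" "card F = k ^ card S" "\<And>B. B \<in> F \<Longrightarrow> \<Sum>B = s"
    using equal_sums_UN[OF S] by blast
  have fA: "finite ?A" using S by auto
  have fU: "finite U" using U T finite_subset by blast
  have "\<exists>p. p \<in> (T - U) \<inter> PL (v * (real a - 1)) (v * a)" if "a \<in> ?A" for a using A that by blast
  then obtain p where p: "\<And>a. a \<in> ?A \<Longrightarrow> p a \<in> (T - U) \<inter> PL (v * (real a - 1)) (v * a)" by metis
  have pT: "p a \<in> T" "p a \<notin> U" "v * (real a - 1) \<le> ln (real (p a))" "ln (real (p a)) \<le> v * a" if "a \<in> ?A" for a
    using p[OF that] by (auto simp: PL_def)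
  have injp: "inj_on p ?A"
    using p PL_scaled_disjoint[OF v] by (intro inj_onI) (metis IntD2 disjoint_iff)
  have cA: "card ?A \<le> card T"
    using injp pT(1) T(1) by (intro card_inj_on_le[of p] image_subsetI)
  let ?g = "\<lambda>(X, B). X \<union> p ` B"
  have inj: "inj_on ?g (Pow U \<times> F)"
  proof (rule inj_onI, clarify)
    fix X B X' B' assume a: "X \<subseteq> U" "B \<in> F" "X' \<subseteq> U" "B' \<in> F" "X \<union> p ` B = X' \<union> p ` B'"
    have sub: "B \<subseteq> ?A" "B' \<subseteq> ?A" using a F(1) by auto
    then have "p ` B \<inter> U = {}" "p ` B' \<inter> U = {}" using pT(2) by blast+
    then have "X = (X \<union> p ` B) \<inter> U" "X' = (X' \<union> p ` B') \<inter> U" "p ` B = (X \<union> p ` B) - U" "p ` B' = (X' \<union> p ` B') - U"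
      using a(1,3) by blast+
    then have "X = X'" "p ` B = p ` B'" using a(5) by metis+
    moreover have "B = B'" using \<open>p ` B = p ` B'\<close> sub injp by (simp add: inj_on_image_eq_iff)
    ultimately show "X = X' \<and> B = B'" by simp
  qed
  have card: "card (?g ` (Pow U \<times> F)) = 2 ^ card U * k ^ card S"
    using F fU by (simp add: card_image[OF inj] card_cartesian_product card_Pow)
  have l0: "0 \<le> ?l X" if "X \<subseteq> U" for X
    using that U T(2) by (intro sum_nonneg ln_ge_zero) (auto simp: Suc_leI prime_gt_0_nat)
  have "real (card (?g ` (Pow U \<times> F))) \<le> ((?l U + v * card T) + 2) * real (Delta (\<Prod>T))"
  \<comment> \<open>The prime chosen in cell \<open>a\<close> has its logarithm at most
    \<open>v\<close> below \<open>v * a\<close>. Over \<open>B\<close> these add up to at most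
    \<open>v * s\<close>, and to at least \<open>v * s - v * card T\<close> because \<open>B\<close>
    injects into \<open>T\<close>; so one interval serves all \<open>B\<close>.\<close>
  proof (rule Delta_pigeonhole[OF T, of _ "v * s - v * card T"])
    show "?g ` (Pow U \<times> F) \<subseteq> Pow T"
    proof (rule image_subsetI, clarify)
      fix X B x assume XB: "X \<subseteq> U" "B \<in> F" "x \<in> X \<union> p ` B"
      then have "B \<subseteq> ?A" using F(1) by blast
      then have "p ` B \<subseteq> T" using pT(1) by blast
      then show "x \<in> T" using XB U by blast
    qed
    show "0 \<le> ?l U + v * card T" using l0[of U] v by simp
  next
    fix Z assume "Z \<in> ?g ` (Pow U \<times> F)"
    then obtain X B where XB: "X \<subseteq> U" "B \<in> F" "Z = X \<union> p ` B" by auto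
    have B: "B \<subseteq> ?A" using XB F by auto
    have fin: "finite X" "finite B" using XB fU fA B finite_subset by blast+
    have dis: "X \<inter> p ` B = {}" using XB(1) B pT(2) by blast
    have lZ: "?l Z = ?l X + (\<Sum>a\<in>B. ln (real (p a)))"
      using XB(3) fin dis inj_on_subset[OF injp B] by (simp add: sum.union_disjoint sum.reindex)
    have sB: "(\<Sum>a\<in>B. real a) = real s" using F(3)[OF XB(2)] by (simp flip: of_nat_sum)
    have "(\<Sum>a\<in>B. ln (real (p a))) \<le> (\<Sum>a\<in>B. v * a)"
      by (intro sum_mono pT(4) subsetD[OF B])
    then have up: "(\<Sum>a\<in>B. ln (real (p a))) \<le> v * s" by (simp add: sB flip: sum_distrib_left)
    have "(\<Sum>a\<in>B. v * (real a - 1)) \<le> (\<Sum>a\<in>B. ln (real (p a)))"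
      by (intro sum_mono pT(3) subsetD[OF B])
    moreover have "(\<Sum>a\<in>B. v * (real a - 1)) = v * s - v * card B"
      by (simp add: sum_subtractf sB algebra_simps flip: sum_distrib_left)
    moreover have "card B \<le> card T" using card_mono[OF fA B] cA by simp
    then have "v * card B \<le> v * card T" using v by simp
    ultimately have lo: "v * s - v * card T \<le> (\<Sum>a\<in>B. ln (real (p a)))" by simp
    have "?l X \<le> ?l U" using XB(1) fU U T(2)
      by (intro sum_mono2 ln_ge_zero) (auto simp: Suc_leI prime_gt_0_nat)
    then show "v * s - v * card T \<le> ?l Z \<and> ?l Z \<le> v * s - v * card T + (?l U + v * card T)"
      using lZ up lo l0[OF XB(1)] by simp
  qed
  then show ?thesis unfolding card by simp
qed

section \<open>Local estimates\<close>

text \<open>Stirling with the right power of \<open>t\<close>: by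
  \<open>2 * (y - x) / (x + y) \<le> ln y - ln x\<close> at consecutive integers the difference of
  the two sides is monotone. The constant 1 gives equality at \<open>t = 1\<close>.\<close>

lemma ln_fact_le:
  fixes t :: nat
  assumes "1 \<le> t"
  shows "ln (fact t) \<le> 1 + ln t / 2 + t * ln t - t"
  using assms
proof (induction t rule: dec_induct)
  case (step t)
  have t: "real t \<ge> 1" using step by simp
  have "2 * (real (Suc t) - real t) / (real t + real (Suc t)) \<le> ln (real (Suc t)) - ln (real t)"
    using t by (intro ln_inverse_approx_ge) auto
  then have "1 / (real t + 1 / 2) \<le> ln (real (Suc t)) - ln t" by (simp add: field_simps)
  then have "1 \<le> (real t + 1 / 2) * (ln (real (Suc t)) - ln t)" using t by (simp add: field_simps)
  then have "1 + ln t / 2 + t * ln t \<le> ln (real (Suc t)) / 2 + t * ln (real (Suc t))"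
    by (simp add: algebra_simps)
  moreover have "ln (fact (Suc t) :: real) = ln (real (Suc t)) + ln (fact t)"
    by (simp add: ln_mult del: of_nat_Suc)
  ultimately show ?case using step.IH by (simp add: algebra_simps)
qed simp

text \<open>Stirling yields \<open>1 / sqrt t\<close>. With \<open>d = t - s\<close>, the bound
  \<open>ln t - ln s \<le> d / s\<close> leaves the exponent \<open>d + d ^ 2 / s\<close>, whose
  linear part cancels against \<open>exp (- s)\<close> and the factor \<open>exp t\<close> of
  Stirling.\<close>

lemma poisson_lower_bound:
  fixes t :: nat and s K :: real
  assumes t: "1 \<le> t" and s: "0 < s" and K: "\<bar>t - s\<bar> \<le> K"
  shows "exp (- (K\<^sup>2 / s) - 1) / sqrt t \<le> exp (- s) * s ^ t / fact t"
proof -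
  define d where "d = t - s"
  have t0: "0 < real t" using t by simp
  have "ln t - ln s \<le> (t - s) / s" using s t0 by (intro ln_diff_le)
  then have "t * (ln t - ln s) \<le> t * ((t - s) / s)" using t0 by (intro mult_left_mono) auto
  also have "\<dots> = d + d\<^sup>2 / s" using s by (simp add: d_def field_simps power2_eq_square)
  also have "d\<^sup>2 \<le> K\<^sup>2" using K unfolding d_def by (metis abs_ge_zero abs_le_square_iff abs_of_nonneg order_trans)
  finally have 1: "t * (ln t - ln s) \<le> d + K\<^sup>2 / s" using s by (simp add: divide_right_mono)
  have "ln (exp (- (K\<^sup>2 / s) - 1) / sqrt t) = - (K\<^sup>2 / s) - 1 - ln t / 2"
    using t0 by (simp add: ln_div ln_sqrt)
  also have "\<dots> \<le> - s + t * ln s - ln (fact t)"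
    using 1 ln_fact_le[OF t] by (simp add: d_def algebra_simps)
  also have "\<dots> = ln (exp (- s) * s ^ t / fact t)"
    using s by (simp add: ln_div ln_mult ln_realpow)
  finally show ?thesis using s t0 by (subst (asm) ln_le_cancel_iff) auto
qed

text \<open>Taylor's formula of order 2 with the remainder taken at \<open>s + w\<close>: its
  quadratic term has the shape of the correction for repeated entries in the induction
  below.\<close>

lemma power_add_le_second_order:
  fixes s w :: real
  assumes "0 \<le> s" "0 \<le> w"
  shows "(s + w) ^ (n + 2) \<le> s ^ (n + 2) + (real n + 2) * w * s ^ (n + 1) + (real n + 2) * (real n + 1) / 2 * w\<^sup>2 * (s + w) ^ n"
proof (induction n)
  case (Suc n)
  have sw: "s * (s + w) ^ n \<le> (s + w) ^ Suc n" using assms by (simp add: mult_right_mono)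
  have ss: "s ^ (n + 1) \<le> (s + w) ^ (n + 1)" using assms by (intro power_mono) auto
  have "(s + w) ^ (Suc n + 2) = (s + w) * (s + w) ^ (n + 2)" by simp
  also have "\<dots> \<le> (s + w) * (s ^ (n + 2) + (real n + 2) * w * s ^ (n + 1) + (real n + 2) * (real n + 1) / 2 * w\<^sup>2 * (s + w) ^ n)"
    by (rule mult_left_mono[OF Suc]) (use assms in simp)
  also have "\<dots> = s ^ (Suc n + 2) + (real (Suc n) + 2) * w * s ^ (Suc n + 1)
       + (real n + 2) * w\<^sup>2 * s ^ (n + 1) + (real n + 2) * (real n + 1) / 2 * w\<^sup>2 * (s + w) ^ Suc n"
    by (simp add: algebra_simps power2_eq_square)
  also have "\<dots> \<le> s ^ (Suc n + 2) + (real (Suc n) + 2) * w * s ^ (Suc n + 1)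
       + (real n + 2) * w\<^sup>2 * (s + w) ^ (n + 1) + (real n + 2) * (real n + 1) / 2 * w\<^sup>2 * (s + w) ^ Suc n"
    using ss assms by (intro add_mono mult_left_mono) auto
  also have "\<dots> = s ^ (Suc n + 2) + (real (Suc n) + 2) * w * s ^ (Suc n + 1)
       + (real (Suc n) + 2) * (real (Suc n) + 1) / 2 * w\<^sup>2 * (s + w) ^ Suc n"
    by (simp add: field_simps)
  finally show ?case .
qed (simp add: power2_eq_square algebra_simps)

lemma power_add_ge_first_order:
  fixes s w :: real
  assumes "0 \<le> s" "0 \<le> w"
  shows "s ^ n + n * w * s ^ (n - 1) \<le> (s + w) ^ n"
proof (induction n)
  case (Suc n)
  have "s ^ Suc n + Suc n * w * s ^ (Suc n - 1) = s * s ^ n + n * w * s ^ n + w * s ^ n" by (simp add: algebra_simps)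
  also have "\<dots> \<le> s * s ^ n + n * w * s ^ n + w * (s + w) ^ n"
    using assms by (intro add_mono mult_left_mono power_mono) auto
  also have "s * s ^ n + n * w * s ^ n = s * (s ^ n + n * w * s ^ (n - 1))"
    by (cases n) (auto simp: algebra_simps)
  also have "\<dots> \<le> s * (s + w) ^ n" using assms Suc by (intro mult_left_mono)
  finally show ?case by (simp add: algebra_simps)
qed simp

text \<open>In terms of the elementary symmetric functions of the odds \<open>w\<close> this is
  \<open>t! e\<^sub>t \<ge> \<sigma>\<^sup>t - (t choose 2) \<sigma>\<^sub>2 \<sigma>\<^sup>t\<^sup>-\<^sup>2\<close>: the ordered tuples with a repeated entry are discarded.\<close>

lemma Esub_card_eq_lower_bound_aux:
  assumes "finite P" "\<And>p. p \<in> P \<Longrightarrow> 0 \<le> w p"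
  shows "(\<Sum>p\<in>P. w p) ^ t - t * (real t - 1) / 2 * (\<Sum>p\<in>P. (w p)\<^sup>2) * (\<Sum>p\<in>P. w p) ^ (t - 2)
     \<le> fact t * ((\<Prod>p\<in>P. 1 + w p) * Esub P (\<lambda>p. w p / (1 + w p)) (\<lambda>T. of_bool (card T = t)))"
  using assms
proof (induction P arbitrary: t rule: finite_induct)
  case empty
  then show ?case by (cases t) auto
next
  case (insert a P)
  let ?q = "\<lambda>p. w p / (1 + w p)"
  define s where "s = (\<Sum>p\<in>P. w p)"
  define s2 where "s2 = (\<Sum>p\<in>P. (w p)\<^sup>2)"
  \<comment> \<open>The product clears the denominators, so \<open>F t\<close> is the elementary
    symmetric function of degree \<open>t\<close> of the odds, and \<open>F'\<close> below is its
    recursion on adding the variable \<open>u\<close>.\<close>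
  define F where "F t = (\<Prod>p\<in>P. 1 + w p) * Esub P ?q (\<lambda>T. of_bool (card T = t))" for t
  define u where "u = w a"
  have nn: "0 \<le> s" "0 \<le> s2" "0 \<le> u" unfolding s_def s2_def u_def using insert.prems by (auto intro: sum_nonneg)
  have IH: "s ^ t - t * (real t - 1) / 2 * s2 * s ^ (t - 2) \<le> fact t * F t" for t
    unfolding s_def s2_def F_def using insert.prems by (intro insert.IH) auto
  have card: "card (insert a T) = Suc (card T)" if "T \<subseteq> P" for T
    using that insert.hyps finite_subset by (subst card_insert_disjoint) auto
  have F': "(\<Prod>p\<in>insert a P. 1 + w p) * Esub (insert a P) ?q (\<lambda>T. of_bool (card T = t))
      = (if t = 0 then F 0 else u * F (t - 1) + F t)" for t
  proof -
    have e: "Esub P ?q (\<lambda>T. of_bool (card (insert a T) = t)) = (if t = 0 then 0 else Esub P ?q (\<lambda>T. of_bool (card T = t - 1)))"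
    proof (cases t)
      case 0
      have "Esub P ?q (\<lambda>T. of_bool (card (insert a T) = 0)) = Esub P ?q (\<lambda>T. 0)"
        using card by (intro Esub_cong) auto
      then show ?thesis using 0 insert.hyps by (simp add: Esub_const)
    next
      case (Suc n)
      then show ?thesis using card by (simp, intro Esub_cong) auto
    qed
    have u1: "(1 + u) * (u / (1 + u)) = u" "(1 + u) * (1 - u / (1 + u)) = 1"
      using nn by (simp_all add: field_simps)
    have "(\<Prod>p\<in>insert a P. 1 + w p) * Esub (insert a P) ?q (\<lambda>T. of_bool (card T = t))
       = (\<Prod>p\<in>P. 1 + w p) * (((1 + u) * (u / (1 + u))) * Esub P ?q (\<lambda>T. of_bool (card (insert a T) = t))
           + ((1 + u) * (1 - u / (1 + u))) * Esub P ?q (\<lambda>T. of_bool (card T = t)))"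
      unfolding Esub_insert[OF insert.hyps] prod.insert[OF insert.hyps] u_def by (simp add: algebra_simps)
    then show ?thesis unfolding u1 e by (simp add: F_def algebra_simps)
  qed
  have sums: "(\<Sum>p\<in>insert a P. w p) = s + u" "(\<Sum>p\<in>insert a P. (w p)\<^sup>2) = s2 + u\<^sup>2"
    using insert.hyps by (auto simp: s_def s2_def u_def)
  consider "t = 0" | "t = 1" | n where "t = n + 2"
    by (metis One_nat_def Suc_1 add_2_eq_Suc' not0_implies_Suc)
  then show ?case
  proof cases
    case 1
    then show ?thesis unfolding F' sums using IH[of 0] by simp
  next
    case 2
    then show ?thesis unfolding F' sums using IH[of 0] IH[of 1] mult_left_mono[OF IH[of 0] nn(3)] by simp
  next
    case 3
    define m :: real where "m = n + 2"
    have mn: "real (n + 2) = m" "real (n + 1) = m - 1" "real n = m - 2" by (auto simp: m_def)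
    have m2: "2 \<le> m" by (simp add: m_def)
    define c where "c = m * (m - 1) / 2"
    have c: "0 \<le> c" using m2 by (simp add: c_def)
    have E: "(s + u) ^ (n + 2) \<le> s ^ (n + 2) + m * u * s ^ (n + 1) + m * (m - 1) / 2 * u\<^sup>2 * (s + u) ^ n"
      using power_add_le_second_order[OF nn(1,3), of n] by (simp add: m_def algebra_simps)
    have G: "s ^ n + (m - 2) * u * s ^ (n - 1) \<le> (s + u) ^ n"
      using power_add_ge_first_order[OF nn(1,3), of n] by (simp add: m_def)
    have I2: "s ^ (n + 2) - m * (m - 1) / 2 * s2 * s ^ n \<le> fact (n + 2) * F (n + 2)"
      using IH[of "n + 2"] unfolding mn by simp
    have I1: "s ^ (n + 1) - (m - 1) * (m - 2) / 2 * s2 * s ^ (n - 1) \<le> fact (n + 1) * F (n + 1)"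
      using IH[of "n + 1"] unfolding mn by simp
    \<comment> \<open>The quadratic Taylor term cancels the contribution of the square of
      \<open>u\<close> to the correction exactly. After the first-order bound \<open>G\<close> the
      rest is linear in \<open>u\<close> and splits into the two induction hypotheses.\<close>
    have "(s + u) ^ (n + 2) - m * (m - 1) / 2 * (s2 + u\<^sup>2) * (s + u) ^ n
       \<le> s ^ (n + 2) + m * u * s ^ (n + 1) - m * (m - 1) / 2 * s2 * (s + u) ^ n"
      using E unfolding c_def[symmetric] by (simp add: algebra_simps)
    also have "\<dots> \<le> s ^ (n + 2) + m * u * s ^ (n + 1) - m * (m - 1) / 2 * s2 * (s ^ n + (m - 2) * u * s ^ (n - 1))"
      using nn m2 by (intro diff_mono order_refl mult_left_mono[OF G]) auto
    also have "\<dots> = (s ^ (n + 2) - m * (m - 1) / 2 * s2 * s ^ n)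
        + m * u * (s ^ (n + 1) - (m - 1) * (m - 2) / 2 * s2 * s ^ (n - 1))"
      by (simp add: field_simps)
    also have "\<dots> \<le> fact (n + 2) * F (n + 2) + m * u * (fact (n + 1) * F (n + 1))"
      using nn m2 by (intro add_mono I2 mult_left_mono[OF I1]) auto
    also have "\<dots> = fact (n + 2) * (u * F (n + 1) + F (n + 2))"
      by (simp add: m_def algebra_simps)
    finally have "(s + u) ^ (n + 2) - m * (m - 1) / 2 * (s2 + u\<^sup>2) * (s + u) ^ n \<le> fact (n + 2) * (u * F (n + 1) + F (n + 2))" .
    then show ?thesis unfolding F' sums 3 mn by simp
  qed
qed

text \<open>The third condition on \<open>t\<close> makes the correction for repeated entries at
  most half of the main term \<open>s ^ t\<close>, whence the 2 in the denominator; with the product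
  bounded by \<open>exp s\<close> the rest is a Poisson probability.\<close>

lemma Esub_card_eq_lower_bound:
  assumes P: "finite P" "\<And>p. p \<in> P \<Longrightarrow> 0 \<le> w p" and s: "s = (\<Sum>p\<in>P. w p)" "0 < s"
    and t: "1 \<le> t" "\<bar>real t - s\<bar> \<le> K" "(real t)\<^sup>2 * (\<Sum>p\<in>P. (w p)\<^sup>2) \<le> s\<^sup>2"
  shows "exp (- (K\<^sup>2 / s) - 1) / (2 * sqrt t) \<le> Esub P (\<lambda>p. w p / (1 + w p)) (\<lambda>T. of_bool (card T = t))"
proof -
  let ?X = "Esub P (\<lambda>p. w p / (1 + w p)) (\<lambda>T. of_bool (card T = t))"
  let ?s2 = "\<Sum>p\<in>P. (w p)\<^sup>2"
  have "0 \<le> w p / (1 + w p) \<and> w p / (1 + w p) \<le> 1" if "p \<in> P" for p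
    using P(2)[OF that] by (simp add: divide_le_eq_1)
  then have X0: "0 \<le> ?X" by (intro Esub_nonneg) auto
  have s2: "0 \<le> ?s2" by (simp add: sum_nonneg)
  have "(\<Prod>p\<in>P. 1 + w p) \<le> (\<Prod>p\<in>P. exp (w p))"
    using P by (intro prod_mono) (auto simp: add_nonneg_nonneg)
  also have "\<dots> = exp s" unfolding s by (simp add: exp_sum P)
  finally have pr: "(\<Prod>p\<in>P. 1 + w p) \<le> exp s" .
  have "t * (real t - 1) / 2 * ?s2 * s ^ (t - 2) \<le> s ^ t / 2"
  proof (cases "t = 1")
    case False
    then obtain n where n: "t = n + 2" using t(1) by (metis add.commute le_add_diff_inverse le_less less_eq_Suc_le numeral_2_eq_2 One_nat_def)
    have "t * (real t - 1) * ?s2 \<le> s\<^sup>2"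
    proof -
      have "t * (real t - 1) \<le> (real t)\<^sup>2" by (simp add: power2_eq_square algebra_simps)
      then have "t * (real t - 1) * ?s2 \<le> (real t)\<^sup>2 * ?s2" using s2 by (rule mult_right_mono)
      then show ?thesis using t(3) by linarith
    qed
    then have "t * (real t - 1) * ?s2 * s ^ n \<le> s\<^sup>2 * s ^ n" using s by (intro mult_right_mono) auto
    then show ?thesis unfolding n by (simp add: power_add power2_eq_square mult_ac)
  qed (use s in auto)
  then have "s ^ t / 2 \<le> s ^ t - t * (real t - 1) / 2 * ?s2 * s ^ (t - 2)" by simp
  also have "\<dots> \<le> fact t * ((\<Prod>p\<in>P. 1 + w p) * ?X)"
    using Esub_card_eq_lower_bound_aux[OF P, where t = t] unfolding s(1) by simp
  also have "\<dots> \<le> fact t * (exp s * ?X)"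
    using pr X0 by (intro mult_left_mono mult_right_mono) auto
  finally have 1: "exp (- s) * s ^ t / fact t / 2 \<le> ?X"
    by (simp add: exp_minus field_simps)
  have "exp (- (K\<^sup>2 / s) - 1) / (2 * sqrt t) = exp (- (K\<^sup>2 / s) - 1) / sqrt t / 2" by simp
  also have "\<dots> \<le> exp (- s) * s ^ t / fact t / 2"
    using poisson_lower_bound[OF t(1) s(2) t(2)] by (rule divide_right_mono) simp
  also note 1
  finally show ?thesis .
qed

section \<open>Prime sums and products for the two success probabilities\<close>

lemma sum_PL_untilted:
  assumes "1 \<le> s" "s \<le> t"
  shows "\<bar>(\<Sum>p\<in>PL s t. 1 / (real p + 1)) - ln (t / s)\<bar> \<le> 24 / s"
proof -
  have up: "(\<Sum>p\<in>PL s t. 1 / (real p + 1)) \<le> (\<Sum>p\<in>PL s t. 1 / real p)"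
    by (intro sum_mono divide_left_mono) (auto dest: PL_gt_1)
  have "(\<Sum>p\<in>PL s t. 1 / real p - 1 / (real p)\<^sup>2) \<le> (\<Sum>p\<in>PL s t. 1 / (real p + 1))"
  proof (intro sum_mono)
    fix p assume "p \<in> PL s t"
    then have "real p > 1" by (auto dest: PL_gt_1)
    then show "1 / real p - 1 / (real p)\<^sup>2 \<le> 1 / (real p + 1)" by (simp add: field_simps power2_eq_square)
  qed
  then have lo: "(\<Sum>p\<in>PL s t. 1 / real p) - 2 / s \<le> (\<Sum>p\<in>PL s t. 1 / (real p + 1))"
    using sum_inverse_squares_PL_le[OF assms(1), of t] by (simp add: sum_subtractf)
  have "24 / s = 22 / s + 2 / s" "0 \<le> 2 / s" using assms by (auto simp: field_simps)
  then show ?thesis using mertens_second[OF assms] up lo by linarith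
qed

text \<open>\<open>2 / p - 2 / (p + 2)\<close> is at most \<open>4 / p ^ 2\<close>, so 52 is twice
  the 22 of Mertens plus four times the 2 of the inverse squares.\<close>

lemma sum_PL_tilted:
  assumes "1 \<le> s" "s \<le> t"
  shows "\<bar>(\<Sum>p\<in>PL s t. 2 / (real p + 2)) - 2 * ln (t / s)\<bar> \<le> 52 / s"
proof -
  have up: "(\<Sum>p\<in>PL s t. 2 / (real p + 2)) \<le> (\<Sum>p\<in>PL s t. 2 * (1 / real p))"
    by (intro sum_mono) (auto dest!: PL_gt_1 simp: field_simps)
  have "(\<Sum>p\<in>PL s t. 2 * (1 / real p) - 4 * (1 / (real p)\<^sup>2)) \<le> (\<Sum>p\<in>PL s t. 2 / (real p + 2))"
  proof (intro sum_mono)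
    fix p assume "p \<in> PL s t"
    then have "real p > 1" by (auto dest: PL_gt_1)
    then show "2 * (1 / real p) - 4 * (1 / (real p)\<^sup>2) \<le> 2 / (real p + 2)" by (simp add: field_simps power2_eq_square)
  qed
  then have lo: "2 * (\<Sum>p\<in>PL s t. 1 / real p) - 4 * (2 / s) \<le> (\<Sum>p\<in>PL s t. 2 / (real p + 2))"
    using sum_inverse_squares_PL_le[OF assms(1), of t]
    unfolding sum_subtractf sum_distrib_left[symmetric] by linarith
  have "52 / s = 2 * (22 / s) + 4 * (2 / s)" "0 \<le> 2 / s" using assms by (auto simp: field_simps)
  then show ?thesis using mertens_second[OF assms] up lo unfolding sum_distrib_left[symmetric] by linarith
qed

text \<open>A lower bound for the total mass of the tilt, by
  \<open>ln (1 + x) \<ge> x - x ^ 2\<close>; the squares add 2 to the 24.\<close>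

lemma prod_PL_ge:
  assumes "1 \<le> s" "s \<le> t"
  shows "t / s * exp (- (26 / s)) \<le> (\<Prod>p\<in>PL s t. 1 + 1 / (real p + 1))"
proof -
  have "ln (t / s) - 24 / s \<le> (\<Sum>p\<in>PL s t. 1 / (real p + 1))" using sum_PL_untilted[OF assms] by linarith
  moreover have "(\<Sum>p\<in>PL s t. (1 / (real p + 1))\<^sup>2) \<le> (\<Sum>p\<in>PL s t. 1 / (real p)\<^sup>2)"
    unfolding power_divide by (intro sum_mono) (auto intro!: divide_left_mono power_mono dest!: PL_gt_1)
  ultimately have "ln (t / s) - 24 / s - 2 / s \<le> (\<Sum>p\<in>PL s t. 1 / (real p + 1) - (1 / (real p + 1))\<^sup>2)"
    using sum_inverse_squares_PL_le[OF assms(1), of t] by (simp add: sum_subtractf)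
  also have "\<dots> \<le> (\<Sum>p\<in>PL s t. ln (1 + 1 / (real p + 1)))"
    by (intro sum_mono ln_one_plus_pos_lower_bound) auto
  finally have "exp (ln (t / s) - 24 / s - 2 / s) \<le> exp (\<Sum>p\<in>PL s t. ln (1 + 1 / (real p + 1)))" by simp
  also have "\<dots> = (\<Prod>p\<in>PL s t. 1 + 1 / (real p + 1))"
    by (subst exp_sum) (auto intro!: prod.cong exp_ln add_pos_nonneg)
  also have "ln (t / s) - 24 / s - 2 / s = ln (t / s) - 26 / s" by (simp add: field_simps)
  also have "exp (ln (t / s) - 26 / s) = t / s * exp (- (26 / s))"
    unfolding diff_conv_add_uminus exp_add using assms by simp
  finally show ?thesis .
qed

lemma abs_exp_minus_one_le: "\<bar>y\<bar> \<le> 1 / 2 \<Longrightarrow> \<bar>exp y - 1\<bar> \<le> 2 * \<bar>y\<bar>" for y :: real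
proof (cases "y \<ge> 0")
  case False
  assume "\<bar>y\<bar> \<le> 1 / 2"
  moreover have "exp y \<le> 1" using False by simp
  ultimately show ?thesis using exp_ge_add_one_self[of y] False by linarith
qed (use real_exp_bound_lemma[of y] in auto)

text \<open>Since \<open>1 - 1 / (p + 1)\<close> is the inverse of \<open>1 + 1 / p\<close>,
  Mertens' theorem puts the probability of missing the cell close to \<open>(a - 1) / a\<close>.
  This is how the law \<open>1 / a\<close> of the random set arises from primes. The threshold 48
  keeps the error \<open>24 / s\<close> in the exponent at most 1/2, where the exponential can be
  linearised.\<close>

lemma block_hit_prob:
  assumes v: "48 \<le> v * (real a - 1)" and a: "2 \<le> (a::nat)" and v0: "0 < v"
  shows "\<bar>(1 - (\<Prod>p\<in>PL (v * (real a - 1)) (v * a). 1 - 1 / (real p + 1))) - 1 / a\<bar> \<le> 48 / (v * a)"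
proof -
  let ?I = "PL (v * (real a - 1)) (v * a)"
  define s where "s = v * (real a - 1)"
  have s: "48 \<le> s" "s \<le> v * a" using v v0 by (auto simp: s_def)
  have ratio: "v * a / s = a / (real a - 1)" using v0 by (simp add: s_def)
  have up: "(\<Sum>p\<in>?I. ln (1 + 1 / real p)) \<le> (\<Sum>p\<in>?I. 1 / real p)"
    by (intro sum_mono ln_add_one_self_le_self) auto
  have "(\<Sum>p\<in>?I. 1 / real p - (1 / real p)\<^sup>2) \<le> (\<Sum>p\<in>?I. ln (1 + 1 / real p))"
    by (intro sum_mono ln_one_plus_pos_lower_bound) (auto dest!: PL_gt_1)
  then have lo: "(\<Sum>p\<in>?I. 1 / real p) - 2 / s \<le> (\<Sum>p\<in>?I. ln (1 + 1 / real p))"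
    using sum_inverse_squares_PL_le[of s "v * a"] s by (simp add: sum_subtractf s_def power_divide)
  define th where "th = (\<Sum>p\<in>?I. ln (1 + 1 / real p)) - ln (a / (real a - 1))"
  have m: "\<bar>(\<Sum>p\<in>?I. 1 / real p) - ln (a / (real a - 1))\<bar> \<le> 22 / s"
    using mertens_second[of s "v * a"] s unfolding ratio by (simp add: s_def)
  have "24 / s = 22 / s + 2 / s" "0 \<le> 2 / s" using s by (auto simp: field_simps)
  then have th: "\<bar>th\<bar> \<le> 24 / s" using m up lo unfolding th_def by linarith
  also have "24 / s \<le> 1 / 2" using s by (simp add: field_simps)
  finally have th2: "\<bar>- th\<bar> \<le> 1 / 2" by simp
  have "(\<Prod>p\<in>?I. 1 - 1 / (real p + 1)) = (\<Prod>p\<in>?I. exp (- ln (1 + 1 / real p)))"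
  proof (intro prod.cong refl)
    fix p assume "p \<in> ?I"
    then have "real p > 1" by (auto dest: PL_gt_1)
    then show "1 - 1 / (real p + 1) = exp (- ln (1 + 1 / real p))"
      by (simp add: exp_minus field_simps)
  qed
  also have "\<dots> = exp (- (\<Sum>p\<in>?I. ln (1 + 1 / real p)))" by (simp add: exp_sum sum_negf[symmetric])
  also have "\<dots> = exp (- ln (a / (real a - 1))) * exp (- th)" unfolding th_def by (simp add: exp_add[symmetric])
  also have "exp (- ln (a / (real a - 1))) = (real a - 1) / a" using a by (simp add: exp_minus)
  finally have pr: "(\<Prod>p\<in>?I. 1 - 1 / (real p + 1)) = (real a - 1) / a * exp (- th)" .
  have r: "1 / real a = 1 - (real a - 1) / a" using a by (simp add: field_simps)
  have "(1 - (\<Prod>p\<in>?I. 1 - 1 / (real p + 1))) - 1 / a = - ((real a - 1) / a * (exp (- th) - 1))"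
    unfolding pr r by (simp add: right_diff_distrib)
  also have "\<bar>\<dots>\<bar> = (real a - 1) / a * \<bar>exp (- th) - 1\<bar>" using a by (simp add: abs_mult)
  also have "\<dots> \<le> (real a - 1) / a * (2 * (24 / s))"
    using abs_exp_minus_one_le[OF th2] th a by (intro mult_left_mono) auto
  also have "\<dots> = 48 / (v * a)" using a v0 s by (simp add: s_def field_simps)
  finally show ?thesis .
qed

section \<open>The integer model and the random set as random subsets\<close>

lemma expectation_n_lt:
  "measure_pmf.expectation (n_lt_pmf x) g
     = Esub {p. prime p \<and> real p < x} (\<lambda>p. 1 / (real p + 1)) (\<lambda>T. g (\<Prod>T))"
proof -
  define P where "P = {p::nat. prime p \<and> real p < x}"
  have fin: "finite P" unfolding P_def by (rule finite_subset[of _ "{..nat \<lceil>x\<rceil>}"]) (auto, linarith)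
  let ?q = "\<lambda>p::nat. 1 / (real p + 1)"
  have "Pi_pmf P 1 np_pmf = Pi_pmf P 1 (\<lambda>p. bind_pmf (bernoulli_pmf (?q p)) (\<lambda>b. return_pmf (if b then p else 1)))"
    unfolding np_pmf_def map_pmf_def by simp
  \<comment> \<open>Outside \<open>P\<close> the default \<open>False\<close> corresponds to the
    factor 1.\<close>
  also have "\<dots> = map_pmf (\<lambda>f p. if p \<in> P then (if f p then p else 1) else 1) (Pi_pmf P False (\<lambda>p. bernoulli_pmf (?q p)))"
    by (subst Pi_pmf_bind[OF fin, where d' = False]) (simp add: fin map_pmf_def del: One_nat_def)
  finally have "n_lt_pmf x = map_pmf (\<lambda>f. \<Prod>{p\<in>P. f p}) (Pi_pmf P False (\<lambda>p. bernoulli_pmf (?q p)))"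
    unfolding n_lt_pmf_def P_def[symmetric]
    by (simp add: pmf.map_comp o_def fin prod.inter_filter cong: prod.cong)
  then have "measure_pmf.expectation (n_lt_pmf x) g
      = measure_pmf.expectation (Pi_pmf P False (\<lambda>p. bernoulli_pmf (?q p))) (\<lambda>f. g (\<Prod>{p\<in>P. f p}))"
    by simp
  also have "\<dots> = Esub P ?q (\<lambda>T. g (\<Prod>T))"
    by (rule expectation_Pi_bernoulli[OF fin, of ?q "\<lambda>T. g (\<Prod>T)"]) auto
  finally show ?thesis unfolding P_def .
qed

lemma finite_window [simp]: "finite (window D c)"
proof -
  have "window D c \<subseteq> {..nat \<lceil>D\<rceil>}" unfolding window_def by (auto, linarith)
  then show ?thesis by (rule finite_subset) simp
qed

lemma prob_randA:
  "measure_pmf.prob (randA_window_pmf D c) {S. k \<le> mEq S} = Esub (window D c) (\<lambda>a. 1 / real a) (\<lambda>A. of_bool (k \<le> mEq A))"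
proof -
  let ?M = "Pi_pmf (window D c) False (\<lambda>a. bernoulli_pmf (1 / real a))"
  have "measure_pmf.prob (randA_window_pmf D c) {S. k \<le> mEq S}
      = measure_pmf.expectation ?M (indicator {f. k \<le> mEq {a\<in>window D c. f a}})"
    unfolding randA_window_pmf_def by (simp add: vimage_def)
  also have "\<dots> = measure_pmf.expectation ?M (\<lambda>f. of_bool (k \<le> mEq {a\<in>window D c. f a}))"
    by (intro Bochner_Integration.integral_cong) (auto simp: indicator_def)
  also have "\<dots> = Esub (window D c) (\<lambda>a. 1 / real a) (\<lambda>A. of_bool (k \<le> mEq A))"
    by (rule expectation_Pi_bernoulli[OF finite_window]) (auto simp: window_def)
  finally show ?thesis .
qed

section \<open>The tilted model\<close>

lemma sum_inverse_le_ln: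
  assumes "1 \<le> n"
  shows "(\<Sum>a=1..n. 1 / real a) \<le> 1 + ln n"
  using assms
proof (induction n rule: dec_induct)
  case (step n)
  have "ln (real n) - ln (real (Suc n)) \<le> (real n - real (Suc n)) / real (Suc n)"
    using step by (intro ln_diff_le) auto
  then have "1 / real (Suc n) \<le> ln (real (Suc n)) - ln n" by (simp add: field_simps)
  then show ?case using step by simp
qed simp

lemma sum_inverse_window_le:
  assumes "1 \<le> D"
  shows "(\<Sum>a\<in>window D c. 1 / real a) \<le> 1 + ln D"
proof -
  have n: "1 \<le> nat \<lfloor>D\<rfloor>" "real (nat \<lfloor>D\<rfloor>) \<le> D" using assms by linarith+
  have "window D c \<subseteq> {1..nat \<lfloor>D\<rfloor>}" unfolding window_def by (auto simp: le_nat_floor)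
  then have "(\<Sum>a\<in>window D c. 1 / real a) \<le> (\<Sum>a=1..nat \<lfloor>D\<rfloor>. 1 / real a)" by (intro sum_mono2) auto
  also have "\<dots> \<le> 1 + ln (real (nat \<lfloor>D\<rfloor>))" by (rule sum_inverse_le_ln[OF n(1)])
  also have "ln (real (nat \<lfloor>D\<rfloor>)) \<le> ln D" using n by (subst ln_le_cancel_iff) auto
  finally show ?thesis by simp
qed

text \<open>The logarithms of the primes of \<open>T\<close> in units of \<open>v\<close>, each
  rounded to the integer \<open>floor (ln p / v) + 1\<close>, as far as they fall into
  \<open>W\<close>.\<close>

abbreviation hits :: "real \<Rightarrow> nat set \<Rightarrow> nat set \<Rightarrow> nat set" where
  "hits v W T \<equiv> {a\<in>W. T \<inter> PL (v * (real a - 1)) (v * a) \<noteq> {}}"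

text \<open>The cells are disjoint, so the hit indices form a random subset of the window whose
  probabilities differ from \<open>1 / a\<close> by at most \<open>48 / (v * a)\<close>; the total
  variation bound and a harmonic sum give the last term.\<close>

lemma stage_failure_le:
  assumes P: "finite P" and sub: "(\<Union>a\<in>window D c. PL (v * (real a - 1)) (v * a)) \<subseteq> P"
    and q: "\<And>a p. a \<in> window D c \<Longrightarrow> p \<in> PL (v * (real a - 1)) (v * a) \<Longrightarrow> q p = 1 / (real p + 1)"
    and v: "0 < v" "\<And>a. a \<in> window D c \<Longrightarrow> 2 \<le> a \<and> 48 \<le> v * (real a - 1)" and D: "1 \<le> D"
  shows "Esub P q (\<lambda>T. of_bool (\<not> k \<le> mEq (hits v (window D c) T)))
     \<le> 1 - measure_pmf.prob (randA_window_pmf D c) {S. k \<le> mEq S} + 48 / v * (1 + ln D)"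
proof -
  let ?W = "window D c"
  let ?I = "\<lambda>a. PL (v * (real a - 1)) (v * a)"
  let ?q' = "\<lambda>a. 1 - (\<Prod>p\<in>?I a. 1 - 1 / (real p + 1))"
  have dis: "disjoint_family_on ?I ?W"
    using PL_scaled_disjoint[OF v(1)] by (auto simp: disjoint_family_on_def)
  have "Esub P q (\<lambda>T. of_bool (\<not> k \<le> mEq (hits v ?W T)))
      = Esub P q (\<lambda>T. of_bool (\<not> k \<le> mEq (hits v ?W (T \<inter> (\<Union>a\<in>?W. ?I a)))))"
    by (intro Esub_cong refl arg_cong[where f = "\<lambda>A. of_bool (\<not> k \<le> mEq A)"]) blast
  also have "\<dots> = Esub (\<Union>a\<in>?W. ?I a) q (\<lambda>T. of_bool (\<not> k \<le> mEq (hits v ?W T)))"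
    by (rule Esub_Int[OF P sub])
  also have "\<dots> = Esub (\<Union>a\<in>?W. ?I a) (\<lambda>p. 1 / (real p + 1)) (\<lambda>T. of_bool (\<not> k \<le> mEq (hits v ?W T)))"
    using q by (intro Esub_cong) auto
  also have "\<dots> = Esub ?W ?q' (\<lambda>A. of_bool (\<not> k \<le> mEq A))"
    by (rule Esub_blocks[OF _ _ dis, where g = "\<lambda>A. of_bool (\<not> k \<le> mEq A)"]) auto
  also have "\<dots> \<le> Esub ?W (\<lambda>a. 1 / real a) (\<lambda>A. of_bool (\<not> k \<le> mEq A)) + (\<Sum>a\<in>?W. \<bar>?q' a - 1 / a\<bar>)"
  proof -
    have q': "0 \<le> ?q' a \<and> ?q' a \<le> 1" for a
    proof -
      have "0 \<le> (\<Prod>p\<in>?I a. 1 - 1 / (real p + 1))" "(\<Prod>p\<in>?I a. 1 - 1 / (real p + 1)) \<le> 1"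
        by (auto intro!: prod_nonneg prod_le_1)
      then show ?thesis by simp
    qed
    have "\<bar>Esub ?W ?q' (\<lambda>A. of_bool (\<not> k \<le> mEq A)) - Esub ?W (\<lambda>a. 1 / real a) (\<lambda>A. of_bool (\<not> k \<le> mEq A))\<bar>
       \<le> (\<Sum>a\<in>?W. \<bar>?q' a - 1 / a\<bar>)"
      using q' by (intro Esub_change_weights finite_window) (auto simp: window_def Suc_le_eq)
    then show ?thesis by linarith
  qed
  also have "(\<Sum>a\<in>?W. \<bar>?q' a - 1 / a\<bar>) \<le> (\<Sum>a\<in>?W. 48 / v * (1 / a))"
  proof (intro sum_mono)
    fix a assume "a \<in> ?W"
    then show "\<bar>?q' a - 1 / a\<bar> \<le> 48 / v * (1 / a)" using block_hit_prob[of v a] v by simp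
  qed
  also have "\<dots> = 48 / v * (\<Sum>a\<in>?W. 1 / real a)" by (simp only: sum_distrib_left)
  also have "\<dots> \<le> 48 / v * (1 + ln D)"
    using sum_inverse_window_le[OF D] v by (intro mult_left_mono) auto
  also have "Esub ?W (\<lambda>a. 1 / real a) (\<lambda>A. of_bool (\<not> k \<le> mEq A))
      = Esub ?W (\<lambda>a. 1 / real a) (\<lambda>A. 1 + (- 1) * of_bool (k \<le> mEq A))"
    by (intro Esub_cong) auto
  also have "\<dots> = 1 - measure_pmf.prob (randA_window_pmf D c) {S. k \<le> mEq S}"
    unfolding prob_randA Esub_add Esub_cmult by (simp add: Esub_const)
  finally show ?thesis by simp
qed

text \<open>Markov's inequality for the number of failing indices, whose mean is at most
  \<open>d' * card I\<close> however the stages depend on each other.\<close>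

lemma many_failures_le:
  assumes P: "finite P" "\<And>p. p \<in> P \<Longrightarrow> 0 \<le> q p \<and> q p \<le> 1" and I: "finite I" "I \<noteq> {}"
    and d: "0 < d" and fl: "\<And>i. i \<in> I \<Longrightarrow> Esub P q (\<lambda>T. of_bool (\<not> G i T)) \<le> d'"
  shows "Esub P q (\<lambda>T. of_bool (\<not> (1 - d) * real (card I) \<le> real (card {i\<in>I. G i T}))) \<le> d' / d"
proof -
  have cI: "0 < real (card I)" using I by (simp add: card_gt_0_iff)
  have c: "(\<Sum>i\<in>I. of_bool (\<not> G i T)) = real (card I) - real (card {i\<in>I. G i T})" for T
  proof -
    have "real (card {i\<in>I. G i T}) + real (card {i\<in>I. \<not> G i T}) = real (card ({i\<in>I. G i T} \<union> {i\<in>I. \<not> G i T}))"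
      using I by (subst card_Un_disjoint) auto
    also have "{i\<in>I. G i T} \<union> {i\<in>I. \<not> G i T} = I" by blast
    finally show ?thesis using I by (simp add: sum_of_bool_mult[of I _ 1, simplified])
  qed
  have "Esub P q (\<lambda>T. of_bool (\<not> (1 - d) * real (card I) \<le> real (card {i\<in>I. G i T})))
     \<le> Esub P q (\<lambda>T. of_bool (d * card I \<le> (\<Sum>i\<in>I. of_bool (\<not> G i T))))"
    using P by (intro Esub_mono) (auto simp: c algebra_simps)
  also have "\<dots> \<le> Esub P q (\<lambda>T. \<Sum>i\<in>I. of_bool (\<not> G i T)) / (d * card I)"
    using P d cI by (intro Esub_markov) (auto intro: sum_nonneg)
  also have "\<dots> \<le> (\<Sum>i\<in>I. d') / (d * card I)"
    unfolding Esub_sum using fl d cI by (intro divide_right_mono sum_mono) auto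
  also have "\<dots> = d' / d" using cI by simp
  finally show ?thesis .
qed

section \<open>Typical events under the tilted measure\<close>

text \<open>What \<open>Esub_tilt\<close> makes of \<open>1 / (p + 1)\<close> when \<open>A\<close>
  consists of the primes with \<open>ln p < y\<close>.\<close>

definition tilted :: "real \<Rightarrow> nat \<Rightarrow> real" where
  "tilted y p = (if ln (real p) < y then 2 / (real p + 2) else 1 / (real p + 1))"

lemma tilted_bounds: "0 \<le> tilted y p \<and> tilted y p \<le> 1"
  by (auto simp: tilted_def)

lemma sum_tilted_below:
  assumes "1 \<le> s" "s \<le> t" "t \<le> y"
  shows "\<bar>(\<Sum>p\<in>PL s t. tilted y p) - 2 * ln (t / s)\<bar> \<le> 52 / s"
proof -
  have "(\<Sum>p\<in>PL s t. tilted y p) = (\<Sum>p\<in>PL s t. 2 / (real p + 2))"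
    using assms by (intro sum.cong) (auto simp: PL_def tilted_def)
  then show ?thesis using sum_PL_tilted[OF assms(1,2)] by simp
qed

lemma sum_tilted_above:
  assumes "1 \<le> s" "s \<le> t" "y \<le> s"
  shows "\<bar>(\<Sum>p\<in>PL s t. tilted y p) - ln (t / s)\<bar> \<le> 24 / s"
proof -
  have "(\<Sum>p\<in>PL s t. tilted y p) = (\<Sum>p\<in>PL s t. 1 / (real p + 1))"
    using assms by (intro sum.cong) (auto simp: PL_def tilted_def)
  then show ?thesis using sum_PL_untilted[OF assms(1,2)] by simp
qed

lemma PL_Un: "s \<le> t \<Longrightarrow> t \<le> u \<Longrightarrow> PL s u = PL s t \<union> PL t u"
  by (auto simp: PL_def)

lemma PL_mono: "s' \<le> s \<Longrightarrow> t \<le> t' \<Longrightarrow> PL s t \<subseteq> PL s' t'"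
  by (auto simp: PL_def)

text \<open>With \<open>d = b - a\<close> the mean is about \<open>2 * d\<close>, whereas the event
  forces a count of at most \<open>3 / 2 * d\<close> because \<open>ln 2 \<ge> 2 / 3\<close>. For
  \<open>d \<ge> 520\<close> the error 52 of the mean is at most \<open>d / 10\<close>, which leaves
  a deviation of \<open>4 / 10 * d\<close> for Chebyshev's inequality.\<close>

lemma low_count_below:
  assumes P: "finite P" "PL (exp a) (exp b) \<subseteq> P" and ab: "0 \<le> a" "520 \<le> b - a" "b \<le> j"
  shows "Esub P (tilted (exp j)) (\<lambda>T. of_bool (real (card (T \<inter> PL (exp a) (exp b))) * ln 2 \<le> b - a)) \<le> 14 / (b - a)"
proof -
  define d where "d = b - a"
  let ?A = "PL (exp a) (exp b)"
  let ?m = "\<Sum>p\<in>?A. tilted (exp j) p"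
  have "\<bar>?m - 2 * ln (exp b / exp a)\<bar> \<le> 52 / exp a"
    using ab by (intro sum_tilted_below) auto
  also have "52 / exp a \<le> 52" using ab by (simp add: field_simps)
  finally have m: "\<bar>?m - 2 * d\<bar> \<le> 52" by (simp add: d_def ln_div)
  have d: "520 \<le> d" using ab by (simp add: d_def)
  have "Esub P (tilted (exp j)) (\<lambda>T. of_bool (real (card (T \<inter> ?A)) * ln 2 \<le> b - a))
      \<le> Esub P (tilted (exp j)) (\<lambda>T. of_bool (4 / 10 * d \<le> \<bar>real (card (T \<inter> ?A)) - ?m\<bar>))"
  proof (rule Esub_mono)
    fix T
    have "4 / 10 * d \<le> \<bar>real (card (T \<inter> ?A)) - ?m\<bar>" if *: "real (card (T \<inter> ?A)) * ln 2 \<le> d"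
    proof -
      have "real (card (T \<inter> ?A)) * (2 / 3) \<le> real (card (T \<inter> ?A)) * ln 2"
        by (intro mult_left_mono ln2_ge_two_thirds) auto
      then have "real (card (T \<inter> ?A)) \<le> 3 / 2 * d" using * by linarith
      then show ?thesis using m d by linarith
    qed
    then show "of_bool (real (card (T \<inter> ?A)) * ln 2 \<le> b - a) \<le> (of_bool (4 / 10 * d \<le> \<bar>real (card (T \<inter> ?A)) - ?m\<bar>) :: real)"
      by (auto simp: d_def)
  qed (rule tilted_bounds)
  also have "\<dots> \<le> ?m / (4 / 10 * d)\<^sup>2"
    using d by (intro Esub_chebyshev[OF P(1) _ P(2)] tilted_bounds) auto
  also have "\<dots> \<le> (21 / 10 * d) / (4 / 10 * d)\<^sup>2" using m d by (intro divide_right_mono) auto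
  also have "\<dots> \<le> 14 / d" using d by (simp add: field_simps power2_eq_square)
  finally show ?thesis by (simp add: d_def)
qed

text \<open>Beyond \<open>j\<close> the mean is only about \<open>d = b - a\<close>, and
  \<open>ln 2 \<le> 25 / 36\<close> forces a count of at least \<open>36 / 25 * d\<close>. The 14 is
  that of the companion estimate, so that both sides of the peak are summed alike.\<close>

lemma high_count_above:
  assumes P: "finite P" "PL (exp a) (exp b) \<subseteq> P" and ab: "0 \<le> a" "520 \<le> b - a" "j \<le> a"
  shows "Esub P (tilted (exp j)) (\<lambda>T. of_bool (b - a \<le> real (card (T \<inter> PL (exp a) (exp b))) * ln 2)) \<le> 14 / (b - a)"
proof -
  define d where "d = b - a"
  let ?A = "PL (exp a) (exp b)"
  let ?m = "\<Sum>p\<in>?A. tilted (exp j) p"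
  have "\<bar>?m - ln (exp b / exp a)\<bar> \<le> 24 / exp a"
    using ab by (intro sum_tilted_above) auto
  also have "24 / exp a \<le> 24" using ab by (simp add: field_simps)
  finally have m: "\<bar>?m - d\<bar> \<le> 24" by (simp add: d_def ln_div)
  have d: "520 \<le> d" using ab by (simp add: d_def)
  have "Esub P (tilted (exp j)) (\<lambda>T. of_bool (b - a \<le> real (card (T \<inter> ?A)) * ln 2))
      \<le> Esub P (tilted (exp j)) (\<lambda>T. of_bool (39 / 100 * d \<le> \<bar>real (card (T \<inter> ?A)) - ?m\<bar>))"
  proof (rule Esub_mono)
    fix T
    have "39 / 100 * d \<le> \<bar>real (card (T \<inter> ?A)) - ?m\<bar>" if *: "d \<le> real (card (T \<inter> ?A)) * ln 2"
    proof -
      have "real (card (T \<inter> ?A)) * ln 2 \<le> real (card (T \<inter> ?A)) * (25 / 36)"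
        by (intro mult_left_mono ln2_le_25_over_36) auto
      then have "36 / 25 * d \<le> real (card (T \<inter> ?A))" using * by linarith
      then show ?thesis using m d by linarith
    qed
    then show "of_bool (b - a \<le> real (card (T \<inter> ?A)) * ln 2) \<le> (of_bool (39 / 100 * d \<le> \<bar>real (card (T \<inter> ?A)) - ?m\<bar>) :: real)"
      by (auto simp: d_def)
  qed (rule tilted_bounds)
  also have "\<dots> \<le> ?m / (39 / 100 * d)\<^sup>2"
    using d by (intro Esub_chebyshev[OF P(1) _ P(2)] tilted_bounds) auto
  also have "\<dots> \<le> (11 / 10 * d) / (39 / 100 * d)\<^sup>2" using m d by (intro divide_right_mono) auto
  also have "\<dots> \<le> 14 / d" using d by (simp add: field_simps power2_eq_square)
  finally show ?thesis by (simp add: d_def)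
qed

text \<open>\<open>n\<close> is the maximum over \<open>{1..N}\<close> of \<open>ln 2 * (number of elements of T below) - n * h\<close>.\<close>

definition peak :: "real \<Rightarrow> real \<Rightarrow> nat \<Rightarrow> nat \<Rightarrow> nat set \<Rightarrow> bool" where
  "peak l h N n T \<longleftrightarrow>
     (\<forall>m\<in>{1..<n}. (real n - real m) * h < real (card (T \<inter> PL (exp (l + m * h)) (exp (l + n * h)))) * ln 2) \<and>
     (\<forall>m\<in>{n<..N}. real (card (T \<inter> PL (exp (l + n * h)) (exp (l + m * h)))) * ln 2 < (real m - real n) * h)"

text \<open>Two peaks \<open>n < m\<close> impose opposite strict inequalities on the same
  count.\<close>

lemma peak_unique:
  assumes "peak l h N n T" "peak l h N m T" "n \<in> {1..N}" "m \<in> {1..N}"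
  shows "n = m"
proof -
  have "False" if "peak l h N n T" "peak l h N m T" "n \<in> {1..N}" "m \<in> {1..N}" "n < m" for n m
  proof -
    let ?c = "real (card (T \<inter> PL (exp (l + n * h)) (exp (l + m * h)))) * ln 2"
    have "?c < (real m - real n) * h" "(real m - real n) * h < ?c"
      using that unfolding peak_def by auto
    then show False by simp
  qed
  then show ?thesis using assms by (metis linorder_neqE_nat)
qed

lemma of_bool_Ex_le_sum:
  assumes "finite A"
  shows "(of_bool (\<exists>m\<in>A. Q m) :: real) \<le> (\<Sum>m\<in>A. of_bool (Q m))"
proof (cases "\<exists>m\<in>A. Q m")
  case True
  then obtain m where "m \<in> A" "Q m" by blast
  then have "(1 :: real) = of_bool (Q m)" by simp
  also have "\<dots> \<le> (\<Sum>m\<in>A. of_bool (Q m))" using assms \<open>m \<in> A\<close> by (intro member_le_sum) auto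
  finally show ?thesis using True by simp
qed (auto intro: sum_nonneg)

text \<open>A competitor \<open>i\<close> grid steps away wins with probability at most
  \<open>14 / (i * h)\<close>, so the union bound is a harmonic sum. Its logarithm is what the mesh
  \<open>h\<close> has to outgrow.\<close>

lemma peak_failure_le:
  assumes P: "finite P" "PL (exp l) (exp (l + N * h)) \<subseteq> P" and l: "0 \<le> l" and h: "520 \<le> h"
    and n: "n \<in> {1..N}"
  shows "Esub P (tilted (exp (l + n * h))) (\<lambda>T. of_bool (\<not> peak l h N n T)) \<le> 28 * (1 + ln N) / h"
proof -
  let ?q = "tilted (exp (l + n * h))"
  let ?lo = "\<lambda>m T. real (card (T \<inter> PL (exp (l + m * h)) (exp (l + n * h)))) * ln 2 \<le> (l + n * h) - (l + m * h)"
  let ?hi = "\<lambda>m T. (l + m * h) - (l + n * h) \<le> real (card (T \<inter> PL (exp (l + n * h)) (exp (l + m * h)))) * ln 2"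
  have N: "1 \<le> N" using n by auto
  have in_P: "PL (exp (l + a * h)) (exp (l + b * h)) \<subseteq> P" if "b \<le> N" for a b :: nat
  proof -
    have "real b * h \<le> real N * h" using that h by (intro mult_right_mono) auto
    then have "PL (exp (l + a * h)) (exp (l + b * h)) \<subseteq> PL (exp l) (exp (l + N * h))"
      using h by (intro PL_mono) auto
    then show ?thesis using P by blast
  qed
  have gap: "520 \<le> (real b - real a) * h" if "a < b" for a b :: nat
  proof -
    have "1 * 520 \<le> (real b - real a) * h" using that h by (intro mult_mono) auto
    then show ?thesis by simp
  qed
  have "Esub P ?q (\<lambda>T. of_bool (\<not> peak l h N n T))
     \<le> Esub P ?q (\<lambda>T. (\<Sum>m\<in>{1..<n}. of_bool (?lo m T)) + (\<Sum>m\<in>{n<..N}. of_bool (?hi m T)))"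
  proof (rule Esub_mono)
    fix T
    have "of_bool (\<not> peak l h N n T) \<le> (of_bool (\<exists>m\<in>{1..<n}. ?lo m T) + of_bool (\<exists>m\<in>{n<..N}. ?hi m T) :: real)"
      by (auto simp: peak_def not_less algebra_simps)
    also have "\<dots> \<le> (\<Sum>m\<in>{1..<n}. of_bool (?lo m T)) + (\<Sum>m\<in>{n<..N}. of_bool (?hi m T))"
      by (intro add_mono of_bool_Ex_le_sum) auto
    finally show "of_bool (\<not> peak l h N n T) \<le> \<dots>" .
  qed (rule tilted_bounds)
  also have "\<dots> = (\<Sum>m\<in>{1..<n}. Esub P ?q (\<lambda>T. of_bool (?lo m T))) + (\<Sum>m\<in>{n<..N}. Esub P ?q (\<lambda>T. of_bool (?hi m T)))"
    by (simp only: Esub_add Esub_sum)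
  also have "\<dots> \<le> (\<Sum>m\<in>{1..<n}. 14 / h * (1 / real (n - m))) + (\<Sum>m\<in>{n<..N}. 14 / h * (1 / real (m - n)))"
  proof (intro add_mono sum_mono)
    fix m assume m: "m \<in> {1..<n}"
    have "Esub P ?q (\<lambda>T. of_bool (?lo m T)) \<le> 14 / ((l + n * h) - (l + m * h))"
      using m n l h gap[of m n] in_P[of n m] by (intro low_count_below P(1)) (auto simp: algebra_simps)
    also have "14 / ((l + n * h) - (l + m * h)) = 14 / (h * real (n - m))"
      using m by (simp add: of_nat_diff algebra_simps)
    also have "14 / (h * real (n - m)) = 14 / h * (1 / real (n - m))" by simp
    finally show "Esub P ?q (\<lambda>T. of_bool (?lo m T)) \<le> 14 / h * (1 / real (n - m))" .
  next
    fix m assume m: "m \<in> {n<..N}"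
    have "Esub P ?q (\<lambda>T. of_bool (?hi m T)) \<le> 14 / ((l + m * h) - (l + n * h))"
      using m n l h gap[of n m] in_P[of m n] by (intro high_count_above P(1)) (auto simp: algebra_simps)
    also have "14 / ((l + m * h) - (l + n * h)) = 14 / (h * real (m - n))"
      using m by (simp add: of_nat_diff algebra_simps)
    also have "14 / (h * real (m - n)) = 14 / h * (1 / real (m - n))" by simp
    finally show "Esub P ?q (\<lambda>T. of_bool (?hi m T)) \<le> 14 / h * (1 / real (m - n))" .
  qed
  also have "\<dots> = 14 / h * ((\<Sum>m\<in>{1..<n}. 1 / real (n - m)) + (\<Sum>m\<in>{n<..N}. 1 / real (m - n)))"
    by (simp only: sum_distrib_left distrib_left)
  also have "(\<Sum>m\<in>{1..<n}. 1 / real (n - m)) = (\<Sum>m\<in>{1..n - 1}. 1 / real m)"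
    by (rule sum.reindex_bij_witness[of _ "\<lambda>m. n - m" "\<lambda>m. n - m"]) auto
  also have "(\<Sum>m\<in>{n<..N}. 1 / real (m - n)) = (\<Sum>m\<in>{1..N - n}. 1 / real m)"
    by (rule sum.reindex_bij_witness[of _ "\<lambda>m. m + n" "\<lambda>m. m - n"]) auto
  also have "14 / h * ((\<Sum>m\<in>{1..n - 1}. 1 / real m) + (\<Sum>m\<in>{1..N - n}. 1 / real m))
      \<le> 14 / h * ((1 + ln N) + (1 + ln N))"
  proof (intro mult_left_mono add_mono)
    have "(\<Sum>m\<in>{1..k}. 1 / real m) \<le> 1 + ln N" if "k \<le> N" for k
      using sum_mono2[of "{1..N}" "{1..k}" "\<lambda>m. 1 / real m"] sum_inverse_le_ln[OF N] that by auto
    then show "(\<Sum>m\<in>{1..n - 1}. 1 / real m) \<le> 1 + ln N" "(\<Sum>m\<in>{1..N - n}. 1 / real m) \<le> 1 + ln N"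
      using n by auto
  qed (use h in simp)
  also have "14 / h * ((1 + ln N) + (1 + ln N)) = 28 * (1 + ln N) / h" by (simp add: field_simps)
  finally show ?thesis .
qed

text \<open>Markov's inequality: the mean is at most twice the sum of \<open>ln p / p\<close> over
  \<open>ln p < y\<close>, hence at most \<open>2 * (y + 3) \<le> 4 * y\<close>. It confines the
  divisors built from these primes to a range of logarithmic length of order
  \<open>y\<close>.\<close>

lemma log_sum_failure_le:
  assumes y: "3 \<le> y"
  shows "Esub (PL s t) (tilted y) (\<lambda>T. of_bool (\<not> (\<Sum>p\<in>T. of_bool (ln (real p) < y) * ln (real p)) < 100 * y)) \<le> 1 / 25"
proof -
  let ?w = "\<lambda>p. of_bool (ln (real p) < y) * ln (real p) :: real"
  have ln0: "0 \<le> ln (real p)" if "p \<in> PL s t" for p using PL_gt_1[OF that] by simp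
  have "Esub (PL s t) (tilted y) (\<lambda>T. of_bool (\<not> (\<Sum>p\<in>T. ?w p) < 100 * y))
      = Esub (PL s t) (tilted y) (\<lambda>T. of_bool (100 * y \<le> (\<Sum>p\<in>T. ?w p)))" by (simp only: not_less)
  also have "\<dots> \<le> Esub (PL s t) (tilted y) (\<lambda>T. \<Sum>p\<in>T. ?w p) / (100 * y)"
    using y ln0 by (intro Esub_markov tilted_bounds sum_nonneg) auto
  also have "Esub (PL s t) (tilted y) (\<lambda>T. \<Sum>p\<in>T. ?w p) = (\<Sum>p\<in>PL s t. tilted y p * ?w p)"
    by (intro Esub_mean) simp
  also have "\<dots> = (\<Sum>p\<in>PL s t \<inter> PL s y. tilted y p * ln (real p))"
    by (intro sum.mono_neutral_cong_right finite_PL) (auto simp: PL_def)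
  also have "\<dots> \<le> (\<Sum>p\<in>PL s t \<inter> PL s y. 2 * (ln (real p) / real p))"
  proof (intro sum_mono)
    fix p assume p: "p \<in> PL s t \<inter> PL s y"
    then have "real p > 1" using PL_gt_1[of p s t] by simp
    moreover have "ln (real p) < y" using p by (simp add: PL_def)
    ultimately have "tilted y p \<le> 2 / p" "0 \<le> ln (real p)" by (auto simp: tilted_def field_simps)
    then have "tilted y p * ln (real p) \<le> 2 / p * ln (real p)" by (rule mult_right_mono)
    then show "tilted y p * ln (real p) \<le> 2 * (ln (real p) / real p)" by simp
  qed
  also have "\<dots> \<le> (\<Sum>p\<in>PL s y. 2 * (ln (real p) / real p))"
  proof (intro sum_mono2)
    show "0 \<le> 2 * (ln (real p) / real p)" if "p \<in> PL s y - PL s t \<inter> PL s y" for p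
      using that PL_gt_1[of p s y] by simp
  qed auto
  also have "\<dots> \<le> 2 * (y + 3)" unfolding sum_distrib_left[symmetric] using mertens_first_PL[of y s] y by simp
  finally have "Esub (PL s t) (tilted y) (\<lambda>T. of_bool (\<not> (\<Sum>p\<in>T. ?w p) < 100 * y)) \<le> 2 * (y + 3) / (100 * y)"
    using y by (simp add: divide_right_mono)
  also have "\<dots> \<le> 1 / 25" using y by (simp add: field_simps)
  finally show ?thesis .
qed

lemma total_count_mean:
  assumes "0 \<le> l" "l \<le> j" "j \<le> L"
  shows "\<bar>(\<Sum>p\<in>PL (exp l) (exp L). tilted (exp j) p) - (2 * (j - l) + (L - j))\<bar> \<le> 76"
proof -
  have dis: "PL (exp l) (exp j) \<inter> PL (exp j) (exp L) = {}" by (auto simp: PL_def)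
  have "(\<Sum>p\<in>PL (exp l) (exp L). tilted (exp j) p)
      = (\<Sum>p\<in>PL (exp l) (exp j). tilted (exp j) p) + (\<Sum>p\<in>PL (exp j) (exp L). tilted (exp j) p)"
    using assms PL_Un[of "exp l" "exp j" "exp L"] by (simp add: sum.union_disjoint[OF finite_PL finite_PL dis])
  moreover have "\<bar>(\<Sum>p\<in>PL (exp l) (exp j). tilted (exp j) p) - 2 * ln (exp j / exp l)\<bar> \<le> 52 / exp l"
    using assms by (intro sum_tilted_below) auto
  moreover have "52 / exp l \<le> 52" using assms by (simp add: field_simps)
  moreover have "\<bar>(\<Sum>p\<in>PL (exp j) (exp L). tilted (exp j) p) - ln (exp L / exp j)\<bar> \<le> 24 / exp j"
    using assms by (intro sum_tilted_above) auto
  moreover have "24 / exp j \<le> 24" using assms by (simp add: field_simps)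
  ultimately show ?thesis by (simp add: ln_div)
qed

text \<open>The odds of \<open>2 / (p + 2)\<close> are \<open>2 / p\<close>, with sum
  \<open>s\<close> close to \<open>2 * l\<close>. As \<open>t\<close> is within
  \<open>12 * sqrt L\<close> of \<open>s\<close> and \<open>s \<ge> e * L\<close>, the Gaussian
  exponent is at most the constant \<open>144 / e\<close>; this is where \<open>l\<close> of order
  \<open>L\<close> enters.\<close>

lemma low_block_local:
  assumes l: "0 < e" "e \<le> 1" "e * L \<le> l" "l \<le> L" "exp l \<ge> 16" "100 / e \<le> sqrt L" "l \<le> j"
    and t: "\<bar>real t - 2 * l\<bar> \<le> 11 * sqrt L + 76"
  shows "exp (- (144 / e) - 1) / (4 * sqrt L) \<le> Esub (PL 16 (exp l)) (tilted (exp j)) (\<lambda>T. of_bool (card T = t))"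
proof -
  let ?P = "PL 16 (exp l)"
  let ?w = "\<lambda>p::nat. 2 / real p"
  define R where "R = sqrt L"
  define s where "s = (\<Sum>p\<in>?P. ?w p)"
  have "0 < R" using l(1,6) unfolding R_def by (smt (verit) divide_pos_pos)
  then have L0: "0 < L" by (simp add: R_def)
  have R100: "100 \<le> R * e" using l by (simp add: R_def field_simps)
  have "R * e \<le> R * 1" using l R100 by (intro mult_left_mono) (use \<open>0 < R\<close> in auto)
  then have R: "100 \<le> R" using R100 by simp
  have L: "L = R * R" using L0 by (simp add: R_def)
  have "100 * R \<le> R * e * R" using R100 R by (intro mult_right_mono) auto
  then have eL: "100 * R \<le> e * L" by (simp add: L mult_ac)
  have s: "\<bar>s - 2 * l\<bar> \<le> 9"
  proof -
    have "s = 2 * (\<Sum>p\<in>?P. 1 / real p)" unfolding s_def sum_distrib_left by simp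
    moreover have "\<bar>(\<Sum>p\<in>?P. 1 / real p) - ln (exp l / 16)\<bar> \<le> 22 / 16"
      using l by (intro mertens_second) auto
    moreover have "ln (exp l / 16) = l - ln 16" by (simp add: ln_div)
    moreover have "ln (16 :: real) = 4 * ln 2" using ln_realpow[of "2::real" 4] by simp
    ultimately show ?thesis using ln2_le_25_over_36 ln2_ge_two_thirds by linarith
  qed
  have s_eL: "e * L \<le> s" using s l(3) eL R by linarith
  have tK: "\<bar>real t - s\<bar> \<le> 12 * R" using t s R unfolding R_def[symmetric] by linarith
  have t1: "1 \<le> real t" using tK s_eL eL R by linarith
  have ts: "real t \<le> 112 / 100 * s" using tK s_eL eL by linarith
  \<comment> \<open>Starting at \<open>ln p = 16\<close> makes the squared odds sum to at most 1/2,
    so \<open>ts\<close> suffices for the smallness condition on repeated entries.\<close>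
  have s2: "(\<Sum>p\<in>?P. (?w p)\<^sup>2) \<le> 1 / 2"
  proof -
    have "(\<Sum>p\<in>?P. (?w p)\<^sup>2) = 4 * (\<Sum>p\<in>?P. 1 / (real p)\<^sup>2)"
      unfolding sum_distrib_left by (simp add: power_divide)
    then show ?thesis using sum_inverse_squares_PL_le[of 16 "exp l"] by simp
  qed
  have "(real t)\<^sup>2 * (\<Sum>p\<in>?P. (?w p)\<^sup>2) \<le> (112 / 100 * s)\<^sup>2 * (1 / 2)"
    using ts s2 by (intro mult_mono power_mono) (auto intro: sum_nonneg)
  also have "\<dots> = (112 / 100)\<^sup>2 / 2 * s\<^sup>2" by (simp only: power_mult_distrib)
  also have "\<dots> \<le> 1 * s\<^sup>2" by (intro mult_right_mono) (auto simp: power2_eq_square)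
  finally have t2: "(real t)\<^sup>2 * (\<Sum>p\<in>?P. (?w p)\<^sup>2) \<le> s\<^sup>2" by simp
  have s0: "0 < s" using s_eL eL R by linarith
  have "exp (- ((12 * R)\<^sup>2 / s) - 1) / (2 * sqrt t) \<le> Esub ?P (\<lambda>p. ?w p / (1 + ?w p)) (\<lambda>T. of_bool (card T = t))"
    using s0 t1 tK t2 by (intro Esub_card_eq_lower_bound) (auto simp: s_def)
  also have "\<dots> = Esub ?P (tilted (exp j)) (\<lambda>T. of_bool (card T = t))"
  proof (intro Esub_cong refl)
    fix p assume p: "p \<in> ?P"
    then have p1: "real p > 1" by (auto dest: PL_gt_1)
    have "ln (real p) < exp l" "exp l \<le> exp j" using p l by (auto simp: PL_def)
    then have "ln (real p) < exp j" by linarith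
    then have "tilted (exp j) p = 2 / (real p + 2)" by (simp add: tilted_def)
    moreover have "1 + ?w p = (real p + 2) / p" using p1 by (simp add: field_simps)
    ultimately show "?w p / (1 + ?w p) = tilted (exp j) p" using p1 by simp
  qed
  finally have main: "exp (- ((12 * R)\<^sup>2 / s) - 1) / (2 * sqrt t) \<le> Esub ?P (tilted (exp j)) (\<lambda>T. of_bool (card T = t))" .
  have "(12 * R)\<^sup>2 / s \<le> (12 * R)\<^sup>2 / (e * L)" using s_eL eL R by (intro divide_left_mono) auto
  also have "\<dots> = 144 / e" using R l by (simp add: L power2_eq_square)
  finally have 1: "exp (- (144 / e) - 1) \<le> exp (- ((12 * R)\<^sup>2 / s) - 1)" by simp
  have "100 * R \<le> R * R" using R by (intro mult_right_mono) auto
  then have "t \<le> 4 * (R * R)" using ts s l(4) R unfolding L by linarith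
  then have "sqrt t \<le> sqrt (4 * (R * R))" by (rule real_sqrt_le_mono)
  also have "\<dots> = 2 * R" using R by (simp add: real_sqrt_mult)
  finally have 2: "2 * sqrt t \<le> 4 * R" by simp
  have "exp (- (144 / e) - 1) / (4 * R) \<le> exp (- ((12 * R)\<^sup>2 / s) - 1) / (2 * sqrt t)"
    using 1 2 t1 R by (intro frac_le) auto
  then show ?thesis using main unfolding R_def by linarith
qed

section \<open>Summation over the grid\<close>

text \<open>Evaluated on the part of the prime set with \<open>ln p \<ge> exp l\<close>, which is
  independent of the small primes that bring the count to \<open>r\<close>; hence there is no
  condition on the cardinality.\<close>

definition good :: "real \<Rightarrow> real \<Rightarrow> real \<Rightarrow> nat \<Rightarrow> nat \<Rightarrow> nat \<Rightarrow> real \<Rightarrow> (nat \<Rightarrow> nat set) \<Rightarrow> nat set \<Rightarrow> nat set \<Rightarrow> bool" where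
  "good l h v N n k d W I T \<longleftrightarrow> peak l h N n T \<and>
     (\<Sum>p\<in>T. of_bool (ln (real p) < exp (l + n * h)) * ln (real p)) < 100 * exp (l + n * h) \<and>
     (1 - d) * real (card I) \<le> real (card {i\<in>I. k \<le> mEq (hits v (W i) T)})"

text \<open>The part \<open>T\<close> beyond \<open>exp l\<close> is good and of typical size with
  probability at least 1/2, since the four failures add up to at most 17/100. Given
  \<open>T\<close>, the independent small primes must supply exactly \<open>r - card T\<close>
  elements, which costs the factor \<open>1 / sqrt L\<close> of the local estimate.\<close>

lemma good_prob:
  fixes d h l L v e :: real and r n N k :: nat
  assumes L: "0 \<le> l" "100 \<le> sqrt L" "0 < e" "e \<le> 1" "100 / e \<le> sqrt L" "e * L \<le> l" "l = real r - L" "real r \<le> 2 * L" "exp l \<ge> 16"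
    and N: "n \<in> {1..N}" "N * h \<le> sqrt L" "520 \<le> h" "l + N * h \<le> L" "28 * (1 + ln N) / h \<le> 1 / 20"
    and I: "finite I" "I \<noteq> {}" and d: "0 < d"
    and fl: "\<And>i. i \<in> I \<Longrightarrow> Esub (PL (exp l) (exp L)) (tilted (exp (l + n * h))) (\<lambda>T. of_bool (\<not> k \<le> mEq (hits v (W i) T))) \<le> d / 20"
  shows "exp (- (144 / e) - 1) / (8 * sqrt L) \<le>
    Esub (PL 16 (exp L)) (tilted (exp (l + n * h))) (\<lambda>T. of_bool (card T = r \<and> good l h v N n k d W I (T \<inter> PL (exp l) (exp L))))"
proof -
  let ?R = "PL (exp l) (exp L)" and ?B = "PL 16 (exp l)"
  define j where "j = l + n * h"
  let ?q = "tilted (exp j)"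
  define m where "m = (\<Sum>p\<in>?R. ?q p)"
  define s where "s = sqrt L"
  have s100: "100 \<le> s" using L by (simp add: s_def)
  have L0: "0 < L" using s100 by (simp add: s_def not_le[symmetric]) (metis L(2) linorder_not_less not_numeral_le_zero order_trans real_sqrt_le_0_iff)
  have Ls: "L = s * s" using L0 by (simp add: s_def)
  have ss: "100 * s \<le> L" using s100 unfolding Ls by (intro mult_right_mono) auto
  have eL: "100 * s \<le> e * L"
  proof -
    have "100 \<le> e * s" using L by (simp add: s_def field_simps)
    then have "100 * s \<le> e * s * s" using s100 by (intro mult_right_mono) auto
    then show ?thesis by (simp add: Ls mult_ac)
  qed
  have nh: "n * h \<le> N * h" "0 \<le> n * h" using N by (auto intro: mult_right_mono)
  have j: "l \<le> j" "j \<le> l + s" "j \<le> L" unfolding j_def s_def using nh N(2,4) by linarith+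
  have lL: "l \<le> L" using j by linarith
  define g where "g = good l h v N n k d W I"
  define cnt where "cnt T \<longleftrightarrow> \<bar>real (card T) - m\<bar> < 10 * s" for T :: "nat set"
  have m: "\<bar>m - (2 * (j - l) + (L - j))\<bar> \<le> 76"
    unfolding m_def using L j by (intro total_count_mean) auto
  have m_up: "m \<le> j - 2 * l + L + 76" and m_lo: "j - 2 * l + L - 76 \<le> m"
    using m by (simp_all add: abs_le_iff)
  have mL: "m \<le> 3 * L" using m_up j(3) ss s100 L(1) by linarith
  have R0: "\<And>p. p \<in> ?R \<Longrightarrow> 0 \<le> ?q p \<and> ?q p \<le> 1" by (rule tilted_bounds)
  have f1: "Esub ?R ?q (\<lambda>T. of_bool (\<not> cnt T)) \<le> 3 / 100"
  proof -
    have "Esub ?R ?q (\<lambda>T. of_bool (\<not> cnt T)) = Esub ?R ?q (\<lambda>T. of_bool (10 * s \<le> \<bar>real (card (T \<inter> ?R)) - (\<Sum>p\<in>?R. ?q p)\<bar>))"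
      by (intro Esub_cong) (auto simp: cnt_def m_def not_less Int_absorb2)
    also have "\<dots> \<le> m / (10 * s)\<^sup>2" unfolding m_def using s100 by (intro Esub_chebyshev R0) auto
    also have "\<dots> \<le> 3 * L / (10 * s)\<^sup>2" using mL by (intro divide_right_mono) auto
    also have "\<dots> = 3 / 100" using s100 by (simp add: Ls power2_eq_square)
    finally show ?thesis .
  qed
  have f2: "Esub ?R ?q (\<lambda>T. of_bool (\<not> peak l h N n T)) \<le> 1 / 20"
  proof -
    have "Esub ?R ?q (\<lambda>T. of_bool (\<not> peak l h N n T)) \<le> 28 * (1 + ln N) / h"
      unfolding j_def using L N by (intro peak_failure_le PL_mono) auto
    then show ?thesis using N by linarith
  qed
  have f3: "Esub ?R ?q (\<lambda>T. of_bool (\<not> (\<Sum>p\<in>T. of_bool (ln (real p) < exp j) * ln (real p)) < 100 * exp j)) \<le> 1 / 25"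
  proof (rule log_sum_failure_le)
    have "exp l \<le> exp j" using j by simp
    then show "3 \<le> exp j" using L by linarith
  qed
  have f4: "Esub ?R ?q (\<lambda>T. of_bool (\<not> (1 - d) * real (card I) \<le> real (card {i\<in>I. k \<le> mEq (hits v (W i) T)}))) \<le> d / 20 / d"
    by (rule many_failures_le) (use R0 I d fl in \<open>auto simp: j_def\<close>)
  have d20: "d / 20 / d = 1 / 20" using d by simp
  have "Esub ?R ?q (\<lambda>T. 1 + (- 1) * (of_bool (\<not> cnt T) + (of_bool (\<not> peak l h N n T) +
        (of_bool (\<not> (\<Sum>p\<in>T. of_bool (ln (real p) < exp j) * ln (real p)) < 100 * exp j)
        + of_bool (\<not> (1 - d) * real (card I) \<le> real (card {i\<in>I. k \<le> mEq (hits v (W i) T)}))))))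
     \<le> Esub ?R ?q (\<lambda>T. of_bool (g T \<and> cnt T))"
    by (intro Esub_mono R0) (auto simp: g_def good_def j_def)
  then have half: "1 / 2 \<le> Esub ?R ?q (\<lambda>T. of_bool (g T \<and> cnt T))"
    unfolding Esub_add Esub_cmult using f1 f2 f3 f4 unfolding d20 by (simp add: Esub_const)
  define b where "b = exp (- (144 / e) - 1) / (4 * sqrt L)"
  have b0: "0 \<le> b" using L0 by (simp add: b_def)
  have inner: "b * of_bool (g T \<and> cnt T) \<le> Esub ?B ?q (\<lambda>S. of_bool (card (T \<union> S) = r \<and> g ((T \<union> S) \<inter> ?R)))"
    if T: "T \<subseteq> ?R" for T
  proof (cases "g T \<and> cnt T")
    case True
    have fT: "finite T" using T finite_PL finite_subset by blast
    \<comment> \<open>The mean of \<open>card T\<close> is about \<open>L + j - 2 * l\<close> and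
      \<open>r = L + l\<close>, so \<open>r - card T - 2 * l\<close> is \<open>l - j\<close> up to
      the fluctuation \<open>10 * s\<close> and the error 76; \<open>j - l \<le> s\<close> gives the
      11.\<close>
    have dev: "\<bar>real r - real (card T) - 2 * l\<bar> \<le> 11 * s + 76"
    proof (rule abs_leI)
      have c: "real (card T) < m + 10 * s" "m - 10 * s < real (card T)"
        using True unfolding cnt_def by (simp_all add: abs_less_iff)
      show "real r - real (card T) - 2 * l \<le> 11 * s + 76" using c m_lo j L(7) s100 by linarith
      show "- (real r - real (card T) - 2 * l) \<le> 11 * s + 76" using c m_up j L(7) by linarith
    qed
    then have "card T \<le> r" using L(6) eL s100 by linarith
    then have t: "real (r - card T) = real r - real (card T)" by simp
    have "b \<le> Esub ?B ?q (\<lambda>S. of_bool (card S = r - card T))"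
      unfolding b_def using L lL j dev unfolding s_def by (intro low_block_local) (auto simp: t)
    also have "\<dots> = Esub ?B ?q (\<lambda>S. of_bool (card (T \<union> S) = r \<and> g ((T \<union> S) \<inter> ?R)))"
    proof (intro Esub_cong refl)
      fix S assume S: "S \<subseteq> ?B"
      have fS: "finite S" using S finite_PL finite_subset by blast
      have dis: "?B \<inter> ?R = {}" by (auto simp: PL_def)
      have "(T \<union> S) \<inter> ?R = T" "T \<inter> S = {}" using S T dis by blast+
      then have "card (T \<union> S) = card T + card S" using fS fT by (simp add: card_Un_disjoint)
      then have "(card S = r - card T) \<longleftrightarrow> (card (T \<union> S) = r \<and> g ((T \<union> S) \<inter> ?R))"
        using \<open>card T \<le> r\<close> True \<open>(T \<union> S) \<inter> ?R = T\<close> by auto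
      then show "of_bool (card S = r - card T) = (of_bool (card (T \<union> S) = r \<and> g ((T \<union> S) \<inter> ?R)) :: real)" by simp
    qed
    finally show ?thesis using True by simp
  next
    case False
    have "0 \<le> Esub ?B ?q (\<lambda>S. of_bool (card (T \<union> S) = r \<and> g ((T \<union> S) \<inter> ?R)))"
      by (intro Esub_nonneg tilted_bounds) auto
    then show ?thesis using False by (simp only: of_bool_def if_False mult_zero_right)
  qed
  have P: "PL 16 (exp L) = ?R \<union> ?B" "?R \<inter> ?B = {}"
    using L lL PL_Un[of 16 "exp l" "exp L"] by (simp add: Un_commute, auto simp: PL_def)
  have "b * (1 / 2) \<le> b * Esub ?R ?q (\<lambda>T. of_bool (g T \<and> cnt T))" using half b0 by (rule mult_left_mono)
  also have "\<dots> = Esub ?R ?q (\<lambda>T. b * of_bool (g T \<and> cnt T))" by (simp only: Esub_cmult)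
  also have "\<dots> \<le> Esub ?R ?q (\<lambda>T. Esub ?B ?q (\<lambda>S. of_bool (card (T \<union> S) = r \<and> g ((T \<union> S) \<inter> ?R))))"
    by (intro Esub_mono R0 inner)
  also have "\<dots> = Esub (PL 16 (exp L)) ?q (\<lambda>T. of_bool (card T = r \<and> g (T \<inter> ?R)))"
    unfolding P(1) using P(2) by (subst Esub_Un) auto
  finally show ?thesis by (simp add: b_def g_def j_def)
qed

text \<open>Put \<open>j = l + n * h\<close>. With \<open>v = exp j / r\<close> the roundings of
  \<open>r\<close> primes add up to \<open>exp j\<close>, and \<open>a \<ge> r + 1\<close> puts
  every cell beyond \<open>exp j\<close>, away from the primes counted in the power of 2. The 104 is
  100 from the typical logarithm sum, 1 from at most \<open>r\<close> primes below
  \<open>exp l\<close>, 1 from the roundings and 2 from the pigeonhole.\<close>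

lemma Delta_good_ge:
  fixes d h l L v :: real and r n N k :: nat
  assumes T: "T \<subseteq> PL 16 (exp L)" "card T = r" "good l h v N n k d W I (T \<inter> PL (exp l) (exp L))"
    and h: "0 \<le> h" and lh: "real r * exp l \<le> exp (l + n * h)" "0 \<le> l" and r: "1 \<le> r" and k: "1 \<le> k"
    and v: "v = exp (l + n * h) / r" and I: "finite I"
    and W: "\<And>i. i \<in> I \<Longrightarrow> finite (W i)" "disjoint_family_on W I" "\<And>i a. i \<in> I \<Longrightarrow> a \<in> W i \<Longrightarrow> real r + 1 \<le> a"
  shows "k powr ((1 - d) * card I) / (104 * exp (l + n * h)) * 2 ^ card (T \<inter> {p. ln (real p) < exp (l + n * h)})
     \<le> real (Delta (\<Prod>T))"
proof -
  define j where "j = l + n * h"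
  let ?R = "PL (exp l) (exp L)"
  let ?T = "T \<inter> ?R"
  define U where "U = T \<inter> {p. ln (real p) < exp j}"
  let ?S = "{i\<in>I. k \<le> mEq (hits v (W i) ?T)}"
  have fT: "finite T" using T finite_PL finite_subset by blast
  have v0: "0 < v" using r by (simp add: v)
  have jl: "l \<le> j" using h by (simp add: j_def)
  have pT: "prime p" if "p \<in> T" for p using that T PL_prime by blast
  have g: "(\<Sum>p\<in>?T. of_bool (ln (real p) < exp j) * ln (real p)) < 100 * exp j"
      "(1 - d) * real (card I) \<le> real (card ?S)"
    using T(3) by (auto simp: good_def j_def)
  have "2 ^ card U * real k ^ card ?S \<le> ((\<Sum>p\<in>U. ln (real p)) + v * card T + 2) * real (Delta (\<Prod>T))"
  proof (rule Delta_ge_stages[OF fT pT])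
    show "U \<subseteq> T" by (auto simp: U_def)
    show "disjoint_family_on (\<lambda>i. hits v (W i) ?T) ?S"
      using W(2) unfolding disjoint_family_on_def by blast
    fix i a assume i: "i \<in> ?S" and a: "a \<in> hits v (W i) ?T"
    then obtain p where p: "p \<in> T" "p \<in> PL (v * (real a - 1)) (v * a)" by blast
    have "real r \<le> real a - 1" using W(3)[of i a] i a by auto
    then have "v * r \<le> v * (real a - 1)" using v0 by (intro mult_left_mono) auto
    moreover have "v * r = exp j" using r by (simp add: v j_def)
    ultimately have "p \<notin> U" using p(2) by (auto simp: U_def PL_def)
    then show "(T - U) \<inter> PL (v * (real a - 1)) (v * a) \<noteq> {}" using p by blast
  qed (use v0 I W(1) in auto)
  also have "(\<Sum>p\<in>U. ln (real p)) + v * card T + 2 \<le> 104 * exp j"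
  proof -
    have "v * card T = exp j" using r T(2) by (simp add: v j_def)
    moreover have "1 \<le> exp j" using jl lh by simp
    moreover have "(\<Sum>p\<in>U. ln (real p)) \<le> 101 * exp j"
    proof -
      have U: "U = (U \<inter> ?R) \<union> (U - ?R)" by blast
      have "(\<Sum>p\<in>U. ln (real p)) = (\<Sum>p\<in>U \<inter> ?R. ln (real p)) + (\<Sum>p\<in>U - ?R. ln (real p))"
        using fT by (subst U, intro sum.union_disjoint) (auto simp: U_def)
      moreover have "(\<Sum>p\<in>U \<inter> ?R. ln (real p)) = (\<Sum>p\<in>?T. of_bool (ln (real p) < exp j) * ln (real p))"
        using fT by (intro sum.mono_neutral_cong_left) (auto simp: U_def)
      moreover have "(\<Sum>p\<in>U - ?R. ln (real p)) \<le> real (card (U - ?R)) * exp l"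
      proof (rule sum_bounded_above)
        fix p assume "p \<in> U - ?R"
        then have "p \<in> PL 16 (exp L)" "p \<notin> ?R" using T by (auto simp: U_def)
        then show "ln (real p) \<le> exp l" by (auto simp: PL_def)
      qed
      moreover have "real (card (U - ?R)) * exp l \<le> real r * exp l"
        using card_mono[of T "U - ?R"] fT T(2) by (intro mult_right_mono) (auto simp: U_def)
      ultimately show ?thesis using g(1) lh(1) unfolding j_def[symmetric] by linarith
    qed
    ultimately show ?thesis by linarith
  qed
  finally have 1: "2 ^ card U * real k ^ card ?S \<le> 104 * exp j * real (Delta (\<Prod>T))"
    by (simp add: mult_right_mono)
  have "k powr ((1 - d) * card I) \<le> k powr real (card ?S)" using g(2) k by (intro powr_mono) auto
  also have "\<dots> = real k ^ card ?S" using k by (simp add: powr_realpow)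
  finally have "2 ^ card U * k powr ((1 - d) * card I) \<le> 2 ^ card U * real k ^ card ?S" by (intro mult_left_mono) auto
  then have "2 ^ card U * k powr ((1 - d) * card I) \<le> 104 * exp j * real (Delta (\<Prod>T))" using 1 by linarith
  then show ?thesis unfolding U_def j_def[symmetric] by (simp add: field_simps)
qed

lemma sum_of_bool_unique_le:
  assumes "finite A" "\<And>n m. n \<in> A \<Longrightarrow> m \<in> A \<Longrightarrow> Q n \<Longrightarrow> Q m \<Longrightarrow> n = m"
    and "\<And>n. n \<in> A \<Longrightarrow> Q n \<Longrightarrow> f n \<le> D" "0 \<le> D"
  shows "(\<Sum>n\<in>A. f n * of_bool (Q n)) \<le> (D :: real)"
proof (cases "\<exists>n\<in>A. Q n")
  case True
  then obtain n where n: "n \<in> A" "Q n" by blast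
  have "(\<Sum>m\<in>A. f m * of_bool (Q m)) = (\<Sum>m\<in>{n}. f m * of_bool (Q m))"
    using assms(1,2) n by (intro sum.mono_neutral_right) auto
  then show ?thesis using n assms(3) by simp
qed (use assms(4) in auto)

text \<open>At most one grid point is a peak of a given \<open>T\<close>, so the pointwise lower
  bounds for \<open>Delta\<close> may be summed over \<open>n\<close>. In each summand the factor
  \<open>1 / exp (l + n * h)\<close> from the pigeonhole cancels against the mass of the tilt, which
  gives all \<open>N\<close> summands the same lower bound.\<close>

lemma expectation_ge_peaks:
  fixes d h l L e :: real and r N k :: nat and W :: "nat \<Rightarrow> nat set"
  assumes L: "0 \<le> l" "100 \<le> sqrt L" "0 < e" "e \<le> 1" "100 / e \<le> sqrt L" "e * L \<le> l" "l = real r - L" "real r \<le> 2 * L" "exp l \<ge> 16"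
    and N: "N * h \<le> sqrt L" "520 \<le> h" "l + N * h \<le> L" "28 * (1 + ln N) / h \<le> 1 / 20"
    and lh: "real r \<le> exp h" and k: "1 \<le> k"
    and I: "finite I" "I \<noteq> {}" and d: "0 < d"
    and W: "\<And>i. i \<in> I \<Longrightarrow> finite (W i)" "disjoint_family_on W I" "\<And>i a. i \<in> I \<Longrightarrow> a \<in> W i \<Longrightarrow> real r + 1 \<le> a"
    and fl: "\<And>i n. i \<in> I \<Longrightarrow> n \<in> {1..N} \<Longrightarrow>
      Esub (PL (exp l) (exp L)) (tilted (exp (l + n * h))) (\<lambda>T. of_bool (\<not> k \<le> mEq (hits (exp (l + n * h) / r) (W i) T))) \<le> d / 20"
  shows "real N * (k powr ((1 - d) * card I) / 104 * (exp (- 2) / 16) * (exp (- (144 / e) - 1) / (8 * sqrt L))) \<le>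
    Esub (PL 16 (exp L)) (\<lambda>p. 1 / (real p + 1)) (\<lambda>T. real (Delta (\<Prod>T)) * of_bool (card T = r))"
proof -
  let ?P = "PL 16 (exp L)" and ?R = "PL (exp l) (exp L)" and ?q = "\<lambda>p::nat. 1 / (real p + 1)"
  let ?g = "\<lambda>n T. card T = r \<and> good l h (exp (l + real n * h) / r) N n k d W I (T \<inter> ?R)"
  let ?K = "k powr ((1 - d) * card I)"
  let ?c = "\<lambda>n. ?K / (104 * exp (l + real n * h))"
  have r: "1 \<le> r"
  proof -
    have "0 < L" using L(2) by (metis linorder_not_less not_numeral_le_zero order_trans real_sqrt_le_0_iff)
    then have "0 < real r" using L(1,7) by linarith
    then show ?thesis by simp
  qed
  have L0: "0 \<le> L" using L(2) by (metis linorder_not_less not_numeral_le_zero order_trans real_sqrt_le_0_iff less_imp_le)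
  have nh: "h \<le> n * h" "n * h \<le> N * h" if "n \<in> {1..N}" for n :: nat
  proof -
    have "1 * h \<le> real n * h" using that N(2) by (intro mult_right_mono) auto
    then show "h \<le> n * h" by simp
    show "n * h \<le> N * h" using that N(2) by (intro mult_right_mono) auto
  qed
  have "real N * (?K / 104 * (exp (- 2) / 16) * (exp (- (144 / e) - 1) / (8 * sqrt L)))
     = (\<Sum>n=1..N. ?K / 104 * (exp (- 2) / 16) * (exp (- (144 / e) - 1) / (8 * sqrt L)))" by simp
  also have "\<dots> \<le> (\<Sum>n=1..N. ?c n * Esub ?P ?q (\<lambda>T. 2 ^ card (T \<inter> {p. ln (real p) < exp (l + n * h)}) * of_bool (?g n T)))"
  proof (rule sum_mono)
    fix n assume n: "n \<in> {1..N}"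
    define y where "y = exp (l + n * h)"
    have ly: "exp l \<le> y" using nh[OF n] N(2) by (simp add: y_def)
    have yL: "y \<le> exp L"
    proof -
      have "l + real n * h \<le> L" using nh(2)[OF n] N(3) by linarith
      then show ?thesis by (simp add: y_def)
    qed
    have P: "?P \<inter> {p. ln (real p) < y} = PL 16 y" using yL by (auto simp: PL_def)
    \<comment> \<open>The error \<open>26 / 16\<close> for the primes with
      \<open>ln p \<ge> 16\<close> is rounded up to 2.\<close>
    have Z: "y / 16 * exp (- 2) \<le> (\<Prod>p\<in>PL 16 y. 1 + 1 / (real p + 1))"
    proof -
      have "y / 16 * exp (- 2) \<le> y / 16 * exp (- (26 / 16))" using ly by (simp add: y_def)
      also have "\<dots> \<le> (\<Prod>p\<in>PL 16 y. 1 + 1 / (real p + 1))" using ly L(9) by (intro prod_PL_ge) auto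
      finally show ?thesis .
    qed
    have pr: "exp (- (144 / e) - 1) / (8 * sqrt L) \<le> Esub ?P (tilted y) (\<lambda>T. of_bool (?g n T))"
      unfolding y_def by (rule good_prob) (use L N I d n fl in auto)
    have "(exp (- 2) / 16) * (exp (- (144 / e) - 1) / (8 * sqrt L)) * y
       = (y / 16 * exp (- 2)) * (exp (- (144 / e) - 1) / (8 * sqrt L))" by simp
    also have "\<dots> \<le> (\<Prod>p\<in>PL 16 y. 1 + 1 / (real p + 1)) * Esub ?P (tilted y) (\<lambda>T. of_bool (?g n T))"
      using Z pr L0 by (intro mult_mono prod_nonneg) (auto intro!: divide_nonneg_nonneg)
    also have "Esub ?P (tilted y) (\<lambda>T. of_bool (?g n T)) =
        Esub ?P (\<lambda>p. if p \<in> {p. ln (real p) < y} then 2 * ?q p / (1 + ?q p) else ?q p) (\<lambda>T. of_bool (?g n T))"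
    proof (intro Esub_cong refl)
      fix p :: nat
      have "2 * (1 / x) / (1 + 1 / x) = 2 / (x + 1)" if "0 < x" for x :: real
      proof -
        have "1 + 1 / x = (x + 1) / x" using that by (simp add: field_simps)
        then show ?thesis using that by simp
      qed
      from this[of "real p + 1"] have "2 * ?q p / (1 + ?q p) = 2 / (real p + 2)" by (simp add: add.assoc)
      then show "tilted y p = (if p \<in> {p. ln (real p) < y} then 2 * ?q p / (1 + ?q p) else ?q p)"
        by (simp add: tilted_def)
    qed
    also have "(\<Prod>p\<in>PL 16 y. 1 + 1 / (real p + 1)) * \<dots>
        = Esub ?P ?q (\<lambda>T. 2 ^ card (T \<inter> {p. ln (real p) < y}) * of_bool (?g n T))"
      unfolding P[symmetric] by (rule Esub_tilt[symmetric]) auto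
    finally have 1: "(exp (- 2) / 16) * (exp (- (144 / e) - 1) / (8 * sqrt L)) * y
       \<le> Esub ?P ?q (\<lambda>T. 2 ^ card (T \<inter> {p. ln (real p) < y}) * of_bool (?g n T))" .
    have "?K / 104 * (exp (- 2) / 16) * (exp (- (144 / e) - 1) / (8 * sqrt L))
       = ?c n * ((exp (- 2) / 16) * (exp (- (144 / e) - 1) / (8 * sqrt L)) * y)" by (simp add: y_def)
    also have "\<dots> \<le> ?c n * Esub ?P ?q (\<lambda>T. 2 ^ card (T \<inter> {p. ln (real p) < y}) * of_bool (?g n T))"
      using 1 by (intro mult_left_mono) auto
    finally show "?K / 104 * (exp (- 2) / 16) * (exp (- (144 / e) - 1) / (8 * sqrt L))
       \<le> ?c n * Esub ?P ?q (\<lambda>T. 2 ^ card (T \<inter> {p. ln (real p) < exp (l + n * h)}) * of_bool (?g n T))"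
      by (simp add: y_def)
  qed
  also have "\<dots> = Esub ?P ?q (\<lambda>T. \<Sum>n=1..N. ?c n * (2 ^ card (T \<inter> {p. ln (real p) < exp (l + n * h)}) * of_bool (?g n T)))"
    by (simp only: Esub_sum Esub_cmult)
  also have "\<dots> \<le> Esub ?P ?q (\<lambda>T. real (Delta (\<Prod>T)) * of_bool (card T = r))"
  proof (rule Esub_mono)
    fix T assume T: "T \<subseteq> ?P"
    have "(\<Sum>n=1..N. ?c n * (2 ^ card (T \<inter> {p. ln (real p) < exp (l + n * h)}) * of_bool (?g n T)))
       = (\<Sum>n=1..N. (?c n * 2 ^ card (T \<inter> {p. ln (real p) < exp (l + n * h)})) * of_bool (?g n T))" by (simp only: mult.assoc)
    also have "\<dots> \<le> real (Delta (\<Prod>T)) * of_bool (card T = r)"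
    proof (rule sum_of_bool_unique_le)
      show "n = m" if "n \<in> {1..N}" "m \<in> {1..N}" "?g n T" "?g m T" for n m
        using that peak_unique[of l h N n "T \<inter> ?R" m] by (auto simp: good_def)
      fix n assume n: "n \<in> {1..N}" and g: "?g n T"
      have "real r * exp l \<le> exp (n * h) * exp l"
      proof (rule mult_right_mono)
        have "exp h \<le> exp (n * h)" using nh(1)[OF n] by simp
        then show "real r \<le> exp (n * h)" using lh by linarith
      qed simp
      then have "real r * exp l \<le> exp (l + n * h)" by (simp add: exp_add mult.commute)
      then show "?c n * 2 ^ card (T \<inter> {p. ln (real p) < exp (l + n * h)}) \<le> real (Delta (\<Prod>T)) * of_bool (card T = r)"
        using Delta_good_ge[of T L r l h "exp (l + n * h) / r" N n k d W I] T g N L r k I W by simp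
    qed auto
    finally show "(\<Sum>n=1..N. ?c n * (2 ^ card (T \<inter> {p. ln (real p) < exp (l + n * h)}) * of_bool (?g n T)))
       \<le> real (Delta (\<Prod>T)) * of_bool (card T = r)" .
  qed auto
  finally show ?thesis .
qed

section \<open>Asymptotics\<close>

lemma window_exp_bounds:
  assumes "a \<in> window (exp x) c"
  shows "exp (c * x) \<le> real a" "real a \<le> exp x"
  using assms by (auto simp: window_def powr_def)

text \<open>\<open>c * lam > 1\<close> puts the upper end of each window below the lower end of the
  next. So \<open>lam\<close> can be taken close to \<open>1 / c\<close>, and \<open>ln lam\<close>
  governs the number of windows.\<close>

lemma disjoint_windows:
  assumes "0 < c" "1 < lam" "1 < c * lam"
  shows "disjoint_family_on (\<lambda>i. window (exp (lam ^ i)) c) I"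
proof -
  have "window (exp (lam ^ i)) c \<inter> window (exp (lam ^ j)) c = {}" if "i < j" for i j
  proof -
    have "1 * lam ^ i < c * lam * lam ^ i" using assms by (intro mult_strict_right_mono) auto
    also have "c * lam * lam ^ i = c * lam ^ Suc i" by simp
    also have "\<dots> \<le> c * lam ^ j" using assms that by (intro mult_left_mono power_increasing) auto
    finally have "exp (lam ^ i) < exp (c * lam ^ j)" by simp
    have "False" if "a \<in> window (exp (lam ^ i)) c" "a \<in> window (exp (lam ^ j)) c" for a
      using window_exp_bounds(2)[OF that(1)] window_exp_bounds(1)[OF that(2)]
        \<open>exp (lam ^ i) < exp (c * lam ^ j)\<close> by linarith
    then show ?thesis by blast
  qed
  then show ?thesis unfolding disjoint_family_on_def by (metis inf_commute linorder_neqE_nat)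
qed

text \<open>The cells of the window have to lie between \<open>exp j\<close> and
  \<open>exp L\<close>: \<open>r + 1 \<le> exp (c * x)\<close> ensures the former and
  \<open>x \<le> e / 2 * L\<close> the latter. The discretisation error is tiny because
  \<open>1 / v \<le> 2 * L * exp (- (e * L))\<close> for \<open>v = exp j / r\<close>. Half of
  \<open>d / 20\<close> goes to this error and half to the limit in \<open>pr\<close>.\<close>

lemma tilted_stage_failure_le:
  fixes r :: nat
  assumes c: "0 < c" and r: "1 \<le> r" "real r \<le> 2 * L" and e: "0 < e" "e \<le> 1" and L: "1 \<le> L"
    and l: "0 \<le> l" "l \<le> j" "e * L \<le> j" "j + e / 2 * L \<le> L"
    and i: "0 \<le> x" "x \<le> e / 2 * L" "real r + 1 \<le> exp (c * x)" "48 \<le> exp (e * L)"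
      "48 * (2 * L) * exp (- (e * L)) * (1 + L) \<le> d / 40"
    and pr: "1 - d / 40 \<le> measure_pmf.prob (randA_window_pmf (exp x) c) {S. k \<le> mEq S}"
  shows "Esub (PL (exp l) (exp L)) (tilted (exp j)) (\<lambda>T. of_bool (\<not> k \<le> mEq (hits (exp j / r) (window (exp x) c) T))) \<le> d / 20"
proof -
  define v where "v = exp j / r"
  have v0: "0 < v" using r by (simp add: v_def)
  have vr: "v * r = exp j" using r by (simp add: v_def)
  have lo: "exp j \<le> v * (real a - 1)" if "a \<in> window (exp x) c" for a
  proof -
    have "real r \<le> real a - 1" using window_exp_bounds(1)[OF that] i(3) by linarith
    then have "v * r \<le> v * (real a - 1)" using v0 by (intro mult_left_mono) auto
    then show ?thesis by (simp only: vr)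
  qed
  have hi: "v * real a \<le> exp L" if "a \<in> window (exp x) c" for a
  proof -
    have "v \<le> exp j" using r by (simp add: v_def field_simps)
    then have "v * real a \<le> exp j * exp x" using window_exp_bounds(2)[OF that] by (intro mult_mono) auto
    also have "\<dots> \<le> exp L" using l i by (simp add: exp_add[symmetric])
    finally show ?thesis .
  qed
  have "Esub (PL (exp l) (exp L)) (tilted (exp j)) (\<lambda>T. of_bool (\<not> k \<le> mEq (hits v (window (exp x) c) T)))
     \<le> 1 - measure_pmf.prob (randA_window_pmf (exp x) c) {S. k \<le> mEq S} + 48 / v * (1 + ln (exp x))"
  proof (rule stage_failure_le)
    show "(\<Union>a\<in>window (exp x) c. PL (v * (real a - 1)) (v * a)) \<subseteq> PL (exp l) (exp L)"
    proof (intro UN_least PL_mono)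
      fix a assume a: "a \<in> window (exp x) c"
      have "exp l \<le> exp j" using l by simp
      then show "exp l \<le> v * (real a - 1)" using lo[OF a] by linarith
      show "v * real a \<le> exp L" by (rule hi[OF a])
    qed
    fix a assume a: "a \<in> window (exp x) c"
    show "tilted (exp j) p = 1 / (real p + 1)" if "p \<in> PL (v * (real a - 1)) (v * a)" for p
      using that lo[OF a] by (auto simp: tilted_def PL_def)
    have "exp (e * L) \<le> exp j" using l by simp
    then have "48 \<le> v * (real a - 1)" using lo[OF a] i(4) by linarith
    moreover have "2 \<le> real a" using window_exp_bounds(1)[OF a] i(3) r by linarith
    ultimately show "2 \<le> a \<and> 48 \<le> v * (real a - 1)" by simp
  qed (use v0 i in auto)
  also have "48 / v * (1 + ln (exp x)) \<le> d / 40"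
  proof -
    have "1 / v = r * exp (- j)" using r by (simp add: v_def exp_minus field_simps)
    also have "\<dots> \<le> (2 * L) * exp (- (e * L))" using r l L by (intro mult_mono) auto
    finally have "1 / v \<le> (2 * L) * exp (- (e * L))" .
    moreover have "e / 2 * L \<le> 1 * L" using e L by (intro mult_right_mono) auto
    then have "1 + x \<le> 1 + L" using i(2) by linarith
    ultimately have "(1 / v) * (1 + x) \<le> ((2 * L) * exp (- (e * L))) * (1 + L)"
      using v0 i(1) L by (intro mult_mono) auto
    then have "48 * ((1 / v) * (1 + x)) \<le> 48 * (((2 * L) * exp (- (e * L))) * (1 + L))" by (rule mult_left_mono) simp
    moreover have "48 / v * (1 + ln (exp x)) = 48 * ((1 / v) * (1 + x))" by simp
    moreover have "48 * (((2 * L) * exp (- (e * L))) * (1 + L)) = 48 * (2 * L) * exp (- (e * L)) * (1 + L)" by simp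
    ultimately show ?thesis using i(5) by linarith
  qed
  finally show ?thesis using pr unfolding v_def by linarith
qed

text \<open>The lower end \<open>L powr d\<close> sends all windows to infinity with
  \<open>L\<close>, uniformly in \<open>i\<close>, at the cost of the factor \<open>1 - d\<close>;
  the constants shift the number of stages by a bounded amount only.\<close>

lemma number_of_stages:
  fixes lam L e d :: real
  assumes lam: "1 < lam" and L: "1 \<le> L" "2 \<le> e * L" and d: "0 < d" and e: "0 < e"
    and big: "2 \<le> (1 - d) * ln L / ln lam + ln (e / 2) / ln lam"
  obtains I where "finite I" "I \<noteq> {}" "\<And>i. i \<in> I \<Longrightarrow> L powr d \<le> lam ^ i" "\<And>i. i \<in> I \<Longrightarrow> lam ^ i \<le> e / 2 * L"
    "(1 - d) * ln L / ln lam + ln (e / 2) / ln lam - 1 \<le> real (card I)"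
proof -
  have ll: "0 < ln lam" using lam by simp
  define u w where "u = d * ln L / ln lam" and "w = ln (e / 2 * L) / ln lam"
  have u0: "0 \<le> u" using d L ll by (simp add: u_def)
  have w0: "0 \<le> w" using L ll by (simp add: w_def)
  have wu: "w - u = (1 - d) * ln L / ln lam + ln (e / 2) / ln lam"
    using L e ln_mult_pos[of "e / 2" L] by (simp add: w_def u_def algebra_simps add_divide_distrib diff_divide_distrib)
  define I where "I = {nat \<lceil>u\<rceil>..nat \<lfloor>w\<rfloor>}"
  have a: "real (nat \<lceil>u\<rceil>) < u + 1" "u \<le> real (nat \<lceil>u\<rceil>)" using u0 by linarith+
  have b: "real (nat \<lfloor>w\<rfloor>) \<le> w" "w - 1 < real (nat \<lfloor>w\<rfloor>)" using w0 by linarith+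
  have "real (nat \<lceil>u\<rceil>) < real (nat \<lfloor>w\<rfloor>) + 1" using a b big wu by linarith
  then have le: "nat \<lceil>u\<rceil> \<le> nat \<lfloor>w\<rfloor>" by linarith
  show ?thesis
  proof
    show "finite I" "I \<noteq> {}" using le by (auto simp: I_def)
    have "real (card I) = real (nat \<lfloor>w\<rfloor>) + 1 - real (nat \<lceil>u\<rceil>)" using le by (simp add: I_def of_nat_diff)
    then show "(1 - d) * ln L / ln lam + ln (e / 2) / ln lam - 1 \<le> real (card I)" using a b wu by linarith
    fix i assume i: "i \<in> I"
    then have "real (nat \<lceil>u\<rceil>) \<le> real i" "real i \<le> real (nat \<lfloor>w\<rfloor>)" by (auto simp: I_def)
    then have ui: "u \<le> real i" "real i \<le> w" using a b by linarith+
    have p: "lam ^ i = exp (real i * ln lam)" using lam by (simp add: exp_of_nat_mult)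
    have "u * ln lam \<le> real i * ln lam" using ui ll by (intro mult_right_mono) auto
    moreover have "u * ln lam = d * ln L" using ll by (simp add: u_def)
    ultimately show "L powr d \<le> lam ^ i" using L by (simp add: p powr_def)
    have "real i * ln lam \<le> w * ln lam" using ui ll by (intro mult_right_mono) auto
    also have "w * ln lam = ln (e / 2 * L)" using ll by (simp add: w_def)
    finally have "lam ^ i \<le> exp (ln (e / 2 * L))" unfolding p by simp
    then show "lam ^ i \<le> e / 2 * L" using L by simp
  qed
qed

text \<open>The number \<open>sqrt L / h\<close> of grid points with
  \<open>h = L powr (e / 2)\<close> compensates the local limit loss up to \<open>e / 2\<close> in
  the exponent; the other \<open>e / 2\<close> pays for the incomplete use of the stages.\<close>

lemma expectation_lower_bound_eventually:
  fixes k :: nat and c lam e :: real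
  assumes k: "1 \<le> k" and c: "0 < c" and lam: "1 < lam" "1 < c * lam" and e: "0 < e" "e \<le> 1 / 4"
    and lim: "((\<lambda>D. measure_pmf.prob (randA_window_pmf D c) {S. k \<le> mEq S}) \<longlongrightarrow> 1) at_top"
  shows "\<exists>C>0. \<forall>\<^sub>F L in at_top. \<forall>r::nat. (1 + e) * L \<le> r \<and> r \<le> (2 - e) * L \<longrightarrow>
     C * L powr (ln k / ln lam - e)
       \<le> Esub (PL 16 (exp L)) (\<lambda>p. 1 / (real p + 1)) (\<lambda>T. real (Delta (\<Prod>T)) * of_bool (card T = r))"
proof -
  define ka where "ka = ln (real k) / ln lam"
  have ll: "0 < ln lam" using lam by simp
  have ka0: "0 \<le> ka" using k ll by (simp add: ka_def)
  \<comment> \<open>The range of stages and the tolerated failures each cost a factor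
    \<open>1 - d\<close>, and the square of \<open>1 - d\<close> is at least
    \<open>1 - 2 * d\<close>; this \<open>d\<close> makes \<open>2 * d * ka \<le> e / 2\<close>. The
    \<open>+ 1\<close> covers \<open>ka = 0\<close>.\<close>
  define d where "d = e / (4 * (ka + 1))"
  have d0: "0 < d" using e ka0 by (simp add: d_def)
  have "d \<le> e / 4" unfolding d_def using e ka0 by (intro divide_left_mono) auto
  then have d1: "d < 1 / 4" using e by linarith
  have dk: "2 * d * ka \<le> e / 2"
  proof -
    have "2 * d * ka = e / 2 * (ka / (ka + 1))" using ka0 by (simp add: d_def field_simps)
    also have "\<dots> \<le> e / 2 * 1" using e ka0 by (intro mult_left_mono) auto
    finally show ?thesis by simp
  qed
  \<comment> \<open>The bounded loss in the number of stages: 1 from rounding, the rest from the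
    factor \<open>e / 2\<close> in the upper end.\<close>
  define C' where "C' = 1 - ln (e / 2) / ln lam"
  have "ln (e / 2) \<le> 0" using e by simp
  then have C'0: "0 \<le> C'" using ll by (simp add: C'_def divide_le_0_iff)
  define C where "C = k powr (- C') / 104 * (exp (- 2) / 16) * (exp (- (144 / e) - 1) / 8) / 2"
  have C0: "0 < C" using k by (simp add: C_def)
  have "\<forall>\<^sub>F D in at_top. dist (measure_pmf.prob (randA_window_pmf D c) {S. k \<le> mEq S}) 1 < d / 40"
    using lim d0 by (intro tendstoD) auto
  then obtain D0 where D0: "\<And>D. D0 \<le> D \<Longrightarrow> dist (measure_pmf.prob (randA_window_pmf D c) {S. k \<le> mEq S}) 1 < d / 40"
    unfolding eventually_at_top_linorder by blast
  have "\<forall>\<^sub>F L in at_top. (1::real) \<le> L" by (rule eventually_ge_at_top)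
  moreover have "\<forall>\<^sub>F L in at_top. 100 \<le> sqrt L" by real_asymp
  moreover have "\<forall>\<^sub>F L in at_top. 100 / e \<le> sqrt L" using e by real_asymp
  moreover have "\<forall>\<^sub>F L in at_top. 16 \<le> e * L" using e by real_asymp
  moreover have "\<forall>\<^sub>F L in at_top. 520 \<le> L powr (e / 2)" using e by real_asymp
  moreover have "\<forall>\<^sub>F L in at_top. 2 * L powr (e / 2) \<le> sqrt L"
  proof -
    have "\<forall>\<^sub>F L in at_top. 2 * L powr (1 / 8) \<le> sqrt L" by real_asymp
    then show ?thesis using eventually_ge_at_top[of 1]
    proof eventually_elim
      case (elim L)
      have "L powr (e / 2) \<le> L powr (1 / 8)" using elim e by (intro powr_mono) auto
      then show ?case using elim by linarith
    qed
  qed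
  moreover have "\<forall>\<^sub>F L in at_top. sqrt L \<le> e / 2 * L" using e by real_asymp
  moreover have "\<forall>\<^sub>F L in at_top. 28 * (1 + ln L) / L powr (e / 2) \<le> 1 / 20" using e by real_asymp
  moreover have "\<forall>\<^sub>F L in at_top. 2 * L \<le> exp (L powr (e / 2))" using e by real_asymp
  moreover have "\<forall>\<^sub>F L in at_top. 2 * L + 1 \<le> exp (c * L powr d)" using c d0 by real_asymp
  moreover have "\<forall>\<^sub>F L in at_top. D0 \<le> exp (L powr d)" using d0 by real_asymp
  moreover have "\<forall>\<^sub>F L in at_top. 48 \<le> exp (e * L)" using e by real_asymp
  moreover have "\<forall>\<^sub>F L in at_top. 48 * (2 * L) * exp (- (e * L)) * (1 + L) \<le> d / 40" using e d0 by real_asymp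
  moreover have "\<forall>\<^sub>F L in at_top. 2 \<le> (1 - d) * ln L / ln lam + ln (e / 2) / ln lam"
  proof -
    have "filterlim (\<lambda>L. (1 - d) / ln lam * ln L) at_top at_top"
      using ll d1 by (intro filterlim_tendsto_pos_mult_at_top[OF tendsto_const _ ln_at_top]) auto
    then have "\<forall>\<^sub>F L in at_top. 2 - ln (e / 2) / ln lam \<le> (1 - d) / ln lam * ln L"
      by (simp add: filterlim_at_top)
    then show ?thesis by eventually_elim simp
  qed
  ultimately have "\<forall>\<^sub>F L in at_top. \<forall>r::nat. (1 + e) * L \<le> r \<and> r \<le> (2 - e) * L \<longrightarrow>
     C * L powr (ka - e)
       \<le> Esub (PL 16 (exp L)) (\<lambda>p. 1 / (real p + 1)) (\<lambda>T. real (Delta (\<Prod>T)) * of_bool (card T = r))"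
  proof eventually_elim
    case (elim L)
    note E = elim
    show ?case
    proof (intro allI impI)
      fix r :: nat
      assume r: "(1 + e) * L \<le> r \<and> r \<le> (2 - e) * L"
      define l where "l = real r - L"
      define h where "h = L powr (e / 2)"
      define N where "N = nat \<lfloor>sqrt L / h\<rfloor>"
      have h0: "520 \<le> h" using E by (simp add: h_def)
      have l: "e * L \<le> l" "l \<le> (1 - e) * L" using r by (auto simp: l_def algebra_simps)
      have l16: "16 \<le> l" using l E by linarith
      have r2: "real r \<le> 2 * L"
      proof -
        have "(2 - e) * L \<le> 2 * L" using e E by (intro mult_right_mono) auto
        then show ?thesis using r by linarith
      qed
      have r1: "1 \<le> r" using l16 E by (simp add: l_def)
      have sh: "2 \<le> sqrt L / h" using E h0 by (simp add: h_def field_simps)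
      have N: "real N \<le> sqrt L / h" "sqrt L / h - 1 < real N" using sh by (auto simp: N_def)
      have N2: "sqrt L / h / 2 \<le> real N"
      proof -
        have "z / 2 \<le> y" if "z - 1 < y" "2 \<le> z" for z y :: real using that by simp
        then show ?thesis using N(2) sh by blast
      qed
      have N1: "1 \<le> N" using N sh by linarith
      have Nh: "N * h \<le> sqrt L" using N(1) h0 by (simp add: field_simps)
      have lNh: "l + N * h \<le> (1 - e / 2) * L" using Nh l E by (simp add: algebra_simps)
      have "N \<le> L"
      proof -
        have "real N * 1 \<le> N * h" using h0 by (intro mult_left_mono) auto
        also note Nh
        also have "sqrt L \<le> e / 2 * L" using E by simp
        also have "\<dots> \<le> 1 * L" using e E by (intro mult_right_mono) auto
        finally show ?thesis by simp
      qed
      then have "ln N \<le> ln L" using N1 by simp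
      then have "28 * (1 + ln N) / h \<le> 28 * (1 + ln L) / h" using h0 by (intro divide_right_mono) auto
      also have "\<dots> \<le> 1 / 20" unfolding h_def by (rule E(8))
      finally have lnN: "28 * (1 + ln N) / h \<le> 1 / 20" .
      obtain I where I: "finite I" "I \<noteq> {}" "\<And>i. i \<in> I \<Longrightarrow> L powr d \<le> lam ^ i" "\<And>i. i \<in> I \<Longrightarrow> lam ^ i \<le> e / 2 * L"
          "(1 - d) * ln L / ln lam + ln (e / 2) / ln lam - 1 \<le> real (card I)"
        using number_of_stages[OF lam(1), of L e d] E d0 e by auto
      define W where "W i = window (exp (lam ^ i)) c" for i
      have ci: "real r + 1 \<le> exp (c * lam ^ i)" if "i \<in> I" for i
      proof -
        have "exp (c * L powr d) \<le> exp (c * lam ^ i)" using I(3)[OF that] c by (simp add: mult_left_mono)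
        then show ?thesis using E r2 by linarith
      qed
      have "real N * (k powr ((1 - d) * card I) / 104 * (exp (- 2) / 16) * (exp (- (144 / e) - 1) / (8 * sqrt L))) \<le>
        Esub (PL 16 (exp L)) (\<lambda>p. 1 / (real p + 1)) (\<lambda>T. real (Delta (\<Prod>T)) * of_bool (card T = r))" (is "_ \<le> ?E")
      proof (rule expectation_ge_peaks)
        show "16 \<le> exp l" using l16 exp_ge_add_one_self[of l] by linarith
        have "(1 - e / 2) * L \<le> 1 * L" using e E by (intro mult_right_mono) auto
        then show "l + N * h \<le> L" using lNh by linarith
        show "disjoint_family_on W I" unfolding W_def by (rule disjoint_windows[OF c lam])
        show "real r \<le> exp h" using r2 E by (simp add: h_def)
        show "real r + 1 \<le> a" if "i \<in> I" "a \<in> W i" for i a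
          using window_exp_bounds(1)[of a "lam ^ i" c] that ci[OF that(1)] by (simp add: W_def)
        fix i n assume i: "i \<in> I" and n: "n \<in> {1..N}"
        have nh: "0 \<le> n * h" "n * h \<le> N * h" using n h0 by (auto intro: mult_right_mono)
        show "Esub (PL (exp l) (exp L)) (tilted (exp (l + n * h))) (\<lambda>T. of_bool (\<not> k \<le> mEq (hits (exp (l + n * h) / r) (W i) T))) \<le> d / 20"
          unfolding W_def
        proof (rule tilted_stage_failure_le[OF c r1 r2 e(1)])
          show "l + n * h + e / 2 * L \<le> L" using nh lNh by (simp add: algebra_simps)
          show "e * L \<le> l + n * h" using l nh by linarith
          have "exp (L powr d) \<le> exp (lam ^ i)" using I(3)[OF i] by simp
          then have "dist (measure_pmf.prob (randA_window_pmf (exp (lam ^ i)) c) {S. k \<le> mEq S}) 1 < d / 40"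
            using E by (intro D0) linarith
          then show "1 - d / 40 \<le> measure_pmf.prob (randA_window_pmf (exp (lam ^ i)) c) {S. k \<le> mEq S}"
            by (simp add: dist_real_def)
        qed (use E e l16 nh lam ci[OF i] I(4)[OF i] in auto)
      qed (use E e k l l16 r2 h0 Nh lnN I(1,2) d0 in \<open>auto simp: l_def W_def\<close>)
      moreover have "C * L powr (ka - e) \<le> real N * (k powr ((1 - d) * card I) / 104 * (exp (- 2) / 16) * (exp (- (144 / e) - 1) / (8 * sqrt L)))"
      proof -
        have L0: "0 < L" "1 \<le> L" using E by auto
        have "L powr (ka - e / 2) * k powr (- C') \<le> k powr ((1 - d) * card I)"
        proof -
          have "(1 - d) * ((1 - d) * (ln L / ln lam) - C') \<le> (1 - d) * card I"
            using I(5) d1 by (intro mult_left_mono) (auto simp: C'_def)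
          moreover have "(1 - 2 * d) * (ln L / ln lam) - C' \<le> (1 - d) * ((1 - d) * (ln L / ln lam) - C')"
          proof -
            have "(1 - 2 * d) * z - C' \<le> (1 - d) * ((1 - d) * z - C')" if "0 \<le> d * d * z" "0 \<le> d * C'" for z
              using that by (simp add: algebra_simps)
            moreover have "0 \<le> d * d * (ln L / ln lam)" "0 \<le> d * C'" using d0 C'0 L0 ll by auto
            ultimately show ?thesis by blast
          qed
          ultimately have 1: "(1 - 2 * d) * (ln L / ln lam) - C' \<le> (1 - d) * card I" by linarith
          have "L powr (ka - e / 2) \<le> L powr (ka * (1 - 2 * d))"
            using L0 dk by (intro powr_mono) (auto simp: algebra_simps)
          also have "\<dots> = k powr ((1 - 2 * d) * (ln L / ln lam))"
            using k L0 by (simp add: powr_def ka_def mult_ac)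
          finally have "L powr (ka - e / 2) * k powr (- C') \<le> k powr ((1 - 2 * d) * (ln L / ln lam)) * k powr (- C')"
            by (intro mult_right_mono) auto
          also have "\<dots> = k powr ((1 - 2 * d) * (ln L / ln lam) - C')" by (simp add: powr_add[symmetric])
          also have "\<dots> \<le> k powr ((1 - d) * card I)" using 1 k by (intro powr_mono) auto
          finally show ?thesis .
        qed
        then have "(sqrt L / h / 2) * (L powr (ka - e / 2) * k powr (- C')) \<le> real N * k powr ((1 - d) * card I)"
          using N2 h0 by (intro mult_mono) auto
        then have "(sqrt L / h / 2) * (L powr (ka - e / 2) * k powr (- C')) * (exp (- 2) / 16 / 104 * (exp (- (144 / e) - 1) / (8 * sqrt L)))
           \<le> real N * k powr ((1 - d) * card I) * (exp (- 2) / 16 / 104 * (exp (- (144 / e) - 1) / (8 * sqrt L)))"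
          using L0 by (intro mult_right_mono) auto
        moreover have "(sqrt L / h / 2) * (L powr (ka - e / 2) * k powr (- C')) * (exp (- 2) / 16 / 104 * (exp (- (144 / e) - 1) / (8 * sqrt L)))
           = C * (L powr (ka - e / 2) / h)" using L0 by (simp add: C_def)
        moreover have "L powr (ka - e / 2) / h = L powr (ka - e)" by (simp add: h_def powr_diff[symmetric])
        ultimately show ?thesis by (simp add: mult_ac)
      qed
      ultimately show "C * L powr (ka - e) \<le> ?E" by linarith
    qed
  qed
  then show ?thesis using C0 unfolding ka_def by blast
qed

section \<open>The exponent and the theorem\<close>

text \<open>Only the outcomes without elements in \<open>A\<close> are kept; for the primes with
  \<open>ln p < 16\<close> this costs a constant factor.\<close>

lemma Esub_ge_avoid:
  assumes fin: "finite A" "finite B" "A \<inter> B = {}" and q: "\<And>p. 0 \<le> q p \<and> q p \<le> 1"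
    and f: "\<And>T. 0 \<le> f T"
  shows "(\<Prod>p\<in>A. 1 - q p) * Esub B q f \<le> Esub (A \<union> B) q f"
proof -
  have nn: "0 \<le> Esub B q (\<lambda>T. f (S \<union> T))" for S using q f by (intro Esub_nonneg) auto
  have "(\<Prod>p\<in>A. 1 - q p) * Esub B q f = Esub A q (\<lambda>S. if S = {} then Esub B q f else 0)"
    using fin by (simp add: Esub_if_empty)
  also have "\<dots> \<le> Esub A q (\<lambda>S. Esub B q (\<lambda>T. f (S \<union> T)))"
    using q nn by (intro Esub_mono) auto
  also have "\<dots> = Esub (A \<union> B) q f" using fin by (simp add: Esub_Un)
  finally show ?thesis .
qed

text \<open>A single set of size \<open>r\<close> is kept; \<open>q \<le> 1 / 2\<close> allows
  \<open>1 - q\<close> to be replaced by \<open>q\<close>, so the bound does not depend on the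
  set.\<close>

lemma Esub_card_eq_ge_prod:
  assumes P: "finite P" "\<And>p. p \<in> P \<Longrightarrow> 0 \<le> q p \<and> q p \<le> 1 / 2" and r: "r \<le> card P"
  shows "(\<Prod>p\<in>P. q p) \<le> Esub P q (\<lambda>T. of_bool (card T = r))"
proof -
  obtain T where T: "T \<subseteq> P" "card T = r" using r obtain_subset_with_card_n by metis
  have "(\<Prod>p\<in>P. q p) \<le> (\<Prod>p\<in>P. if p \<in> T then q p else 1 - q p)"
    using P(2) by (intro prod_mono) (auto, fastforce)
  also have "\<dots> = (\<Prod>p\<in>P. if p \<in> T then q p else 1 - q p) * of_bool (card T = r)" using T by simp
  also have "\<dots> \<le> Esub P q (\<lambda>T. of_bool (card T = r))" unfolding Esub_def
  proof (rule member_le_sum)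
    fix S assume "S \<in> Pow P - {T}"
    have "0 \<le> 1 - q p" if "p \<in> P" for p using P(2)[OF that] by simp
    then show "0 \<le> (\<Prod>p\<in>P. if p \<in> S then q p else 1 - q p) * of_bool (card S = r)"
      using P(2) by (intro mult_nonneg_nonneg prod_nonneg) auto
  qed (use T P in auto)
  finally show ?thesis .
qed

text \<open>For bounded \<open>x\<close> the event \<open>\<omega> = r\<close> has to be possible:
  with \<open>y = ln x\<close> there must be at least \<open>r\<close> primes below
  \<open>x\<close>. For \<open>r \<le> 2\<close> the primes 2 and 3 serve; otherwise each
  \<open>ln p / p\<close> is at most \<open>1 / exp 1 \<le> 2 / 5\<close>, so Mertens' lower bound
  forces many primes.\<close>

lemma card_primes_ge:
  assumes y: "1 < ln y" "0 < y" and r: "real r < 2 * ln y"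
  shows "r \<le> card (PL 0 y)"
proof (cases "r \<le> 2")
  case True
  have "exp 1 < exp (ln y)" using y(1) by (simp only: exp_less_cancel_iff)
  then have "exp 1 \<le> y" using y(2) by simp
  then have y2: "5 / 2 \<le> y" using exp_lower_Taylor_quadratic[of 1] by simp
  have "ln (2::real) < y" "ln (3::real) < y"
    using y2 ln_le_minus_one[of "2::real"] ln_le_minus_one[of "3::real"] ln_less_self[of "2::real"] by auto
  then have "{2, 3} \<subseteq> PL 0 y" by (auto simp: PL_def)
  then have "card {2, 3::nat} \<le> card (PL 0 y)" by (intro card_mono) auto
  then show ?thesis using True by simp
next
  case False
  have eh: "13 / 8 \<le> exp (1 / 2 :: real)" using exp_lower_Taylor_quadratic[of "1 / 2"] by (simp add: power2_eq_square)
  have e1: "5 / 2 \<le> exp (1 :: real)" using exp_lower_Taylor_quadratic[of 1] by simp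
  have "3 / 2 < ln y" using r False by linarith
  then have "exp (3 / 2) < exp (ln y)" by (simp only: exp_less_cancel_iff)
  moreover have "(13 / 8) ^ 3 \<le> exp (1 / 2 :: real) ^ 3" using eh by (intro power_mono) auto
  moreover have "exp (1 / 2 :: real) ^ 3 = exp (3 / 2)" by (simp flip: exp_of_nat_mult)
  ultimately have y4: "429 / 100 < y" using y by (simp add: power3_eq_cube)
  obtain n where n: "real n < exp y" "exp y \<le> real n + 1" "\<And>p::nat. 0 < p \<Longrightarrow> ln (real p) < y \<longleftrightarrow> p \<le> n"
    using PL_conv_nat[of y] by blast
  have "(5 / 2) ^ 4 \<le> exp (1 :: real) ^ 4" using e1 by (intro power_mono) auto
  also have "exp (1 :: real) ^ 4 = exp 4" by (simp flip: exp_of_nat_mult)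
  also have "\<dots> \<le> exp y" using y4 by simp
  finally have n38: "38 \<le> real n" using n(2) by (simp add: power4_eq_xxxx)
  have "y = ln (exp y)" by simp
  also have "\<dots> \<le> ln (real n + 1)" using n(2) by (subst ln_le_cancel_iff) auto
  also have "\<dots> - ln n \<le> (real n + 1 - real n) / n" using n38 by (intro ln_diff_le) auto
  also have "\<dots> \<le> 1 / 38" using n38 by (simp add: field_simps)
  finally have lny: "y - 1 / 38 \<le> ln n" by simp
  have PL: "PL 0 y = {p. prime p \<and> p \<le> n}"
  proof -
    have "p \<in> PL 0 y \<longleftrightarrow> prime p \<and> p \<le> n" for p
    proof (cases "prime p")
      case True
      then have "0 < p" by (rule prime_gt_0_nat)
      then show ?thesis using True n(3)[of p] by (simp add: PL_def)
    qed (simp add: PL_def)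
    then show ?thesis by blast
  qed
  have "ln n - 3 \<le> (\<Sum>p\<in>PL 0 y. ln (real p) / real p)"
    unfolding PL using n38 by (intro mertens_first_lower) simp
  also have "\<dots> \<le> (\<Sum>p\<in>PL 0 y. 2 / 5)"
  proof (rule sum_mono)
    fix p assume "p \<in> PL 0 y"
    then have p: "real p > 1" by (auto dest: PL_gt_1)
    have "ln (real p / exp 1) \<le> real p / exp 1 - 1" using p by (intro ln_le_minus_one) simp
    then have "ln (real p) \<le> real p / exp 1" using p by (simp add: ln_div)
    also have "\<dots> \<le> real p / (5 / 2)" using p e1 by (intro divide_left_mono) auto
    finally show "ln (real p) / real p \<le> 2 / 5" using p by (simp add: field_simps)
  qed
  finally have "5 / 2 * (y - 1 / 38 - 3) \<le> card (PL 0 y)" using lny by simp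
  \<comment> \<open>The tangent of the logarithm at 4, close to the smallest \<open>y\<close> of
    this case.\<close>
  moreover have "ln y \<le> 2 * ln 2 + (y / 4 - 1)"
  proof -
    have "ln (y / 4) \<le> y / 4 - 1" using y4 by (intro ln_le_minus_one) simp
    moreover have "ln (4::real) = 2 * ln 2" using ln_realpow[of "2::real" 2] by simp
    ultimately show ?thesis using y4 by (simp add: ln_div)
  qed
  then have "2 * ln y \<le> 5 / 2 * (y - 1 / 38 - 3)" using y4 ln2_le_25_over_36 by argo
  ultimately have "real r \<le> real (card (PL 0 y))" using r by argo
  then show ?thesis by simp
qed

text \<open>The asymptotic bound holds from some \<open>L0\<close> on. For smaller \<open>L\<close>
  only boundedly many primes occur, and \<open>Delta \<ge> 1\<close> together with a positive
  probability of \<open>\<omega> = r\<close> takes its place.\<close>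

lemma expectation_lower_bound:
  fixes k :: nat and c lam e :: real
  assumes k: "1 \<le> k" and c: "0 < c" and lam: "1 < lam" "1 < c * lam" and e: "0 < e" "e \<le> 1 / 4"
    and lim: "((\<lambda>D. measure_pmf.prob (randA_window_pmf D c) {S. k \<le> mEq S}) \<longlongrightarrow> 1) at_top"
  shows "\<exists>C>0. \<forall>x r. (1 + e) * Log2 x \<le> real_of_int r \<and> real_of_int r \<le> (2 - e) * Log2 x \<and> x > 0 \<longrightarrow>
     C * Log2 x powr (ln k / ln lam - e)
       \<le> measure_pmf.expectation (n_lt_pmf x) (\<lambda>n. real (Delta n) * (if int (omega n) = r then 1 else 0))"
proof -
  let ?q = "\<lambda>p::nat. 1 / (real p + 1)"
  let ?f = "\<lambda>r T. real (Delta (\<Prod>T)) * of_bool (card T = r)"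
  define u where "u = ln k / ln lam - e"
  obtain C L0 where C: "C > 0" and L0: "\<And>L r. L0 \<le> L \<Longrightarrow> (1 + e) * L \<le> real r \<Longrightarrow> real r \<le> (2 - e) * L \<Longrightarrow>
      C * L powr u \<le> Esub (PL 16 (exp L)) ?q (?f r)"
    using expectation_lower_bound_eventually[OF k c lam e lim] unfolding eventually_at_top_linorder u_def by blast
  \<comment> \<open>15 gives \<open>exp L \<ge> L + 1 \<ge> 16\<close>, so that the primes split at
    \<open>ln p = 16\<close>.\<close>
  define L1 where "L1 = max L0 15"
  define z where "z = (\<Prod>p\<in>PL 0 16. 1 - ?q p)"
  define y where "y = (\<Prod>p\<in>PL 0 (exp L1). ?q p)"
  \<comment> \<open>The absolute value makes \<open>M\<close> a bound of \<open>L powr u\<close> for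
    \<open>1 \<le> L \<le> L1\<close>, whatever the sign of \<open>u\<close>.\<close>
  define M where "M = L1 powr \<bar>u\<bar>"
  have z0: "0 < z" unfolding z_def by (intro prod_pos) (auto dest!: PL_gt_1)
  have y0: "0 < y" unfolding y_def by (intro prod_pos) auto
  have M0: "0 < M" by (simp add: M_def L1_def)
  define C' where "C' = min (z * C) (y / M)"
  have C'0: "0 < C'" using z0 y0 M0 C by (simp add: C'_def)
  have "C' * Log2 x powr u \<le> measure_pmf.expectation (n_lt_pmf x) (\<lambda>n. real (Delta n) * (if int (omega n) = r then 1 else 0))"
    if r: "(1 + e) * Log2 x \<le> real_of_int r" "real_of_int r \<le> (2 - e) * Log2 x" and x: "0 < x" for x r
  proof -
    define L where "L = Log2 x"
    have L1: "1 \<le> L" by (simp add: L_def Log2_def LogM_def)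
    have "1 < (1 + e) * 1" using e by simp
    also have "\<dots> \<le> (1 + e) * L" using L1 e by (intro mult_left_mono) auto
    also have "\<dots> \<le> real_of_int r" using r(1) by (simp add: L_def)
    finally have r1: "1 < real_of_int r" .
    define s where "s = nat r"
    have s: "int s = r" "real s = real_of_int r" using r1 by (auto simp: s_def)
    have "1 < r" using r1 by simp
    then have "2 \<le> r" by simp
    then have "2 \<le> real_of_int r" by simp
    then have "2 \<le> (2 - e) * L" using r unfolding L_def by linarith
    \<comment> \<open>For \<open>L = 1\<close> no integer lies between \<open>1 + e\<close> and
      \<open>2 - e\<close>. Hence neither truncation in \<open>Log2\<close> is active and
      \<open>L\<close> is \<open>ln (ln x)\<close>.\<close>
    then have L2: "1 < L" using L1 e by (cases "L = 1") auto
    then have LM: "L = ln (LogM x)" "1 < ln (LogM x)" by (auto simp: L_def Log2_def LogM_def[of "LogM x"] max_def split: if_splits)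
    have "LogM x \<noteq> 1" using LM by auto
    then have "LogM x = ln x" "1 < ln x" by (auto simp: LogM_def max_def split: if_splits)
    then have eL: "exp L = ln x" using LM by simp
    have P: "{p. prime p \<and> real p < x} = PL 0 (exp L)"
    proof -
      have "real p < x \<longleftrightarrow> ln (real p) < ln x" if "prime p" for p
        using prime_gt_0_nat[OF that] x by simp
      moreover have "0 \<le> ln (real p)" if "prime p" for p using prime_ge_1_nat[OF that] by simp
      ultimately show ?thesis unfolding PL_def eL by blast
    qed
    have E: "measure_pmf.expectation (n_lt_pmf x) (\<lambda>n. real (Delta n) * (if int (omega n) = r then 1 else 0))
       = Esub (PL 0 (exp L)) ?q (?f s)"
      unfolding expectation_n_lt P
    proof (intro Esub_cong refl)
      fix T assume T: "T \<subseteq> PL 0 (exp L)"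
      have "omega (\<Prod>T) = card T" using T PL_prime finite_subset[OF T finite_PL] by (intro omega_prod) auto
      then show "real (Delta (\<Prod>T)) * (if int (omega (\<Prod>T)) = r then 1 else 0) = ?f s T" using s by auto
    qed
    have r': "(1 + e) * L \<le> real s" "real s \<le> (2 - e) * L" using r s by (auto simp: L_def)
    show ?thesis
    proof (cases "L1 \<le> L")
      case True
      have "L + 1 \<le> exp L" using exp_ge_add_one_self[of L] by (simp add: add.commute)
      then have "16 \<le> exp L" using True by (simp add: L1_def)
      then have "PL 0 (exp L) = PL 0 16 \<union> PL 16 (exp L)" by (intro PL_Un) auto
      moreover have "z * Esub (PL 16 (exp L)) ?q (?f s) \<le> Esub (PL 0 16 \<union> PL 16 (exp L)) ?q (?f s)"
      proof -
        have "PL 0 16 \<inter> PL 16 (exp L) = {}" by (auto simp: PL_def)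
        then show ?thesis unfolding z_def by (intro Esub_ge_avoid) auto
      qed
      moreover have "C * L powr u \<le> Esub (PL 16 (exp L)) ?q (?f s)"
        using True r' by (intro L0) (auto simp: L1_def)
      then have "z * (C * L powr u) \<le> z * Esub (PL 16 (exp L)) ?q (?f s)" using z0 by (intro mult_left_mono) auto
      moreover have "C' * L powr u \<le> z * C * L powr u" by (intro mult_right_mono) (auto simp: C'_def)
      ultimately show ?thesis unfolding E L_def[symmetric] by (simp add: mult.assoc)
    next
      case False
      have sc: "s \<le> card (PL 0 (exp L))"
      proof (rule card_primes_ge)
        have "(2 - e) * L < 2 * L" using e L1 by (intro mult_strict_right_mono) auto
        then show "real s < 2 * ln (exp L)" using r' by simp
      qed (use L2 in auto)
      have "y \<le> (\<Prod>p\<in>PL 0 (exp L). ?q p)"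
      proof -
        have sub: "PL 0 (exp L) \<subseteq> PL 0 (exp L1)" using False by (intro PL_mono) auto
        have "y = (\<Prod>p\<in>PL 0 (exp L1) - PL 0 (exp L). ?q p) * (\<Prod>p\<in>PL 0 (exp L). ?q p)"
          unfolding y_def by (rule prod.subset_diff[OF sub]) simp
        also have "\<dots> \<le> 1 * (\<Prod>p\<in>PL 0 (exp L). ?q p)"
          by (intro mult_right_mono prod_le_1 prod_nonneg) auto
        finally show ?thesis by simp
      qed
      also have "\<dots> \<le> Esub (PL 0 (exp L)) ?q (\<lambda>T. of_bool (card T = s))"
        by (rule Esub_card_eq_ge_prod[OF _ _ sc]) (auto dest!: PL_gt_1)
      also have "\<dots> \<le> Esub (PL 0 (exp L)) ?q (?f s)"
      proof (rule Esub_mono)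
        fix T assume T: "T \<subseteq> PL 0 (exp L)"
        have "0 < \<Prod>T" using T by (intro prod_pos) (auto dest!: PL_gt_1)
        then have "1 \<le> real (Delta (\<Prod>T))" using Delta_ge_1 by fastforce
        then show "of_bool (card T = s) \<le> ?f s T" by simp
      qed auto
      finally have "y \<le> Esub (PL 0 (exp L)) ?q (?f s)" .
      moreover have "C' * L powr u \<le> y"
      proof -
        have "L powr u \<le> L powr \<bar>u\<bar>" using L1 by (intro powr_mono) auto
        also have "\<dots> \<le> M" unfolding M_def using L1 False by (intro powr_mono2) auto
        finally have "C' * L powr u \<le> (y / M) * M" using C'0 y0 M0 by (intro mult_mono) (auto simp: C'_def)
        then show ?thesis using M0 by simp
      qed
      ultimately show ?thesis unfolding E L_def[symmetric] by linarith
    qed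
  qed
  then show ?thesis using C'0 unfolding u_def by blast
qed

section \<open>The supremum \<open>beta\<close> and the lower limit \<open>eta_star\<close>\<close>

abbreviation beta_set :: "nat \<Rightarrow> real set" where
  "beta_set k \<equiv> {c. c < 1 \<and> ((\<lambda>D. measure_pmf.prob (randA_window_pmf D c) {S. mEq S \<ge> k}) \<longlongrightarrow> 1) at_top}"

lemma beta_set_antimono:
  assumes "k \<le> k'"
  shows "beta_set k' \<subseteq> beta_set k"
proof
  fix c assume c: "c \<in> beta_set k'"
  have "((\<lambda>D. measure_pmf.prob (randA_window_pmf D c) {S. k \<le> mEq S}) \<longlongrightarrow> 1) at_top"
  proof (rule tendsto_sandwich[where h = "\<lambda>_. 1"])
    show "\<forall>\<^sub>F D in at_top. measure_pmf.prob (randA_window_pmf D c) {S. k' \<le> mEq S} \<le> measure_pmf.prob (randA_window_pmf D c) {S. k \<le> mEq S}"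
      using assms by (intro always_eventually allI measure_pmf.finite_measure_mono) auto
    show "((\<lambda>D. measure_pmf.prob (randA_window_pmf D c) {S. k' \<le> mEq S}) \<longlongrightarrow> 1) at_top" using c by simp
  qed (auto intro: always_eventually measure_pmf.prob_le_1)
  then show "c \<in> beta_set k" using c by simp
qed

text \<open>For \<open>c \<le> 0\<close> and \<open>D \<ge> 1\<close> the window consists of all
  positive integers up to \<open>D\<close>, so a negative \<open>c\<close> in the set puts 0 into it
  as well.\<close>

lemma beta_nonneg:
  assumes "beta_set k \<noteq> {}"
  shows "0 \<le> beta k"
proof -
  obtain c where c: "c \<in> beta_set k" using assms by blast
  have bdd: "bdd_above (beta_set k)" by (rule bdd_aboveI[of _ 1]) auto
  show ?thesis
  proof (cases "0 \<le> c")
    case True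
    then show ?thesis using cSup_upper[OF c bdd] unfolding beta_def by simp
  next
    case False
    have w: "window D c = window D 0" if "1 \<le> D" for D
    proof -
      have "D powr c \<le> D powr 0" using that False by (intro powr_mono) auto
      then have "D powr c \<le> real a" if "0 < a" for a using that \<open>1 \<le> D\<close> by (simp add: Suc_le_eq[symmetric])
      then show ?thesis using that unfolding window_def by (auto simp: Suc_le_eq)
    qed
    have ev: "\<forall>\<^sub>F D in at_top. measure_pmf.prob (randA_window_pmf D c) {S. mEq S \<ge> k} = measure_pmf.prob (randA_window_pmf D 0) {S. mEq S \<ge> k}"
      using eventually_ge_at_top[of 1] by eventually_elim (simp add: randA_window_pmf_def w)
    have "((\<lambda>D. measure_pmf.prob (randA_window_pmf D c) {S. mEq S \<ge> k}) \<longlongrightarrow> 1) at_top" using c by simp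
    then have "((\<lambda>D. measure_pmf.prob (randA_window_pmf D 0) {S. mEq S \<ge> k}) \<longlongrightarrow> 1) at_top"
      using ev by (rule Lim_transform_eventually)
    then have "0 \<in> beta_set k" by simp
    then show ?thesis using cSup_upper[OF _ bdd] unfolding beta_def by simp
  qed
qed

text \<open>\<open>Sup {}\<close> is some fixed real number. If the set is empty for
  \<open>k\<close>, it is empty for all larger indices and \<open>beta\<close> is constant from
  there on; then the quotients tend to infinity, and \<open>real_of_ereal\<close> maps this lower
  limit to 0, against \<open>eta_star > 0\<close>.\<close>

lemma beta_set_nonempty:
  assumes eta: "0 < eta_star" and k: "2 \<le> k" "0 < ln (1 / beta k)"
  shows "beta_set k \<noteq> {}"
proof
  assume empty: "beta_set k = {}"
  define b where "b = ln (1 / beta k)"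
  have beq: "beta k' = beta k" if "k \<le> k'" for k'
  proof -
    have "beta_set k' \<subseteq> {}" using beta_set_antimono[OF that] unfolding empty .
    then have "beta_set k' = {}" by (rule subset_empty[THEN iffD1])
    then show ?thesis unfolding beta_def empty by (rule arg_cong)
  qed
  have "\<forall>\<^sub>F k' in sequentially. ereal (ln (real k') / ln (1 / beta k')) = ereal (ln (real k') / b)"
    using eventually_ge_at_top[of k]
  proof eventually_elim
    case (elim k')
    show ?case unfolding b_def beq[OF elim] ..
  qed
  then have "liminf (\<lambda>k. ereal (ln (real k) / ln (1 / beta k))) = liminf (\<lambda>k'. ereal (ln (real k') / b))"
    by (rule Liminf_eq)
  also have "\<dots> = \<infinity>"
  proof -
    have "filterlim (\<lambda>k'. ln (real k') / b) at_top sequentially" using k unfolding b_def[symmetric] by real_asymp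
    then have "(\<lambda>k'. ereal (ln (real k') / b)) \<longlonglongrightarrow> \<infinity>" by (simp add: tendsto_PInfty_eq_at_top)
    then show ?thesis by (intro lim_imp_Liminf) auto
  qed
  finally show False using eta by (simp add: eta_star_def)
qed

text \<open>Choosing \<open>ln lam\<close> strictly between \<open>ln (1 / beta k)\<close> and
  \<open>ln k / t\<close> leaves room on both sides: \<open>1 / lam < beta k\<close> yields an
  admissible \<open>c > 1 / lam\<close>, and \<open>ln k / ln lam\<close> still exceeds
  \<open>t\<close>.\<close>

lemma eta_star_witness:
  assumes eta: "0 < eta_star" and e: "0 < e"
  obtains k c lam where "1 \<le> k" "0 < c" "1 < lam" "1 < c * lam" "eta_star - e < ln (real k) / ln lam"
    "((\<lambda>D. measure_pmf.prob (randA_window_pmf D c) {S. k \<le> mEq S}) \<longlongrightarrow> 1) at_top"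
proof -
  let ?f = "\<lambda>k. ereal (ln (real k) / ln (1 / beta k))"
  \<comment> \<open>An infinite lower limit would be mapped to 0 by
    \<open>real_of_ereal\<close>.\<close>
  have "liminf ?f = ereal eta_star"
    using eta unfolding eta_star_def by (cases "liminf ?f") auto
  moreover define t where "t = max (eta_star / 2) (eta_star - e)"
  moreover have t: "0 < t" "t < eta_star" "eta_star - e \<le> t" using eta e by (auto simp: t_def)
  ultimately have "ereal t < liminf ?f" by simp
  then have "\<forall>\<^sub>F k in sequentially. ereal t < ?f k" by (rule less_LiminfD)
  then have "\<forall>\<^sub>F k in sequentially. 2 \<le> k \<and> ereal t < ?f k" using eventually_ge_at_top[of 2] by eventually_elim simp
  then obtain k where k: "2 \<le> k" "t < ln (real k) / ln (1 / beta k)"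
    unfolding eventually_sequentially by auto
  define b where "b = ln (1 / beta k)"
  have lk: "0 < ln (real k)" using k by simp
  have b0: "0 < b"
  proof (rule ccontr)
    assume "\<not> 0 < b"
    then have "ln (real k) / b \<le> 0" using lk by (simp add: divide_nonneg_nonpos)
    then show False using k t by (simp add: b_def)
  qed
  have ne: "beta_set k \<noteq> {}" by (rule beta_set_nonempty[OF eta k(1)]) (use b0 b_def in simp)
  \<comment> \<open>As \<open>1 / 0 = 0\<close> and \<open>ln 0 = 0\<close>, a vanishing
    \<open>beta k\<close> would give \<open>b = 0\<close>.\<close>
  have "beta k \<noteq> 0" using b0 by (auto simp: b_def)
  then have be: "0 < beta k" using beta_nonneg[OF ne] by simp
  have "b < ln k / t" using k(2) b0 t by (simp add: b_def field_simps)
  then obtain s where s: "b < s" "s < ln k / t" using dense by blast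
  have s0: "0 < s" using s b0 by linarith
  have "1 / beta k = exp b" using be by (simp add: b_def)
  then have "1 / beta k < exp s" using s by simp
  then have "1 / exp s < beta k" using be by (simp add: field_simps)
  then obtain c where c: "c \<in> beta_set k" "1 / exp s < c"
    unfolding beta_def using ne less_cSupE by blast
  show ?thesis
  proof
    show "1 \<le> k" using k by simp
    have "0 < 1 / exp s" by simp
    then show "0 < c" using c(2) by linarith
    show "1 < exp s" using s0 by simp
    show "1 < c * exp s" using c(2) by (simp add: field_simps)
    have "t < ln k / s" using s t s0 by (simp add: field_simps)
    then show "eta_star - e < ln (real k) / ln (exp s)" using t by simp
    show "((\<lambda>D. measure_pmf.prob (randA_window_pmf D c) {S. k \<le> mEq S}) \<longlongrightarrow> 1) at_top" using c by simp
  qed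
qed

text \<open>The family consisting of the empty set alone has equal sums. The index 1 is the choice
  when \<open>eta_star \<le> 0\<close>.\<close>

lemma prob_mEq_ge_1:
  "measure_pmf.prob (randA_window_pmf D c) {S. 1 \<le> mEq S} = 1"
proof -
  have "1 \<le> mEq A" if "A \<subseteq> window D c" for A
    using finite_subset[OF that finite_window] by (subst mEq_ge_iff) (auto intro!: exI[of _ "{{}}"])
  then have "Esub (window D c) (\<lambda>a. 1 / real a) (\<lambda>A. of_bool (1 \<le> mEq A)) = Esub (window D c) (\<lambda>a. 1 / real a) (\<lambda>A. 1)"
    by (intro Esub_cong) auto
  then show ?thesis unfolding prob_randA by (simp add: Esub_const)
qed

theorem theorem2p2:
  shows "\<forall>\<epsilon>>0. \<exists>C>0. \<forall>(x::real)>0. \<forall>r::int.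
     (1 + \<epsilon>) * Log2 x \<le> real_of_int r \<and> real_of_int r \<le> (2 - \<epsilon>) * Log2 x \<longrightarrow>
     measure_pmf.expectation (n_lt_pmf x)
        (\<lambda>n. real (Delta n) * (if int (omega n) = r then 1 else 0))
       \<ge> C * Log2 x powr (eta_star - \<epsilon>)"
proof (intro allI impI)
  fix \<epsilon> :: real assume eps: "\<epsilon> > 0"
  \<comment> \<open>One half of \<open>\<epsilon>\<close> is spent on approximating
    \<open>eta_star\<close>, the other on the loss in the lower bound, which is available for
    \<open>e \<le> 1 / 4\<close>.\<close>
  define e where "e = min (\<epsilon> / 2) (1 / 4)"
  have e: "0 < e" "e \<le> 1 / 4" "e \<le> \<epsilon> / 2" "e \<le> \<epsilon>" using eps by (auto simp: e_def)
  obtain k c lam where kcl: "1 \<le> k" "0 < c" "1 < lam" "1 < c * lam"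
      "((\<lambda>D. measure_pmf.prob (randA_window_pmf D c) {S. k \<le> mEq S}) \<longlongrightarrow> 1) at_top"
      and eta: "eta_star - \<epsilon> / 2 \<le> ln (real k) / ln lam"
  proof (cases "0 < eta_star")
    case True
    obtain k c lam where "1 \<le> k" "0 < c" "1 < lam" "1 < c * lam" "eta_star - \<epsilon> / 2 < ln (real k) / ln lam"
      "((\<lambda>D. measure_pmf.prob (randA_window_pmf D c) {S. k \<le> mEq S}) \<longlongrightarrow> 1) at_top"
      using eta_star_witness[OF True, of "\<epsilon> / 2"] eps by auto
    then show ?thesis using that[of k c lam] by simp
  next
    case False
    \<comment> \<open>With \<open>k = 1\<close> the exponent is 0; \<open>c = 1 / 2\<close> and
      \<open>lam = 4\<close> are any values with \<open>c * lam > 1\<close>.\<close>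
    show ?thesis
      by (rule that[of 1 "1 / 2" 4]) (use False eps prob_mEq_ge_1 in auto)
  qed
  obtain C where C: "C > 0" "\<And>x r. (1 + e) * Log2 x \<le> real_of_int r \<and> real_of_int r \<le> (2 - e) * Log2 x \<and> x > 0 \<longrightarrow>
     C * Log2 x powr (ln k / ln lam - e)
       \<le> measure_pmf.expectation (n_lt_pmf x) (\<lambda>n. real (Delta n) * (if int (omega n) = r then 1 else 0))"
    using expectation_lower_bound[OF kcl(1-4) e(1,2) kcl(5)] by blast
  show "\<exists>C>0. \<forall>(x::real)>0. \<forall>r::int.
     (1 + \<epsilon>) * Log2 x \<le> real_of_int r \<and> real_of_int r \<le> (2 - \<epsilon>) * Log2 x \<longrightarrow>
     measure_pmf.expectation (n_lt_pmf x)
        (\<lambda>n. real (Delta n) * (if int (omega n) = r then 1 else 0))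
       \<ge> C * Log2 x powr (eta_star - \<epsilon>)"
  proof (intro exI[of _ C] conjI allI impI)
    fix x :: real and r :: int
    assume x: "0 < x" and r: "(1 + \<epsilon>) * Log2 x \<le> real_of_int r \<and> real_of_int r \<le> (2 - \<epsilon>) * Log2 x"
    have L: "1 \<le> Log2 x" by (simp add: Log2_def LogM_def)
    have "(1 + e) * Log2 x \<le> (1 + \<epsilon>) * Log2 x" "(2 - \<epsilon>) * Log2 x \<le> (2 - e) * Log2 x"
      using L e by (auto intro!: mult_right_mono)
    then have "C * Log2 x powr (ln k / ln lam - e)
       \<le> measure_pmf.expectation (n_lt_pmf x) (\<lambda>n. real (Delta n) * (if int (omega n) = r then 1 else 0))"
      using C(2)[of x r] x r by linarith
    moreover have "C * Log2 x powr (eta_star - \<epsilon>) \<le> C * Log2 x powr (ln k / ln lam - e)"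
      using L C(1) eta e by (intro mult_left_mono powr_mono) auto
    ultimately show "measure_pmf.expectation (n_lt_pmf x) (\<lambda>n. real (Delta n) * (if int (omega n) = r then 1 else 0))
       \<ge> C * Log2 x powr (eta_star - \<epsilon>)" by linarith
  qed (use C in auto)
qed

end
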